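(* Let $\mathfrak a$ be a $\mathcal U$-graded category, let $(\mathcal Z,\mathcal V)$ be an ideal-subcategory decomposition of $\mathcal U$, let $\varphi:\mathcal V\subseteq\mathcal U$ be the inclusion, $\mathfrak b=\mathfrak a|_{\mathcal V}$, and let $M$ be an $\mathfrak a$-bimodule. The exact sequences of complexes $$0\to\mathbf C_{\mathcal U\setminus\mathcal V}(\mathfrak a,M)\to\mathbf C_{\mathcal U}(\mathfrak a,M)\to\mathbf C_{\mathcal V}(\mathfrak b,M|_{\mathcal V})\to0$$ and $$0\to\mathbf C_{\mathcal U}(\mathfrak a,M_{\mathcal Z})\to\mathbf C_{\mathcal U}(\mathfrak a,M)\to\mathbf C_{\mathcal U}(\mathfrak a,M_{\mathcal V})\to0$$ are canonically isomorphic.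
   Context: Fix a commutative ring $k$. For a small category $\mathcal U$, a ($k$-linear) $\mathcal U$-graded category $\mathfrak a$ consists of a set $\mathfrak a_U$ for each object $U$; a $k$-module $\mathfrak a_u(A,A')$ for each $u:U\to U'$, $A\in\mathfrak a_U$, $A'\in\mathfrak a_{U'}$; compositions $\mathfrak a_{u'}(A',A'')\otimes_k\mathfrak a_u(A,A')\to\mathfrak a_{u'u}(A,A'')$ and identities $1_A\in\mathfrak a_{1_U}(A,A)$, associative and unital. An $\mathfrak a$-bimodule $M$ consists of $k$-modules $M_u(A,A')$ with associative unital left and right actions of $\mathfrak a$ (compatible with composition in $\mathcal U$). An ideal $\mathcal Z$ in $\mathcal U$ consists of subsets $\mathcal Z(V,U)\subseteq\mathcal U(V,U)$ with $uzv\in\mathcal Z$ whenever $z\in\mathcal Z$ and $u,v$ are composable morphisms of $\mathcal U$. An ideal-subcategory decomposition $(\mathcal Z,\mathcal V)$ of $\mathcal U$ is an ideal $\mathcal Z$ and a subcategory $\mathcal V\subseteq\mathcal U$ such that $\mathrm{Mor}(\mathcal U)=\mathrm{Mor}(\mathcal V)\sqcup\mathrm{Mor}(\mathcal Z)$ (disjoint union). $\mathfrak a|_{\mathcal V}$ and $M|_{\mathcal V}$ are the restrictions of $\mathfrak a$ and $M$ to objects and morphisms in $\mathcal V$. $M_{\mathcal Z}\subseteq M$ is the sub-bimodule obtained by changing the values of $M$ to zero outside $\mathcal Z$, and $M\to M_{\mathcal V}$ is the quotient bimodule obtained by changing the values of $M$ to zero outside $\mathcal V$; so $0\to M_{\mathcal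 Z}\to M\to M_{\mathcal V}\to0$ is exact, and induces the second sequence. An $n$-simplex $(u,A)$ of $\mathfrak a$ consists of $U_0\xrightarrow{u_0}\cdots\xrightarrow{u_{n-1}}U_n$ in $\mathcal U$ and $A_i\in\mathfrak a_{U_i}$; $|u|=u_{n-1}\cdots u_0$ (identity of $U_0$ if $n=0$). The Hochschild complex is $\mathbf C^n_{\mathcal U}(\mathfrak a,M)=\prod_{(u,A)}\mathrm{Hom}_k(\mathfrak a_{u_{n-1}}(A_{n-1},A_n)\otimes\cdots\otimes\mathfrak a_{u_0}(A_0,A_1),M_{|u|}(A_0,A_n))$ with the Hochschild differential. The map $\mathbf C_{\mathcal U}(\mathfrak a,M)\to\mathbf C_{\mathcal V}(\mathfrak b,M|_{\mathcal V})$ is the projection onto the factors indexed by simplices in $\mathcal V$, and $\mathbf C_{\mathcal U\setminus\mathcal V}(\mathfrak a,M)$ is its kernel (Hochschild complex of $\mathfrak a$ with support outside $\mathcal V$). *)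

theory Defs
  imports "HOL-Algebra.Module" "HOL-Algebra.AbelCoset"
begin

section \<open>Small categories, ideals and subcategories\<close>

record ('o, 'f) cat =
  Obj :: "'o set"
  Mor :: "'f set"
  Dom :: "'f \<Rightarrow> 'o"
  Cod :: "'f \<Rightarrow> 'o"
  Ident :: "'o \<Rightarrow> 'f"
  Comp :: "'f \<Rightarrow> 'f \<Rightarrow> 'f"  \<comment> \<open>\<open>Comp C g f\<close> is \<open>g\<close> after \<open>f\<close>\<close>

locale small_category =
  fixes C :: "('o, 'f) cat"
  assumes dom_closed: "f \<in> Mor C \<Longrightarrow> Dom C f \<in> Obj C"
    and cod_closed: "f \<in> Mor C \<Longrightarrow> Cod C f \<in> Obj C"
    and ident_closed: "U \<in> Obj C \<Longrightarrow> Ident C U \<in> Mor C"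
    and dom_ident: "U \<in> Obj C \<Longrightarrow> Dom C (Ident C U) = U"
    and cod_ident: "U \<in> Obj C \<Longrightarrow> Cod C (Ident C U) = U"
    and comp_closed: "\<lbrakk>f \<in> Mor C; g \<in> Mor C; Dom C g = Cod C f\<rbrakk> \<Longrightarrow> Comp C g f \<in> Mor C"
    and dom_comp: "\<lbrakk>f \<in> Mor C; g \<in> Mor C; Dom C g = Cod C f\<rbrakk> \<Longrightarrow> Dom C (Comp C g f) = Dom C f"
    and cod_comp: "\<lbrakk>f \<in> Mor C; g \<in> Mor C; Dom C g = Cod C f\<rbrakk> \<Longrightarrow> Cod C (Comp C g f) = Cod C g"
    and comp_ident_right: "f \<in> Mor C \<Longrightarrow> Comp C f (Ident C (Dom C f)) = f"
    and comp_ident_left: "f \<in> Mor C \<Longrightarrow> Comp C (Ident C (Cod C f)) f = f"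
    and comp_assoc: "\<lbrakk>f \<in> Mor C; g \<in> Mor C; h \<in> Mor C; Dom C g = Cod C f; Dom C h = Cod C g\<rbrakk>
        \<Longrightarrow> Comp C h (Comp C g f) = Comp C (Comp C h g) f"

definition subcategory :: "('o, 'f) cat \<Rightarrow> ('o, 'f) cat \<Rightarrow> bool" where
  "subcategory V U \<longleftrightarrow>
     small_category V \<and> Obj V \<subseteq> Obj U \<and> Mor V \<subseteq> Mor U \<and>
     (\<forall>f\<in>Mor V. Dom V f = Dom U f \<and> Cod V f = Cod U f) \<and>
     (\<forall>X\<in>Obj V. Ident V X = Ident U X) \<and>
     (\<forall>f\<in>Mor V. \<forall>g\<in>Mor V. Dom V g = Cod V f \<longrightarrow> Comp V g f = Comp U g f)"

text \<open>
  An ideal is encoded by the set of all its morphisms; its component from \<open>U\<close> to \<open>V\<close>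
  consists of the members with domain \<open>U\<close> and codomain \<open>V\<close>.
\<close>

definition cat_ideal :: "('o, 'f) cat \<Rightarrow> 'f set \<Rightarrow> bool" where
  "cat_ideal U Z \<longleftrightarrow>
     Z \<subseteq> Mor U \<and>
     (\<forall>z\<in>Z. \<forall>u\<in>Mor U. \<forall>v\<in>Mor U. Dom U u = Cod U z \<longrightarrow> Dom U z = Cod U v \<longrightarrow>
        Comp U u (Comp U z v) \<in> Z)"

definition ideal_subcategory_decomposition :: "('o, 'f) cat \<Rightarrow> 'f set \<Rightarrow> ('o, 'f) cat \<Rightarrow> bool" where
  "ideal_subcategory_decomposition U Z V \<longleftrightarrow>
     cat_ideal U Z \<and> subcategory V U \<and> Mor U = Mor V \<union> Z \<and> Mor V \<inter> Z = {}"


section \<open>Linear and multilinear maps between modules\<close>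

definition linear_maps ::
  "('k, 'r) ring_scheme \<Rightarrow> ('k, 'a, 's) module_scheme \<Rightarrow> ('k, 'b, 't) module_scheme \<Rightarrow> ('a \<Rightarrow> 'b) set"
  where
  "linear_maps k M N =
     {f \<in> carrier M \<rightarrow> carrier N.
        (\<forall>x\<in>carrier M. \<forall>y\<in>carrier M. f (x \<oplus>\<^bsub>M\<^esub> y) = f x \<oplus>\<^bsub>N\<^esub> f y) \<and>
        (\<forall>c\<in>carrier k. \<forall>x\<in>carrier M. f (c \<odot>\<^bsub>M\<^esub> x) = c \<odot>\<^bsub>N\<^esub> f x)}"

definition bilinear_maps ::
  "('k, 'r) ring_scheme \<Rightarrow> ('k, 'a, 's) module_scheme \<Rightarrow> ('k, 'b, 't) module_scheme \<Rightarrow>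
   ('k, 'c, 'u) module_scheme \<Rightarrow> ('a \<Rightarrow> 'b \<Rightarrow> 'c) set" where
  "bilinear_maps k M N P =
     {f. (\<forall>x\<in>carrier M. (\<lambda>y. f x y) \<in> linear_maps k N P) \<and>
         (\<forall>y\<in>carrier N. (\<lambda>x. f x y) \<in> linear_maps k M P)}"

text \<open>
  Products of modules. The fields \<open>mult\<close> and \<open>one\<close>, which the record of modules inherits
  from rings, play no role for modules and are left unspecified.
\<close>

definition product_module :: "'i set \<Rightarrow> ('i \<Rightarrow> ('k, 'm) module) \<Rightarrow> ('k, 'i \<Rightarrow> 'm) module" where
  "product_module I N =
     \<lparr>carrier = (\<Pi>\<^sub>E i\<in>I. carrier (N i)),
      mult = undefined,
      one = undefined,
      zero = (\<lambda>i\<in>I. \<zero>\<^bsub>N i\<^esub>),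
      add = (\<lambda>f g. \<lambda>i\<in>I. f i \<oplus>\<^bsub>N i\<^esub> g i),
      smult = (\<lambda>c f. \<lambda>i\<in>I. c \<odot>\<^bsub>N i\<^esub> f i)\<rparr>"

text \<open>
  The module \<open>Hom\<^sub>k(V\<^sub>n\<^sub>-\<^sub>1 \<otimes> \<dots> \<otimes> V\<^sub>0, N)\<close>, each linear map being given by its values on pure
  tensors, that is, as a \<open>k\<close>-multilinear map. The list \<open>[x\<^sub>0, \<dots>, x\<^sub>n\<^sub>-\<^sub>1]\<close> stands for the
  tensor \<open>x\<^sub>n\<^sub>-\<^sub>1 \<otimes> \<dots> \<otimes> x\<^sub>0\<close>. For the empty list of modules (empty tensor product \<open>k\<close>) a member
  is just an element of \<open>N\<close>, as the value at \<open>[]\<close>.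
\<close>

definition multilinear_module ::
  "('k, 'r) ring_scheme \<Rightarrow> ('k, 'a) module list \<Rightarrow> ('k, 'm) module \<Rightarrow> ('k, 'a list \<Rightarrow> 'm) module" where
  "multilinear_module k Vs N =
     (product_module (listset (map carrier Vs)) (\<lambda>_. N))
       \<lparr>carrier :=
          {f \<in> listset (map carrier Vs) \<rightarrow>\<^sub>E carrier N.
             \<forall>i<length Vs. \<forall>xs\<in>listset (map carrier Vs).
               (\<lambda>x. f (xs[i := x])) \<in> linear_maps k (Vs ! i) N}\<rparr>"


section \<open>Graded categories and bimodules\<close>

text \<open>
  \<open>GHom a u A A'\<close> is the module of \<open>u\<close>-graded morphisms from \<open>A\<close> to \<open>A'\<close>, and
  \<open>GComp a u' u A A' A'' y x\<close> is the composite \<open>y x\<close> of \<open>x\<close> in degree \<open>u\<close> from \<open>A\<close> to \<open>A'\<close> and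
  \<open>y\<close> in degree \<open>u'\<close> from \<open>A'\<close> to \<open>A''\<close>.
\<close>

record ('k, 'o, 'f, 'x, 'a) graded_cat =
  GObj :: "'o \<Rightarrow> 'x set"
  GHom :: "'f \<Rightarrow> 'x \<Rightarrow> 'x \<Rightarrow> ('k, 'a) module"
  GComp :: "'f \<Rightarrow> 'f \<Rightarrow> 'x \<Rightarrow> 'x \<Rightarrow> 'x \<Rightarrow> 'a \<Rightarrow> 'a \<Rightarrow> 'a"
  GIdent :: "'o \<Rightarrow> 'x \<Rightarrow> 'a"

locale graded_category = small_category U
  for k :: "('k, 'r) ring_scheme"
    and U :: "('o, 'f) cat"
    and a :: "('k, 'o, 'f, 'x, 'a) graded_cat" +
  assumes base_ring: "cring k"
    and hom_module:
      "\<lbrakk>u \<in> Mor U; A \<in> GObj a (Dom U u); A' \<in> GObj a (Cod U u)\<rbrakk> \<Longrightarrow> module k (GHom a u A A')"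
    and comp_bilinear:
      "\<lbrakk>u \<in> Mor U; u' \<in> Mor U; Dom U u' = Cod U u;
        A \<in> GObj a (Dom U u); A' \<in> GObj a (Cod U u); A'' \<in> GObj a (Cod U u')\<rbrakk> \<Longrightarrow>
       GComp a u' u A A' A''
         \<in> bilinear_maps k (GHom a u' A' A'') (GHom a u A A') (GHom a (Comp U u' u) A A'')"
    and gident_closed:
      "\<lbrakk>X \<in> Obj U; A \<in> GObj a X\<rbrakk> \<Longrightarrow> GIdent a X A \<in> carrier (GHom a (Ident U X) A A)"
    and gcomp_assoc:
      "\<lbrakk>u \<in> Mor U; u' \<in> Mor U; u'' \<in> Mor U; Dom U u' = Cod U u; Dom U u'' = Cod U u';
        A \<in> GObj a (Dom U u); A' \<in> GObj a (Cod U u); A'' \<in> GObj a (Cod U u');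
        A''' \<in> GObj a (Cod U u'');
        x \<in> carrier (GHom a u A A'); y \<in> carrier (GHom a u' A' A'');
        z \<in> carrier (GHom a u'' A'' A''')\<rbrakk> \<Longrightarrow>
       GComp a u'' (Comp U u' u) A A'' A''' z (GComp a u' u A A' A'' y x)
         = GComp a (Comp U u'' u') u A A' A''' (GComp a u'' u' A' A'' A''' z y) x"
    and gcomp_ident_left:
      "\<lbrakk>u \<in> Mor U; A \<in> GObj a (Dom U u); A' \<in> GObj a (Cod U u); x \<in> carrier (GHom a u A A')\<rbrakk> \<Longrightarrow>
       GComp a (Ident U (Cod U u)) u A A' A' (GIdent a (Cod U u) A') x = x"
    and gcomp_ident_right:
      "\<lbrakk>u \<in> Mor U; A \<in> GObj a (Dom U u); A' \<in> GObj a (Cod U u); x \<in> carrier (GHom a u A A')\<rbrakk> \<Longrightarrow>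
       GComp a u (Ident U (Dom U u)) A A A' x (GIdent a (Dom U u) A) = x"

text \<open>
  \<open>LAct M u' u A A' A'' y m\<close> is the product \<open>y m\<close> for \<open>y \<in> \<aa>\<^sub>u\<^sub>'(A', A'')\<close> and \<open>m \<in> M\<^sub>u(A, A')\<close>, while
  \<open>RAct M u' u A A' A'' m x\<close> is the product \<open>m x\<close> for \<open>m \<in> M\<^sub>u\<^sub>'(A', A'')\<close> and \<open>x \<in> \<aa>\<^sub>u(A, A')\<close>.
\<close>

record ('k, 'f, 'x, 'a, 'm) bimod =
  BHom :: "'f \<Rightarrow> 'x \<Rightarrow> 'x \<Rightarrow> ('k, 'm) module"
  LAct :: "'f \<Rightarrow> 'f \<Rightarrow> 'x \<Rightarrow> 'x \<Rightarrow> 'x \<Rightarrow> 'a \<Rightarrow> 'm \<Rightarrow> 'm"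
  RAct :: "'f \<Rightarrow> 'f \<Rightarrow> 'x \<Rightarrow> 'x \<Rightarrow> 'x \<Rightarrow> 'm \<Rightarrow> 'a \<Rightarrow> 'm"

locale bimodule = graded_category k U a
  for k :: "('k, 'r) ring_scheme"
    and U :: "('o, 'f) cat"
    and a :: "('k, 'o, 'f, 'x, 'a) graded_cat"
    and M :: "('k, 'f, 'x, 'a, 'm) bimod" +
  assumes bhom_module:
      "\<lbrakk>u \<in> Mor U; A \<in> GObj a (Dom U u); A' \<in> GObj a (Cod U u)\<rbrakk> \<Longrightarrow> module k (BHom M u A A')"
    and lact_bilinear:
      "\<lbrakk>u \<in> Mor U; u' \<in> Mor U; Dom U u' = Cod U u;
        A \<in> GObj a (Dom U u); A' \<in> GObj a (Cod U u); A'' \<in> GObj a (Cod U u')\<rbrakk> \<Longrightarrow>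
       LAct M u' u A A' A''
         \<in> bilinear_maps k (GHom a u' A' A'') (BHom M u A A') (BHom M (Comp U u' u) A A'')"
    and ract_bilinear:
      "\<lbrakk>u \<in> Mor U; u' \<in> Mor U; Dom U u' = Cod U u;
        A \<in> GObj a (Dom U u); A' \<in> GObj a (Cod U u); A'' \<in> GObj a (Cod U u')\<rbrakk> \<Longrightarrow>
       RAct M u' u A A' A''
         \<in> bilinear_maps k (BHom M u' A' A'') (GHom a u A A') (BHom M (Comp U u' u) A A'')"
    and lact_assoc:
      "\<lbrakk>u \<in> Mor U; u' \<in> Mor U; u'' \<in> Mor U; Dom U u' = Cod U u; Dom U u'' = Cod U u';
        A \<in> GObj a (Dom U u); A' \<in> GObj a (Cod U u); A'' \<in> GObj a (Cod U u');
        A''' \<in> GObj a (Cod U u'');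
        m \<in> carrier (BHom M u A A'); y \<in> carrier (GHom a u' A' A'');
        z \<in> carrier (GHom a u'' A'' A''')\<rbrakk> \<Longrightarrow>
       LAct M u'' (Comp U u' u) A A'' A''' z (LAct M u' u A A' A'' y m)
         = LAct M (Comp U u'' u') u A A' A''' (GComp a u'' u' A' A'' A''' z y) m"
    and lact_ract_assoc:
      "\<lbrakk>u \<in> Mor U; u' \<in> Mor U; u'' \<in> Mor U; Dom U u' = Cod U u; Dom U u'' = Cod U u';
        A \<in> GObj a (Dom U u); A' \<in> GObj a (Cod U u); A'' \<in> GObj a (Cod U u');
        A''' \<in> GObj a (Cod U u'');
        x \<in> carrier (GHom a u A A'); m \<in> carrier (BHom M u' A' A'');
        z \<in> carrier (GHom a u'' A'' A''')\<rbrakk> \<Longrightarrow>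
       LAct M u'' (Comp U u' u) A A'' A''' z (RAct M u' u A A' A'' m x)
         = RAct M (Comp U u'' u') u A A' A''' (LAct M u'' u' A' A'' A''' z m) x"
    and ract_assoc:
      "\<lbrakk>u \<in> Mor U; u' \<in> Mor U; u'' \<in> Mor U; Dom U u' = Cod U u; Dom U u'' = Cod U u';
        A \<in> GObj a (Dom U u); A' \<in> GObj a (Cod U u); A'' \<in> GObj a (Cod U u');
        A''' \<in> GObj a (Cod U u'');
        x \<in> carrier (GHom a u A A'); y \<in> carrier (GHom a u' A' A'');
        m \<in> carrier (BHom M u'' A'' A''')\<rbrakk> \<Longrightarrow>
       RAct M u'' (Comp U u' u) A A'' A''' m (GComp a u' u A A' A'' y x)
         = RAct M (Comp U u'' u') u A A' A''' (RAct M u'' u' A' A'' A''' m y) x"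
    and lact_ident:
      "\<lbrakk>u \<in> Mor U; A \<in> GObj a (Dom U u); A' \<in> GObj a (Cod U u); m \<in> carrier (BHom M u A A')\<rbrakk> \<Longrightarrow>
       LAct M (Ident U (Cod U u)) u A A' A' (GIdent a (Cod U u) A') m = m"
    and ract_ident:
      "\<lbrakk>u \<in> Mor U; A \<in> GObj a (Dom U u); A' \<in> GObj a (Cod U u); m \<in> carrier (BHom M u A A')\<rbrakk> \<Longrightarrow>
       RAct M u (Ident U (Dom U u)) A A A' m (GIdent a (Dom U u) A) = m"

definition restrict_graded_cat ::
  "('o, 'f) cat \<Rightarrow> ('k, 'o, 'f, 'x, 'a) graded_cat \<Rightarrow> ('k, 'o, 'f, 'x, 'a) graded_cat" where
  "restrict_graded_cat V a =
     \<lparr>GObj = restrict (GObj a) (Obj V),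
      GHom = restrict (GHom a) (Mor V),
      GComp = (\<lambda>u'\<in>Mor V. \<lambda>u\<in>Mor V. GComp a u' u),
      GIdent = restrict (GIdent a) (Obj V)\<rparr>"

definition restrict_bimod ::
  "('o, 'f) cat \<Rightarrow> ('k, 'f, 'x, 'a, 'm) bimod \<Rightarrow> ('k, 'f, 'x, 'a, 'm) bimod" where
  "restrict_bimod V M =
     \<lparr>BHom = restrict (BHom M) (Mor V),
      LAct = (\<lambda>u'\<in>Mor V. \<lambda>u\<in>Mor V. LAct M u' u),
      RAct = (\<lambda>u'\<in>Mor V. \<lambda>u\<in>Mor V. RAct M u' u)\<rparr>"

definition zero_submodule :: "('k, 'm) module \<Rightarrow> ('k, 'm) module" where
  "zero_submodule N = N\<lparr>carrier := {\<zero>\<^bsub>N\<^esub>}\<rparr>"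

text \<open>
  The sub-bimodule \<open>M\<^sub>Z\<close> has the actions of \<open>M\<close>. In the quotient \<open>M\<^sub>V\<close> an action whose result
  has a degree outside \<open>V\<close> takes the value zero.
\<close>

definition ideal_bimod ::
  "'f set \<Rightarrow> ('k, 'f, 'x, 'a, 'm) bimod \<Rightarrow> ('k, 'f, 'x, 'a, 'm) bimod" where
  "ideal_bimod Z M =
     M\<lparr>BHom := (\<lambda>u A A'. if u \<in> Z then BHom M u A A' else zero_submodule (BHom M u A A'))\<rparr>"

definition quotient_bimod ::
  "('o, 'f) cat \<Rightarrow> ('o, 'f) cat \<Rightarrow> ('k, 'f, 'x, 'a, 'm) bimod \<Rightarrow> ('k, 'f, 'x, 'a, 'm) bimod" where
  "quotient_bimod U V M =
     \<lparr>BHom = (\<lambda>u A A'. if u \<in> Mor V then BHom M u A A' else zero_submodule (BHom M u A A')),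
      LAct = (\<lambda>u' u A A' A'' y m. if Comp U u' u \<in> Mor V then LAct M u' u A A' A'' y m
                else \<zero>\<^bsub>BHom M (Comp U u' u) A A''\<^esub>),
      RAct = (\<lambda>u' u A A' A'' m x. if Comp U u' u \<in> Mor V then RAct M u' u A A' A'' m x
                else \<zero>\<^bsub>BHom M (Comp U u' u) A A''\<^esub>)\<rparr>"

definition ideal_inclusion :: "'f \<Rightarrow> 'x \<Rightarrow> 'x \<Rightarrow> 'm \<Rightarrow> 'm" where
  "ideal_inclusion u A A' m = m"

definition quotient_projection ::
  "('o, 'f) cat \<Rightarrow> ('k, 'f, 'x, 'a, 'm) bimod \<Rightarrow> 'f \<Rightarrow> 'x \<Rightarrow> 'x \<Rightarrow> 'm \<Rightarrow> 'm" where
  "quotient_projection V M u A A' m = (if u \<in> Mor V then m else \<zero>\<^bsub>BHom M u A A'\<^esub>)"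


section \<open>Short exact sequences of cochain complexes\<close>

text \<open>
  Complexes are concentrated in degrees \<open>n \<ge> 0\<close>. Chain maps are extensional functions, so that
  equality of chain maps is equality on the carriers.
\<close>

record ('k, 'c) cochain_complex =
  Deg :: "nat \<Rightarrow> ('k, 'c) module"
  Diff :: "nat \<Rightarrow> 'c \<Rightarrow> 'c"

definition is_complex :: "('k, 'r) ring_scheme \<Rightarrow> ('k, 'c) cochain_complex \<Rightarrow> bool" where
  "is_complex k C \<longleftrightarrow>
     (\<forall>n. module k (Deg C n) \<and>
          Diff C n \<in> linear_maps k (Deg C n) (Deg C (Suc n)) \<and>
          (\<forall>x\<in>carrier (Deg C n). Diff C (Suc n) (Diff C n x) = \<zero>\<^bsub>Deg C (Suc (Suc n))\<^esub>))"

definition chain_maps ::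
  "('k, 'r) ring_scheme \<Rightarrow> ('k, 'c) cochain_complex \<Rightarrow> ('k, 'd) cochain_complex \<Rightarrow>
   (nat \<Rightarrow> 'c \<Rightarrow> 'd) set" where
  "chain_maps k C D =
     {f. \<forall>n. f n \<in> linear_maps k (Deg C n) (Deg D n) \<and> f n \<in> extensional (carrier (Deg C n)) \<and>
             (\<forall>x\<in>carrier (Deg C n). f (Suc n) (Diff C n x) = Diff D n (f n x))}"

definition chain_isos ::
  "('k, 'r) ring_scheme \<Rightarrow> ('k, 'c) cochain_complex \<Rightarrow> ('k, 'd) cochain_complex \<Rightarrow>
   (nat \<Rightarrow> 'c \<Rightarrow> 'd) set" where
  "chain_isos k C D =
     {f \<in> chain_maps k C D. \<forall>n. bij_betw (f n) (carrier (Deg C n)) (carrier (Deg D n))}"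

definition identity_chain_map :: "('k, 'c) cochain_complex \<Rightarrow> nat \<Rightarrow> 'c \<Rightarrow> 'c" where
  "identity_chain_map C n = (\<lambda>x\<in>carrier (Deg C n). x)"

text \<open>The kernel of a chain map \<open>f\<close> from \<open>C\<close> to \<open>D\<close>, as a subcomplex of \<open>C\<close>.\<close>

definition kernel_complex ::
  "('k, 'c) cochain_complex \<Rightarrow> ('k, 'd) cochain_complex \<Rightarrow> (nat \<Rightarrow> 'c \<Rightarrow> 'd) \<Rightarrow>
   ('k, 'c) cochain_complex" where
  "kernel_complex C D f =
     \<lparr>Deg = (\<lambda>n. (Deg C n)\<lparr>carrier := a_kernel (Deg C n) (Deg D n) (f n)\<rparr>),
      Diff = (\<lambda>n. restrict (Diff C n) (a_kernel (Deg C n) (Deg D n) (f n)))\<rparr>"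

record ('k, 'c, 'd, 'e) complex_sequence =
  Sub :: "('k, 'c) cochain_complex"
  Mid :: "('k, 'd) cochain_complex"
  Quo :: "('k, 'e) cochain_complex"
  Inc :: "nat \<Rightarrow> 'c \<Rightarrow> 'd"
  Prj :: "nat \<Rightarrow> 'd \<Rightarrow> 'e"

definition short_exact :: "('k, 'r) ring_scheme \<Rightarrow> ('k, 'c, 'd, 'e) complex_sequence \<Rightarrow> bool" where
  "short_exact k S \<longleftrightarrow>
     is_complex k (Sub S) \<and> is_complex k (Mid S) \<and> is_complex k (Quo S) \<and>
     Inc S \<in> chain_maps k (Sub S) (Mid S) \<and> Prj S \<in> chain_maps k (Mid S) (Quo S) \<and>
     (\<forall>n. inj_on (Inc S n) (carrier (Deg (Sub S) n)) \<and>
          Inc S n ` carrier (Deg (Sub S) n) = a_kernel (Deg (Mid S) n) (Deg (Quo S) n) (Prj S n) \<and>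
          Prj S n ` carrier (Deg (Mid S) n) = carrier (Deg (Quo S) n))"

definition sequence_isos ::
  "('k, 'r) ring_scheme \<Rightarrow> ('k, 'c, 'd, 'e) complex_sequence \<Rightarrow> ('k, 'c', 'd', 'e') complex_sequence \<Rightarrow>
   ((nat \<Rightarrow> 'c \<Rightarrow> 'c') \<times> (nat \<Rightarrow> 'd \<Rightarrow> 'd') \<times> (nat \<Rightarrow> 'e \<Rightarrow> 'e')) set" where
  "sequence_isos k S T =
     {(\<alpha>, \<beta>, \<gamma>).
        \<alpha> \<in> chain_isos k (Sub S) (Sub T) \<and> \<beta> \<in> chain_isos k (Mid S) (Mid T) \<and>
        \<gamma> \<in> chain_isos k (Quo S) (Quo T) \<and>
        (\<forall>n. \<forall>x\<in>carrier (Deg (Sub S) n). \<beta> n (Inc S n x) = Inc T n (\<alpha> n x)) \<and>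
        (\<forall>n. \<forall>x\<in>carrier (Deg (Mid S) n). \<gamma> n (Prj S n x) = Prj T n (\<beta> n x))}"


section \<open>The Hochschild complex\<close>

text \<open>
  An \<open>n\<close>-simplex is a triple \<open>([U\<^sub>0, \<dots>, U\<^sub>n], [u\<^sub>0, \<dots>, u\<^sub>n\<^sub>-\<^sub>1], [A\<^sub>0, \<dots>, A\<^sub>n])\<close>.
\<close>

type_synonym ('o, 'f, 'x) simplex = "'o list \<times> 'f list \<times> 'x list"

definition simplices ::
  "('o, 'f) cat \<Rightarrow> ('k, 'o, 'f, 'x, 'a) graded_cat \<Rightarrow> nat \<Rightarrow> ('o, 'f, 'x) simplex set" where
  "simplices C a n =
     {(Us, us, As). length Us = Suc n \<and> length us = n \<and> length As = Suc n \<and>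
        (\<forall>i\<le>n. Us ! i \<in> Obj C \<and> As ! i \<in> GObj a (Us ! i)) \<and>
        (\<forall>i<n. us ! i \<in> Mor C \<and> Dom C (us ! i) = Us ! i \<and> Cod C (us ! i) = Us ! Suc i)}"

text \<open>The composite \<open>|u| = u\<^sub>n\<^sub>-\<^sub>1 \<cdots> u\<^sub>0\<close>, the identity of \<open>U\<^sub>0\<close> for \<open>n = 0\<close>.\<close>

fun composite :: "('o, 'f) cat \<Rightarrow> ('o, 'f, 'x) simplex \<Rightarrow> 'f" where
  "composite C (Us, us, As) = foldl (\<lambda>w u. Comp C u w) (Ident C (hd Us)) us"

fun factors :: "('k, 'o, 'f, 'x, 'a) graded_cat \<Rightarrow> ('o, 'f, 'x) simplex \<Rightarrow> ('k, 'a) module list" where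
  "factors a (Us, us, As) = map (\<lambda>i. GHom a (us ! i) (As ! i) (As ! Suc i)) [0..<length us]"

fun target ::
  "('o, 'f) cat \<Rightarrow> ('k, 'f, 'x, 'a, 'm) bimod \<Rightarrow> ('o, 'f, 'x) simplex \<Rightarrow> ('k, 'm) module" where
  "target C M (Us, us, As) = BHom M (composite C (Us, us, As)) (hd As) (last As)"

abbreviation arguments ::
  "('k, 'o, 'f, 'x, 'a) graded_cat \<Rightarrow> ('o, 'f, 'x) simplex \<Rightarrow> 'a list set" where
  "arguments a \<sigma> \<equiv> listset (map carrier (factors a \<sigma>))"

definition cochains ::
  "('k, 'r) ring_scheme \<Rightarrow> ('o, 'f) cat \<Rightarrow> ('k, 'o, 'f, 'x, 'a) graded_cat \<Rightarrow>
   ('k, 'f, 'x, 'a, 'm) bimod \<Rightarrow> nat \<Rightarrow> ('k, ('o, 'f, 'x) simplex \<Rightarrow> 'a list \<Rightarrow> 'm) module" where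
  "cochains k C a M n =
     product_module (simplices C a n) (\<lambda>\<sigma>. multilinear_module k (factors a \<sigma>) (target C M \<sigma>))"

fun drop_first :: "('o, 'f, 'x) simplex \<Rightarrow> ('o, 'f, 'x) simplex" where
  "drop_first (Us, us, As) = (tl Us, tl us, tl As)"

fun drop_last :: "('o, 'f, 'x) simplex \<Rightarrow> ('o, 'f, 'x) simplex" where
  "drop_last (Us, us, As) = (butlast Us, butlast us, butlast As)"

text \<open>\<open>merge_at\<close> and \<open>merge_args\<close> replace the adjacent entries \<open>i\<close> and \<open>i + 1\<close> by their composite.\<close>

fun merge_at :: "('o, 'f) cat \<Rightarrow> nat \<Rightarrow> ('o, 'f, 'x) simplex \<Rightarrow> ('o, 'f, 'x) simplex" where
  "merge_at C i (Us, us, As) =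
     (take (Suc i) Us @ drop (i + 2) Us,
      take i us @ [Comp C (us ! Suc i) (us ! i)] @ drop (i + 2) us,
      take (Suc i) As @ drop (i + 2) As)"

fun merge_args ::
  "('k, 'o, 'f, 'x, 'a) graded_cat \<Rightarrow> nat \<Rightarrow> ('o, 'f, 'x) simplex \<Rightarrow> 'a list \<Rightarrow> 'a list" where
  "merge_args a i (Us, us, As) xs =
     take i xs @
     [GComp a (us ! Suc i) (us ! i) (As ! i) (As ! Suc i) (As ! (i + 2)) (xs ! Suc i) (xs ! i)] @
     drop (i + 2) xs"

definition signed :: "('k, 'm) module \<Rightarrow> nat \<Rightarrow> 'm \<Rightarrow> 'm" where
  "signed N j m = (if even j then m else \<ominus>\<^bsub>N\<^esub> m)"

text \<open>
  The Hochschild differential of an \<open>n\<close>-cochain \<open>\<phi>\<close>: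
  \<open>(d\<phi>)(x\<^sub>n, \<dots>, x\<^sub>0) = x\<^sub>n \<phi>(x\<^sub>n\<^sub>-\<^sub>1, \<dots>, x\<^sub>0)
     + \<Sum>\<^sub>i\<^sub><\<^sub>n (-1)\<^sup>n\<^sup>-\<^sup>i \<phi>(x\<^sub>n, \<dots>, x\<^sub>i\<^sub>+\<^sub>1 x\<^sub>i, \<dots>, x\<^sub>0) + (-1)\<^sup>n\<^sup>+\<^sup>1 \<phi>(x\<^sub>n, \<dots>, x\<^sub>1) x\<^sub>0\<close>.
\<close>

fun hochschild_value ::
  "('o, 'f) cat \<Rightarrow> ('k, 'o, 'f, 'x, 'a) graded_cat \<Rightarrow> ('k, 'f, 'x, 'a, 'm) bimod \<Rightarrow> nat \<Rightarrow>
   (('o, 'f, 'x) simplex \<Rightarrow> 'a list \<Rightarrow> 'm) \<Rightarrow> ('o, 'f, 'x) simplex \<Rightarrow> 'a list \<Rightarrow> 'm" where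
  "hochschild_value C a M n \<phi> (Us, us, As) xs =
     (let \<sigma> = (Us, us, As); N = target C M \<sigma> in
        LAct M (last us) (composite C (drop_last \<sigma>)) (As ! 0) (As ! n) (As ! Suc n)
          (last xs) (\<phi> (drop_last \<sigma>) (butlast xs))
        \<oplus>\<^bsub>N\<^esub> (\<Oplus>\<^bsub>N\<^esub> i\<in>{..<n}. signed N (n - i) (\<phi> (merge_at C i \<sigma>) (merge_args a i \<sigma> xs)))
        \<oplus>\<^bsub>N\<^esub> signed N (Suc n)
          (RAct M (composite C (drop_first \<sigma>)) (hd us) (As ! 0) (As ! 1) (As ! Suc n)
            (\<phi> (drop_first \<sigma>) (tl xs)) (hd xs)))"

definition hochschild_complex ::
  "('k, 'r) ring_scheme \<Rightarrow> ('o, 'f) cat \<Rightarrow> ('k, 'o, 'f, 'x, 'a) graded_cat \<Rightarrow>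
   ('k, 'f, 'x, 'a, 'm) bimod \<Rightarrow> ('k, ('o, 'f, 'x) simplex \<Rightarrow> 'a list \<Rightarrow> 'm) cochain_complex" where
  "hochschild_complex k C a M =
     \<lparr>Deg = cochains k C a M,
      Diff = (\<lambda>n. \<lambda>\<phi>\<in>carrier (cochains k C a M n). \<lambda>\<sigma>\<in>simplices C a (Suc n). \<lambda>xs\<in>arguments a \<sigma>.
                hochschild_value C a M n \<phi> \<sigma> xs)\<rparr>"

text \<open>The chain map induced by a family \<open>f\<close> of maps from \<open>M\<^sub>u(A, A')\<close> to \<open>N\<^sub>u(A, A')\<close>.\<close>

definition induced_chain_map ::
  "('k, 'r) ring_scheme \<Rightarrow> ('o, 'f) cat \<Rightarrow> ('k, 'o, 'f, 'x, 'a) graded_cat \<Rightarrow>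
   ('k, 'f, 'x, 'a, 'm) bimod \<Rightarrow> ('f \<Rightarrow> 'x \<Rightarrow> 'x \<Rightarrow> 'm \<Rightarrow> 'n) \<Rightarrow>
   nat \<Rightarrow> (('o, 'f, 'x) simplex \<Rightarrow> 'a list \<Rightarrow> 'm) \<Rightarrow> ('o, 'f, 'x) simplex \<Rightarrow> 'a list \<Rightarrow> 'n" where
  "induced_chain_map k C a M f n =
     (\<lambda>\<phi>\<in>carrier (cochains k C a M n). \<lambda>(Us, us, As)\<in>simplices C a n. \<lambda>xs\<in>arguments a (Us, us, As).
        f (composite C (Us, us, As)) (hd As) (last As) (\<phi> (Us, us, As) xs))"

text \<open>The projection of the complex of \<open>\<aa>\<close> over \<open>U\<close> onto the factors indexed by simplices in \<open>V\<close>.\<close>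

definition restriction_chain_map ::
  "('k, 'r) ring_scheme \<Rightarrow> ('o, 'f) cat \<Rightarrow> ('o, 'f) cat \<Rightarrow> ('k, 'o, 'f, 'x, 'a) graded_cat \<Rightarrow>
   ('k, 'f, 'x, 'a, 'm) bimod \<Rightarrow>
   nat \<Rightarrow> (('o, 'f, 'x) simplex \<Rightarrow> 'a list \<Rightarrow> 'm) \<Rightarrow> ('o, 'f, 'x) simplex \<Rightarrow> 'a list \<Rightarrow> 'm" where
  "restriction_chain_map k U V a M n =
     (\<lambda>\<phi>\<in>carrier (cochains k U a M n). restrict \<phi> (simplices V (restrict_graded_cat V a) n))"

definition support_complex ::
  "('k, 'r) ring_scheme \<Rightarrow> ('o, 'f) cat \<Rightarrow> ('o, 'f) cat \<Rightarrow> ('k, 'o, 'f, 'x, 'a) graded_cat \<Rightarrow>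
   ('k, 'f, 'x, 'a, 'm) bimod \<Rightarrow> ('k, ('o, 'f, 'x) simplex \<Rightarrow> 'a list \<Rightarrow> 'm) cochain_complex" where
  "support_complex k U V a M =
     kernel_complex (hochschild_complex k U a M)
       (hochschild_complex k V (restrict_graded_cat V a) (restrict_bimod V M))
       (restriction_chain_map k U V a M)"

definition support_sequence where
  "support_sequence k U V a M =
     \<lparr>Sub = support_complex k U V a M,
      Mid = hochschild_complex k U a M,
      Quo = hochschild_complex k V (restrict_graded_cat V a) (restrict_bimod V M),
      Inc = identity_chain_map (support_complex k U V a M),
      Prj = restriction_chain_map k U V a M\<rparr>"

definition coefficient_sequence where
  "coefficient_sequence k U Z V a M =
     \<lparr>Sub = hochschild_complex k U a (ideal_bimod Z M),
      Mid = hochschild_complex k U a M,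
      Quo = hochschild_complex k U a (quotient_bimod U V M),
      Inc = induced_chain_map k U a (ideal_bimod Z M) ideal_inclusion,
      Prj = induced_chain_map k U a M (quotient_projection V M)\<rparr>"

end

theory Submission
  imports Defs
begin

text \<open>
  Since the complement of the subcategory \<open>V\<close> is an ideal, a composite \<open>|u|\<close> of a chain of
  morphisms of \<open>U\<close> lies in \<open>V\<close> exactly when every factor does; for the empty chain this says that
  an identity lies in \<open>V\<close> exactly when its object does. So the simplices of the restricted category
  are the simplices of \<open>\<aa>\<close> with \<open>|u| \<in> V\<close> (\<open>V_simplices_iff\<close>), and both the restriction of cochains
  to simplices in \<open>V\<close> and the change of coefficients from \<open>M\<close> to its quotient \<open>M\<^sub>V\<close> keep the values of
  a cochain on these simplices and discard the others. The former drops the remaining factors of the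
  product, the latter replaces them by zero. Both are surjective, and both have as kernel the
  cochains that vanish on all simplices with \<open>|u| \<in> V\<close> (\<open>kernel_restriction\<close>,
  \<open>kernel_projection\<close>). This kernel is also, with the same operations and the same differential,
  the complex with coefficients in \<open>M\<^sub>Z\<close> (\<open>ideal_complex_is_kernel\<close>). Hence the two sequences are the
  kernel sequences of two quotients of one complex by one subcomplex, and such sequences are
  isomorphic by a unique isomorphism that is the identity in the middle
  (\<open>quotients_with_same_kernel\<close>).

  Exactness includes the claim that all terms are complexes. It is enough that the Hochschild complex of
  a bimodule over \<open>U\<close> is one, since images of a complex under surjections that commute with the
  differentials, and kernels of these, inherit the property. For that complex, the differential is
  the alternating sum of cofaces that satisfy the cosimplicial identities.
\<close>

section \<open>Linear maps\<close>

lemma linear_maps_closed: "f \<in> linear_maps k M N \<Longrightarrow> x \<in> carrier M \<Longrightarrow> f x \<in> carrier N"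
  by (auto simp: linear_maps_def)

lemma linear_maps_add:
  "f \<in> linear_maps k M N \<Longrightarrow> x \<in> carrier M \<Longrightarrow> y \<in> carrier M \<Longrightarrow> f (x \<oplus>\<^bsub>M\<^esub> y) = f x \<oplus>\<^bsub>N\<^esub> f y"
  by (auto simp: linear_maps_def)

lemma linear_maps_smult:
  "f \<in> linear_maps k M N \<Longrightarrow> c \<in> carrier k \<Longrightarrow> x \<in> carrier M \<Longrightarrow> f (c \<odot>\<^bsub>M\<^esub> x) = c \<odot>\<^bsub>N\<^esub> f x"
  by (auto simp: linear_maps_def)

lemma linear_maps_cong:
  assumes "module k M" and "\<And>x. x \<in> carrier M \<Longrightarrow> f x = g x"
  shows "f \<in> linear_maps k M N \<longleftrightarrow> g \<in> linear_maps k M N"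
proof -
  interpret module k M by fact
  show ?thesis
    using assms(2) by (auto simp: linear_maps_def Pi_iff)
qed

lemma linear_maps_zero:
  assumes "module k M" "module k N" "f \<in> linear_maps k M N"
  shows "f \<zero>\<^bsub>M\<^esub> = \<zero>\<^bsub>N\<^esub>"
proof -
  interpret M: module k M by fact
  interpret N: module k N by fact
  have "f \<zero>\<^bsub>M\<^esub> = f \<zero>\<^bsub>M\<^esub> \<oplus>\<^bsub>N\<^esub> f \<zero>\<^bsub>M\<^esub>"
    using linear_maps_add[OF assms(3), of "\<zero>\<^bsub>M\<^esub>" "\<zero>\<^bsub>M\<^esub>"] by simp
  then show ?thesis
    using linear_maps_closed[OF assms(3), of "\<zero>\<^bsub>M\<^esub>"] by simp
qed

lemma linear_maps_minus:
  assumes "module k M" "module k N" "f \<in> linear_maps k M N" "x \<in> carrier M"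
  shows "f (\<ominus>\<^bsub>M\<^esub> x) = \<ominus>\<^bsub>N\<^esub> f x"
proof -
  interpret M: module k M by fact
  interpret N: module k N by fact
  have "f (\<ominus>\<^bsub>M\<^esub> x) \<oplus>\<^bsub>N\<^esub> f x = \<zero>\<^bsub>N\<^esub>"
    using linear_maps_add[OF assms(3), of "\<ominus>\<^bsub>M\<^esub> x" x] linear_maps_zero[OF assms(1-3)] assms(4)
    by (simp add: M.l_neg)
  then show ?thesis
    using linear_maps_closed[OF assms(3)] assms(4) by (simp add: N.minus_equality)
qed

lemma linear_maps_finsum:
  assumes "module k M" "module k N" "f \<in> linear_maps k M N" "finite A" "g \<in> A \<rightarrow> carrier M"
  shows "f (finsum M g A) = finsum N (\<lambda>i. f (g i)) A"
proof -
  interpret M: module k M by fact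
  interpret N: module k N by fact
  show ?thesis
    using assms(4,5)
  proof (induction A rule: finite_induct)
    case empty
    then show ?case by (simp add: linear_maps_zero[OF assms(1-3)])
  next
    case (insert a A)
    then show ?case
      using linear_maps_closed[OF assms(3)]
      by (simp add: linear_maps_add[OF assms(3)] Pi_iff)
  qed
qed

lemma linear_maps_comp:
  "f \<in> linear_maps k M N \<Longrightarrow> g \<in> linear_maps k N P \<Longrightarrow> (\<lambda>x. g (f x)) \<in> linear_maps k M P"
  by (auto simp: linear_maps_def Pi_iff)

lemma linear_maps_add_maps:
  assumes "module k N" "f \<in> linear_maps k M N" "g \<in> linear_maps k M N"
  shows "(\<lambda>x. f x \<oplus>\<^bsub>N\<^esub> g x) \<in> linear_maps k M N"
proof -
  interpret module k N by fact
  show ?thesis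
    using assms(2,3) by (auto simp: linear_maps_def Pi_iff smult_r_distr M.a_ac)
qed

lemma linear_maps_smult_map:
  assumes "module k N" "f \<in> linear_maps k M N" "c \<in> carrier k"
  shows "(\<lambda>x. c \<odot>\<^bsub>N\<^esub> f x) \<in> linear_maps k M N"
proof -
  interpret module k N by fact
  have "c \<odot>\<^bsub>N\<^esub> (b \<odot>\<^bsub>N\<^esub> y) = b \<odot>\<^bsub>N\<^esub> (c \<odot>\<^bsub>N\<^esub> y)" if "b \<in> carrier k" "y \<in> carrier N" for b y
    using that assms(3) by (metis smult_assoc1 R.m_comm)
  then show ?thesis
    using assms(2,3) by (auto simp: linear_maps_def Pi_iff smult_r_distr)
qed

lemma linear_maps_zero_map:
  assumes "module k N"
  shows "(\<lambda>x. \<zero>\<^bsub>N\<^esub>) \<in> linear_maps k M N"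
proof -
  interpret module k N by fact
  show ?thesis by (auto simp: linear_maps_def)
qed

lemma linear_maps_minus_map:
  assumes "module k N" "f \<in> linear_maps k M N"
  shows "(\<lambda>x. \<ominus>\<^bsub>N\<^esub> f x) \<in> linear_maps k M N"
proof -
  interpret module k N by fact
  show ?thesis
    using assms(2) by (auto simp: linear_maps_def Pi_iff smult_r_minus M.minus_add M.a_comm)
qed

lemma linear_maps_finsum_map:
  assumes "module k M" "module k N" "finite A" "\<And>i. i \<in> A \<Longrightarrow> f i \<in> linear_maps k M N"
  shows "(\<lambda>x. finsum N (\<lambda>i. f i x) A) \<in> linear_maps k M N"
proof -
  interpret N: module k N by fact
  show ?thesis
    using assms(3,4)
  proof (induction A rule: finite_induct)
    case empty
    then show ?case by (simp add: linear_maps_zero_map[OF assms(2)])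
  next
    case (insert a A)
    have "(\<lambda>x. f a x \<oplus>\<^bsub>N\<^esub> finsum N (\<lambda>i. f i x) A) \<in> linear_maps k M N"
      using insert by (intro linear_maps_add_maps[OF assms(2)]) auto
    moreover have "finsum N (\<lambda>i. f i x) (insert a A) = f a x \<oplus>\<^bsub>N\<^esub> finsum N (\<lambda>i. f i x) A"
      if "x \<in> carrier M" for x
      using insert that linear_maps_closed[OF insert.prems] by (subst N.finsum_insert) auto
    ultimately show ?case
      by (subst linear_maps_cong[OF assms(1)])
  qed
qed

lemma bilinear_maps_left:
  "f \<in> bilinear_maps k M N P \<Longrightarrow> y \<in> carrier N \<Longrightarrow> (\<lambda>x. f x y) \<in> linear_maps k M P"
  by (simp add: bilinear_maps_def)

lemma bilinear_maps_right:
  "f \<in> bilinear_maps k M N P \<Longrightarrow> x \<in> carrier M \<Longrightarrow> f x \<in> linear_maps k N P"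
  by (simp add: bilinear_maps_def)

lemma signed_linear:
  assumes "module k N" "f \<in> linear_maps k M N"
  shows "(\<lambda>x. signed N j (f x)) \<in> linear_maps k M N"
  using linear_maps_minus_map[OF assms] assms(2) by (cases "even j") (simp_all add: signed_def)

lemma signed_closed:
  assumes "module k N" "x \<in> carrier N"
  shows "signed N j x \<in> carrier N"
proof -
  interpret module k N by fact
  show ?thesis using assms(2) by (simp add: signed_def)
qed

lemma signed_of_linear:
  assumes "module k M" "module k N" "f \<in> linear_maps k M N" "x \<in> carrier M"
  shows "f (signed M j x) = signed N j (f x)"
  using linear_maps_minus[OF assms] by (simp add: signed_def)

lemma signed_signed:
  assumes "module k N" "x \<in> carrier N"
  shows "signed N i (signed N j x) = signed N (i + j) x"
proof -
  interpret module k N by fact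
  show ?thesis using assms(2) by (simp add: signed_def)
qed


section \<open>Modules of families and of multilinear maps\<close>

lemma product_module_is_module:
  assumes k: "cring k" and N: "\<And>i. i \<in> I \<Longrightarrow> module k (N i)"
  shows "module k (product_module I N)"
proof -
  note m = module.axioms(2)[OF N]
  note gr = abelian_group.axioms(1)[OF m]
  show ?thesis
  proof (intro moduleI abelian_groupI)
    fix x assume x: "x \<in> carrier (product_module I N)"
    have "(\<lambda>i\<in>I. \<ominus>\<^bsub>N i\<^esub> x i) \<in> carrier (product_module I N)"
      using x by (auto simp: product_module_def PiE_iff intro!: abelian_group.a_inv_closed m)
    moreover have "(\<lambda>i\<in>I. \<ominus>\<^bsub>N i\<^esub> x i) \<oplus>\<^bsub>product_module I N\<^esub> x = \<zero>\<^bsub>product_module I N\<^esub>"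
      using x by (auto simp: product_module_def PiE_iff abelian_group.l_neg[OF m])
    ultimately show "\<exists>y\<in>carrier (product_module I N).
        y \<oplus>\<^bsub>product_module I N\<^esub> x = \<zero>\<^bsub>product_module I N\<^esub>" by blast
  qed (auto simp: k product_module_def PiE_iff fun_eq_iff extensional_def
      abelian_monoid.a_assoc[OF gr] abelian_monoid.zero_closed[OF gr]
      abelian_monoid.l_zero[OF gr] module.smult_closed[OF N] module.smult_l_distr[OF N]
      module.smult_r_distr[OF N] module.smult_assoc1[OF N] module.smult_one[OF N]
      intro: abelian_monoid.a_closed[OF gr] abelian_monoid.a_comm[OF gr])
qed

lemma in_listset: "xs \<in> listset As \<longleftrightarrow> length xs = length As \<and> (\<forall>i<length As. xs ! i \<in> As ! i)"
proof (induction As arbitrary: xs)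
  case (Cons A As)
  then show ?case
    by (cases xs) (auto simp: set_Cons_def nth_Cons' less_Suc_eq_0_disj)
qed auto

lemma multilinear_carrier:
  "carrier (multilinear_module k Vs N) =
     {f \<in> listset (map carrier Vs) \<rightarrow>\<^sub>E carrier N.
        \<forall>i<length Vs. \<forall>xs\<in>listset (map carrier Vs). (\<lambda>x. f (xs[i := x])) \<in> linear_maps k (Vs ! i) N}"
  by (simp add: multilinear_module_def)

text \<open>
  The multilinear maps form a submodule of the product of copies of \<open>N\<close> indexed by the argument
  lists. Outside the argument lists a member is undefined, so linearity in one slot is checked only
  on arguments that stay inside.
\<close>

lemma multilinear_module_is_module:
  assumes "cring k" and Vs: "\<And>i. i < length Vs \<Longrightarrow> module k (Vs ! i)" and N: "module k N"
  shows "module k (multilinear_module k Vs N)"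
proof -
  define P where "P = product_module (listset (map carrier Vs)) (\<lambda>_. N)"
  define H where "H = carrier (multilinear_module k Vs N)"
  interpret P: module k P
    unfolding P_def by (rule product_module_is_module) (use assms in auto)
  interpret N: module k N by fact
  have upd: "xs[i := x] \<in> listset (map carrier Vs)"
    if "xs \<in> listset (map carrier Vs)" "i < length Vs" "x \<in> carrier (Vs ! i)" for xs i x
    using that by (auto simp: in_listset nth_list_update)
  have inv: "\<ominus>\<^bsub>P\<^esub> f = (\<lambda>xs\<in>listset (map carrier Vs). \<ominus>\<^bsub>N\<^esub> f xs)" if "f \<in> carrier P" for f
    using that
    by (intro P.minus_equality) (auto simp: P_def product_module_def PiE_iff N.l_neg fun_eq_iff)
  have lin: "(\<lambda>x. if xs[i := x] \<in> listset (map carrier Vs) then g (xs[i := x]) else undefined)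
      \<in> linear_maps k (Vs ! i) N"
    if "xs \<in> listset (map carrier Vs)" "i < length Vs" "(\<lambda>x. g (xs[i := x])) \<in> linear_maps k (Vs ! i) N"
    for g xs i
    using that upd by (subst linear_maps_cong[OF Vs, of i _ "\<lambda>x. g (xs[i := x])"]) auto
  have "submodule H k P"
  proof (rule P.submoduleI)
    show sub: "H \<subseteq> carrier P"
      by (auto simp: H_def multilinear_carrier P_def product_module_def)
    show "\<zero>\<^bsub>P\<^esub> \<in> H"
      by (auto simp: H_def multilinear_carrier P_def product_module_def PiE_iff
          intro!: lin linear_maps_zero_map N)
    show "\<ominus>\<^bsub>P\<^esub> f \<in> H" if "f \<in> H" for f
      using that sub
      by (subst inv) (auto simp: H_def multilinear_carrier PiE_iff
          intro!: lin linear_maps_minus_map N)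
    show "f \<oplus>\<^bsub>P\<^esub> g \<in> H" if "f \<in> H" "g \<in> H" for f g
      using that by (auto simp: H_def multilinear_carrier P_def product_module_def PiE_iff
          intro!: lin linear_maps_add_maps N)
    show "c \<odot>\<^bsub>P\<^esub> f \<in> H" if "c \<in> carrier k" "f \<in> H" for c f
      using that by (auto simp: H_def multilinear_carrier P_def product_module_def PiE_iff
          intro!: lin linear_maps_smult_map N)
  qed
  moreover have "multilinear_module k Vs N = P\<lparr>carrier := H\<rparr>"
    by (simp add: multilinear_module_def P_def H_def)
  ultimately show ?thesis
    using submodule.submodule_is_module P.module_axioms by metis
qed


section \<open>Alternating sums\<close>

lemma finsum_nested:
  assumes N: "abelian_monoid N" and fin: "finite A" "finite B"
    and f: "\<And>i j. i \<in> A \<Longrightarrow> j \<in> B \<Longrightarrow> f (i, j) \<in> carrier N"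
  shows "finsum N (\<lambda>i. finsum N (\<lambda>j. f (i, j)) B) A = finsum N f (A \<times> B)"
  using fin(1) f
proof (induction A rule: finite_induct)
  interpret N: abelian_monoid N by fact
  case (insert a A)
  have "finsum N f (Pair a ` B) = finsum N (\<lambda>j. f (a, j)) B"
    using insert.prems by (intro N.finsum_reindex) (auto simp: inj_on_def)
  moreover have "insert a A \<times> B = Pair a ` B \<union> A \<times> B" by auto
  moreover have "finsum N f (Pair a ` B \<union> A \<times> B) = finsum N f (Pair a ` B) \<oplus>\<^bsub>N\<^esub> finsum N f (A \<times> B)"
    using insert fin by (intro N.finsum_Un_disjoint) auto
  ultimately show ?case
    using insert by (subst N.finsum_insert) (auto intro: N.finsum_closed)
next
  interpret N: abelian_monoid N by fact
  case empty
  show ?case by simp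
qed

text \<open>
  Split the double sum into the pairs with \<open>i < j\<close> and those with \<open>j \<le> i\<close>. The identities match
  the term at \<open>(j, i)\<close> of the first kind with the term at \<open>(i, j - 1)\<close> of the second kind, which has
  the opposite sign.
\<close>

lemma alternating_sum_square_zero:
  assumes mod: "module k A" "module k B" "module k C"
    and d: "\<And>i. i \<le> m \<Longrightarrow> d i \<in> linear_maps k A B"
    and e: "\<And>j. j \<le> Suc m \<Longrightarrow> e j \<in> linear_maps k B C"
    and cos: "\<And>i j. i < j \<Longrightarrow> j \<le> Suc m \<Longrightarrow> e j (d i x) = e i (d (j - 1) x)"
    and x: "x \<in> carrier A"
  shows "finsum C (\<lambda>j. signed C (Suc m - j)
           (e j (finsum B (\<lambda>i. signed B (m - i) (d i x)) {..m}))) {..Suc m} = \<zero>\<^bsub>C\<^esub>"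
proof -
  interpret B: module k B by fact
  interpret C: module k C by fact
  define r where "r = (\<lambda>j i. Suc m - j + (m - i))"
  define t where "t = (\<lambda>(j, i). signed C (r j i) (e j (d i x)))"
  have dcl: "d i x \<in> carrier B" if "i \<le> m" for i
    using linear_maps_closed[OF d] that x by blast
  have edcl: "e j (d i x) \<in> carrier C" if "j \<le> Suc m" "i \<le> m" for i j
    using linear_maps_closed[OF e] dcl that by blast
  have tcl: "t p \<in> carrier C" if "p \<in> {..Suc m} \<times> {..m}" for p
    using that by (auto simp: t_def intro!: signed_closed mod edcl)
  define P where "P = {(j, i). i < j \<and> j \<le> Suc m}"
  define Q where "Q = {(j, i). j \<le> i \<and> i \<le> m}"
  have PQ: "{..Suc m} \<times> {..m} = P \<union> Q" "P \<inter> Q = {}"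
    by (auto simp: P_def Q_def)
  have fin: "finite P" "finite Q"
    using finite_cartesian_product[of "{..Suc m}" "{..m}"] unfolding PQ(1) by auto
  have "(\<lambda>(j, i). (i, j - 1)) ` P = Q"
  proof (intro equalityI subsetI)
    fix q assume "q \<in> Q"
    then obtain i j where "q = (i, j)" "i \<le> j" "j \<le> m" by (auto simp: Q_def)
    then show "q \<in> (\<lambda>(j, i). (i, j - 1)) ` P"
      by (intro image_eqI[of _ _ "(Suc j, i)"]) (auto simp: P_def)
  qed (auto simp: P_def Q_def)
  moreover have "inj_on (\<lambda>(j, i). (i, j - 1)) P"
    by (auto simp: inj_on_def P_def)
  moreover have clPQ: "t \<in> P \<rightarrow> carrier C" "t \<in> Q \<rightarrow> carrier C"
    using tcl PQ by auto
  ultimately have Q: "finsum C t Q = finsum C (\<lambda>p. t ((\<lambda>(j, i). (i, j - 1)) p)) P"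
    using C.finsum_reindex[of t "\<lambda>(j, i). (i, j - 1)" P] by simp
  have cancel: "t p \<oplus>\<^bsub>C\<^esub> t ((\<lambda>(j, i). (i, j - 1)) p) = \<zero>\<^bsub>C\<^esub>" if "p \<in> P" for p
  proof -
    obtain i j where p: "p = (j, i)" "i < j" "j \<le> Suc m"
      using \<open>p \<in> P\<close> by (auto simp: P_def)
    have "r i (j - 1) = Suc (r j i)"
      using p by (auto simp: r_def)
    then have "t ((\<lambda>(j, i). (i, j - 1)) p) = signed C (Suc (r j i)) (e j (d i x))"
      using p cos[of i j] by (simp add: t_def)
    moreover have "t p = signed C (r j i) (e j (d i x))"
      using p by (simp add: t_def)
    moreover have "signed C l z \<oplus>\<^bsub>C\<^esub> signed C (Suc l) z = \<zero>\<^bsub>C\<^esub>" if "z \<in> carrier C" for l z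
      using that by (simp add: signed_def C.r_neg C.l_neg)
    moreover have "e j (d i x) \<in> carrier C"
      using p by (intro edcl) auto
    ultimately show ?thesis by simp
  qed
  have tt: "(\<lambda>p. t ((\<lambda>(j, i). (i, j - 1)) p)) \<in> P \<rightarrow> carrier C"
    by (auto simp: P_def intro!: tcl)
  have "signed C (Suc m - j) (e j (finsum B (\<lambda>i. signed B (m - i) (d i x)) {..m}))
      = finsum C (\<lambda>i. t (j, i)) {..m}" if "j \<le> Suc m" for j
  proof -
    have L: "(\<lambda>y. signed C (Suc m - j) (e j y)) \<in> linear_maps k B C"
      using that by (intro signed_linear mod e)
    have "signed C (Suc m - j) (e j (finsum B (\<lambda>i. signed B (m - i) (d i x)) {..m}))
       = finsum C (\<lambda>i. signed C (Suc m - j) (e j (signed B (m - i) (d i x)))) {..m}"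
      by (rule linear_maps_finsum[OF mod(2,3) L]) (auto intro!: signed_closed mod dcl)
    also have "\<dots> = finsum C (\<lambda>i. t (j, i)) {..m}"
    proof (intro C.finsum_cong')
      fix i assume i: "i \<in> {..m}"
      have "signed C (Suc m - j) (e j (signed B (m - i) (d i x)))
          = signed C (Suc m - j) (signed C (m - i) (e j (d i x)))"
        using that i by (simp add: signed_of_linear[OF mod(2,3) e] dcl)
      also have "\<dots> = t (j, i)"
        using that i by (subst signed_signed[OF mod(3)]) (simp_all only: t_def r_def edcl atMost_iff prod.case)
      finally show "signed C (Suc m - j) (e j (signed B (m - i) (d i x))) = t (j, i)" .
    qed (use that tcl in auto)
    finally show ?thesis .
  qed
  then have "finsum C (\<lambda>j. signed C (Suc m - j)
           (e j (finsum B (\<lambda>i. signed B (m - i) (d i x)) {..m}))) {..Suc m}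
     = finsum C (\<lambda>j. finsum C (\<lambda>i. t (j, i)) {..m}) {..Suc m}"
    using tcl by (intro C.finsum_cong') (auto intro!: C.finsum_closed)
  also have "\<dots> = finsum C t ({..Suc m} \<times> {..m})"
    by (rule finsum_nested) (auto intro!: tcl C.abelian_monoid_axioms)
  also have "\<dots> = finsum C t P \<oplus>\<^bsub>C\<^esub> finsum C t Q"
    unfolding PQ(1) by (rule C.finsum_Un_disjoint) (use PQ fin clPQ in auto)
  also have "\<dots> = finsum C (\<lambda>p. t p \<oplus>\<^bsub>C\<^esub> t ((\<lambda>(j, i). (i, j - 1)) p)) P"
    unfolding Q by (rule C.finsum_addf[symmetric]) (use clPQ tt in auto)
  also have "\<dots> = finsum C (\<lambda>p. \<zero>\<^bsub>C\<^esub>) P"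
    by (rule C.finsum_cong') (use cancel in auto)
  finally show ?thesis by simp
qed


section \<open>Simplices and their faces\<close>

text \<open>
  Merging two adjacent factors of a simplex contracts its lists of morphisms and arguments and
  deletes an entry from its lists of objects. Identities between faces are checked entry by entry
  with the following two formulas.
\<close>

lemma nth_contract:
  assumes "Suc i < length xs" "k < length xs - 1"
  shows "(take i xs @ y # drop (Suc (Suc i)) xs) ! k = (if k < i then xs ! k else if k = i then y else xs ! Suc k)"
proof -
  have "xs ! (i + (k - i) + 1) = xs ! Suc k" if "i \<le> k"
    using that by simp
  then show ?thesis
    using assms by (auto simp: nth_append min_def nth_Cons' Suc_diff_Suc)
qed

lemma nth_delete:
  assumes "Suc i < length xs" "k < length xs - 1"
  shows "(take (Suc i) xs @ drop (Suc (Suc i)) xs) ! k = (if k \<le> i then xs ! k else xs ! Suc k)"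
  using assms by (auto simp: nth_append min_def less_Suc_eq_le)

lemma length_contract: "Suc i < length xs \<Longrightarrow> length (take i xs @ y # drop (Suc (Suc i)) xs) = length xs - 1"
  by auto

lemma length_delete: "Suc i < length xs \<Longrightarrow> length (take (Suc i) xs @ drop (Suc (Suc i)) xs) = length xs - 1"
  by auto

lemma merge_at_simp:
  "merge_at C i (Us, us, As) =
     (take (Suc i) Us @ drop (Suc (Suc i)) Us,
      take i us @ Comp C (us ! Suc i) (us ! i) # drop (Suc (Suc i)) us,
      take (Suc i) As @ drop (Suc (Suc i)) As)"
  by simp

lemma merge_args_simp:
  "merge_args a i (Us, us, As) xs = take i xs @
     GComp a (us ! Suc i) (us ! i) (As ! i) (As ! Suc i) (As ! Suc (Suc i)) (xs ! Suc i) (xs ! i) #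
     drop (Suc (Suc i)) xs"
  by simp

lemma simplicesD:
  assumes "(Us, us, As) \<in> simplices C a n"
  shows "length Us = Suc n" "length us = n" "length As = Suc n"
    "\<And>i. i \<le> n \<Longrightarrow> Us ! i \<in> Obj C" "\<And>i. i \<le> n \<Longrightarrow> As ! i \<in> GObj a (Us ! i)"
    "\<And>i. i < n \<Longrightarrow> us ! i \<in> Mor C" "\<And>i. i < n \<Longrightarrow> Dom C (us ! i) = Us ! i"
    "\<And>i. i < n \<Longrightarrow> Cod C (us ! i) = Us ! Suc i"
  using assms by (auto simp: simplices_def)

lemma in_arguments:
  assumes "(Us, us, As) \<in> simplices C a n"
  shows "xs \<in> arguments b (Us, us, As) \<longleftrightarrow>
    length xs = n \<and> (\<forall>i<n. xs ! i \<in> carrier (GHom b (us ! i) (As ! i) (As ! Suc i)))"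
  using simplicesD(2)[OF assms] by (simp add: in_listset)

lemma target_eq:
  assumes "(Us, us, As) \<in> simplices C a n"
  shows "target C M (Us, us, As) = BHom M (composite C (Us, us, As)) (As ! 0) (As ! n)"
proof -
  have "As \<noteq> []"
    using simplicesD(3)[OF assms] by auto
  then show ?thesis
    using simplicesD(3)[OF assms] by (simp add: hd_conv_nth last_conv_nth)
qed

context small_category
begin

lemma composite_take:
  assumes "(Us, us, As) \<in> simplices C a n" "i \<le> n"
  defines "w \<equiv> foldl (\<lambda>w u. Comp C u w) (Ident C (hd Us)) (take i us)"
  shows "w \<in> Mor C" "Dom C w = Us ! 0" "Cod C w = Us ! i"
proof -
  note s = simplicesD[OF assms(1)]
  have "hd Us = Us ! 0"
    using s(1) by (cases Us) auto
  then have "w \<in> Mor C \<and> Dom C w = Us ! 0 \<and> Cod C w = Us ! i"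
    using assms(2) unfolding w_def
  proof (induction i)
    case 0
    then show ?case using s(4)[of 0] by (simp add: ident_closed dom_ident cod_ident)
  next
    case (Suc i)
    then show ?case
      using s(2) s(6-8)[of i] by (simp add: take_Suc_conv_app_nth comp_closed dom_comp cod_comp)
  qed
  then show "w \<in> Mor C" "Dom C w = Us ! 0" "Cod C w = Us ! i" by auto
qed

lemma composite_mor:
  assumes "(Us, us, As) \<in> simplices C a n"
  shows "composite C (Us, us, As) \<in> Mor C" "Dom C (composite C (Us, us, As)) = Us ! 0"
    "Cod C (composite C (Us, us, As)) = Us ! n"
  using composite_take[OF assms, of n] simplicesD(2)[OF assms] by auto

text \<open>
  Composition starts at the first morphism, so splitting off the first factor is the direction
  that needs associativity; splitting off the last one is the definition.
\<close>

lemma foldl_comp: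
  assumes "w \<in> Mor C" "\<And>i. i < length us \<Longrightarrow> us ! i \<in> Mor C"
    "\<And>i. i < length us \<Longrightarrow> Dom C (us ! i) = (if i = 0 then Cod C w else Cod C (us ! (i - 1)))"
  shows "foldl (\<lambda>w u. Comp C u w) w us =
    Comp C (foldl (\<lambda>w u. Comp C u w) (Ident C (Cod C w)) us) w"
proof -
  define F where "F = foldl (\<lambda>w u. Comp C u w)"
  have "F w (take i us) = Comp C (F (Ident C (Cod C w)) (take i us)) w \<and>
    F (Ident C (Cod C w)) (take i us) \<in> Mor C \<and>
    Dom C (F (Ident C (Cod C w)) (take i us)) = Cod C w \<and>
    Cod C (F (Ident C (Cod C w)) (take i us)) = (if i = 0 then Cod C w else Cod C (us ! (i - 1)))"
    if "i \<le> length us" for i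
    using that
  proof (induction i)
    case 0
    then show ?case
      using assms(1) cod_closed[OF assms(1)]
      by (simp add: F_def ident_closed dom_ident cod_ident comp_ident_left)
  next
    case (Suc i)
    then show ?case
      using assms(2,3)[of i] assms(1)
      by (simp add: F_def take_Suc_conv_app_nth comp_closed dom_comp cod_comp comp_assoc)
  qed
  from this[of "length us"] show ?thesis by (simp add: F_def)
qed

lemma drop_first_simplex:
  assumes "(Us, us, As) \<in> simplices C a (Suc n)"
  shows "drop_first (Us, us, As) \<in> simplices C a n"
    "composite C (Us, us, As) = Comp C (composite C (drop_first (Us, us, As))) (us ! 0)"
proof -
  note s = simplicesD[OF assms]
  show "drop_first (Us, us, As) \<in> simplices C a n"
    using s by (auto simp: simplices_def nth_tl)
  obtain u us' where us: "us = u # us'"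
    using s(2) by (cases us) auto
  have h: "hd Us = Us ! 0" "hd (tl Us) = Us ! 1"
    using s(1) by (cases Us; cases "tl Us"; auto)+
  have u: "u \<in> Mor C" "Dom C u = Us ! 0" "Cod C u = Us ! 1"
    using s(6-8)[of 0] us by auto
  have "foldl (\<lambda>w u. Comp C u w) u us' =
    Comp C (foldl (\<lambda>w u. Comp C u w) (Ident C (Cod C u)) us') u"
  proof (rule foldl_comp)
    fix i assume "i < length us'"
    then show "us' ! i \<in> Mor C"
      "Dom C (us' ! i) = (if i = 0 then Cod C u else Cod C (us' ! (i - 1)))"
      using s(2) s(6-8)[of "Suc i"] s(8)[of i] us u by (auto simp: nth_Cons')
  qed (rule u)
  moreover have "Comp C u (Ident C (Us ! 0)) = u"
    using comp_ident_right[OF u(1)] u by simp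
  ultimately show "composite C (Us, us, As) = Comp C (composite C (drop_first (Us, us, As))) (us ! 0)"
    using us u h by simp
qed

lemma drop_last_simplex:
  assumes "(Us, us, As) \<in> simplices C a (Suc n)"
  shows "drop_last (Us, us, As) \<in> simplices C a n"
    "composite C (Us, us, As) = Comp C (us ! n) (composite C (drop_last (Us, us, As)))"
proof -
  note s = simplicesD[OF assms]
  show "drop_last (Us, us, As) \<in> simplices C a n"
    using s by (auto simp: simplices_def nth_butlast)
  have "us = butlast us @ [us ! n]"
    using s(2) by (metis append_butlast_last_id diff_Suc_1 last_conv_nth list.size(3) nat.distinct(1))
  then have "foldl (\<lambda>w u. Comp C u w) x us = Comp C (us ! n) (foldl (\<lambda>w u. Comp C u w) x (butlast us))" for x
    by (metis foldl_Cons foldl_Nil foldl_append)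
  moreover have "hd (butlast Us) = hd Us"
    using s(1) by (cases Us) auto
  ultimately show "composite C (Us, us, As) = Comp C (us ! n) (composite C (drop_last (Us, us, As)))"
    by simp
qed

lemma merge_at_simplex:
  assumes "(Us, us, As) \<in> simplices C a (Suc n)" "i < n"
  shows "merge_at C i (Us, us, As) \<in> simplices C a n"
    "composite C (merge_at C i (Us, us, As)) = composite C (Us, us, As)"
proof -
  note s = simplicesD[OF assms(1)]
  have i: "Suc i < length us" "Suc i < length Us" "Suc i < length As"
    using s(1-3) assms(2) by auto
  have uu: "us ! i \<in> Mor C" "us ! Suc i \<in> Mor C" "Dom C (us ! Suc i) = Cod C (us ! i)"
    "Dom C (us ! i) = Us ! i" "Cod C (us ! Suc i) = Us ! Suc (Suc i)" "Cod C (us ! i) = Us ! Suc i"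
    using s(6-8)[of i] s(6-8)[of "Suc i"] i s(2) by auto
  show "merge_at C i (Us, us, As) \<in> simplices C a n"
    unfolding merge_at_simp simplices_def mem_Collect_eq prod.case length_contract[OF i(1)]
      length_delete[OF i(2)] length_delete[OF i(3)]
    using s i uu
    by (auto simp: nth_contract nth_delete comp_closed dom_comp cod_comp
        simp del: append_take_drop_id)
  have "us = take i us @ us ! i # us ! Suc i # drop (Suc (Suc i)) us"
    using i(1) by (metis Cons_nth_drop_Suc Suc_lessD id_take_nth_drop)
  then have "foldl (\<lambda>w u. Comp C u w) x us =
      foldl (\<lambda>w u. Comp C u w) (Comp C (us ! Suc i) (Comp C (us ! i) (foldl (\<lambda>w u. Comp C u w) x (take i us))))
      (drop (Suc (Suc i)) us)" for x
    by (metis foldl_Cons foldl_append)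
  moreover have "hd (take (Suc i) Us @ drop (Suc (Suc i)) Us) = hd Us"
    using s(1) by (cases Us) auto
  ultimately show "composite C (merge_at C i (Us, us, As)) = composite C (Us, us, As)"
    using composite_take[OF assms(1), of i] assms(2) uu by (simp add: comp_assoc)
qed

end

lemma drop_first_merge_first:
  assumes "(Us, us, As) \<in> simplices C a (Suc (Suc n))"
  shows "drop_first (merge_at C 0 (Us, us, As)) = drop_first (drop_first (Us, us, As))"
proof -
  note s = simplicesD[OF assms]
  show ?thesis
    using s(1-3) by (cases Us; cases us; cases As) (auto simp: drop_Suc)
qed

lemma drop_first_merge:
  assumes "(Us, us, As) \<in> simplices C a (Suc (Suc n))"
  shows "drop_first (merge_at C (Suc i) (Us, us, As)) = merge_at C i (drop_first (Us, us, As))"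
proof -
  note s = simplicesD[OF assms]
  show ?thesis
    using s(1-3) by (cases Us; cases us; cases As) auto
qed

lemma drop_last_merge_last:
  assumes "(Us, us, As) \<in> simplices C a (Suc (Suc n))"
  shows "drop_last (merge_at C n (Us, us, As)) = drop_last (drop_last (Us, us, As))"
proof -
  note s = simplicesD[OF assms]
  show ?thesis
    using s(1-3) by (simp add: butlast_append butlast_conv_take)
qed

lemma drop_last_merge:
  assumes "(Us, us, As) \<in> simplices C a (Suc (Suc n))" "i < n"
  shows "drop_last (merge_at C i (Us, us, As)) = merge_at C i (drop_last (Us, us, As))"
proof -
  note s = simplicesD[OF assms(1)]
  show ?thesis
    using s(1-3) assms(2) by (simp add: butlast_append nth_butlast take_butlast drop_butlast)
qed

text \<open>
  Merging at \<open>j\<close> and then at \<open>i < j\<close> is merging at \<open>i\<close> and then at \<open>j - 1\<close>. The new entries \<open>y\<close>, \<open>z\<close>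
  are those of the first merge on either side, \<open>y'\<close>, \<open>z'\<close> those of the second. If the two merged
  pairs are disjoint, each entry is formed from the same data on both sides; if they overlap, the
  final entries are the two bracketings of a triple product, which agree by associativity.
\<close>

lemma contract_contract:
  assumes "i < j" "Suc j < length xs"
    and "j \<noteq> Suc i \<Longrightarrow> y' = y \<and> z' = z" and "j = Suc i \<Longrightarrow> y' = z'"
  shows "take i (take j xs @ z # drop (Suc (Suc j)) xs) @ y' # drop (Suc (Suc i)) (take j xs @ z # drop (Suc (Suc j)) xs)
    = take (j - 1) (take i xs @ y # drop (Suc (Suc i)) xs) @ z' # drop (Suc j) (take i xs @ y # drop (Suc (Suc i)) xs)"
  (is "?L = ?R")
proof (rule nth_equalityI)
  have len: "length (take j xs @ z # drop (Suc (Suc j)) xs) = length xs - 1"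
    "length (take i xs @ y # drop (Suc (Suc i)) xs) = length xs - 1"
    using assms by (auto simp: length_contract)
  have j: "drop (Suc j) w = drop (Suc (Suc (j - 1))) w" for w :: "'a list"
    using assms(1) by simp
  show "length ?L = length ?R"
    using assms by auto
  fix k assume "k < length ?L"
  then have k: "k < length xs - 2"
    using assms by auto
  show "?L ! k = ?R ! k"
    using assms k unfolding j
    by (subst (1 2) nth_contract) (auto simp: len nth_contract simp del: append_take_drop_id)
qed

lemma delete_delete:
  assumes "i < j" "Suc j < length xs"
  shows "take (Suc i) (take (Suc j) xs @ drop (Suc (Suc j)) xs) @ drop (Suc (Suc i)) (take (Suc j) xs @ drop (Suc (Suc j)) xs)
    = take j (take (Suc i) xs @ drop (Suc (Suc i)) xs) @ drop (Suc j) (take (Suc i) xs @ drop (Suc (Suc i)) xs)"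
  (is "?L = ?R")
proof (rule nth_equalityI)
  have len: "length (take (Suc j) xs @ drop (Suc (Suc j)) xs) = length xs - 1"
    "length (take (Suc i) xs @ drop (Suc (Suc i)) xs) = length xs - 1"
    using assms by (auto simp: length_delete)
  have j: "take j w = take (Suc (j - 1)) w" "drop (Suc j) w = drop (Suc (Suc (j - 1))) w" for w :: "'a list"
    using assms(1) by auto
  show "length ?L = length ?R"
    using assms by auto
  fix k assume "k < length ?L"
  then have k: "k < length xs - 2"
    using assms by auto
  show "?L ! k = ?R ! k"
    using assms k unfolding j
    by (subst (1 2) nth_delete) (auto simp: len nth_delete simp del: append_take_drop_id)
qed


section \<open>Cochains\<close>

lemma cochain_closed:
  assumes "\<phi> \<in> carrier (cochains k C a M n)" "\<sigma> \<in> simplices C a n" "xs \<in> arguments a \<sigma>"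
  shows "\<phi> \<sigma> xs \<in> carrier (target C M \<sigma>)"
  using assms by (auto simp: cochains_def product_module_def multilinear_carrier PiE_iff)

lemma cochain_multilinear:
  assumes "\<phi> \<in> carrier (cochains k C a M n)" "(Us, us, As) \<in> simplices C a n"
    "xs \<in> arguments a (Us, us, As)" "i < n"
  shows "(\<lambda>x. \<phi> (Us, us, As) (xs[i := x]))
    \<in> linear_maps k (GHom a (us ! i) (As ! i) (As ! Suc i)) (target C M (Us, us, As))"
proof -
  have "\<phi> (Us, us, As) \<in> carrier (multilinear_module k (factors a (Us, us, As)) (target C M (Us, us, As)))"
    using assms(1,2) by (auto simp: cochains_def product_module_def PiE_iff)
  then have "(\<lambda>x. \<phi> (Us, us, As) (xs[i := x]))
    \<in> linear_maps k (factors a (Us, us, As) ! i) (target C M (Us, us, As))"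
    using assms(3,4) simplicesD(2)[OF assms(2)] by (simp add: multilinear_carrier)
  then show ?thesis
    using assms(4) simplicesD(2)[OF assms(2)] by simp
qed

lemma cochainI:
  assumes "\<phi> \<in> extensional (simplices C a n)"
    and "\<And>\<sigma>. \<sigma> \<in> simplices C a n \<Longrightarrow> \<phi> \<sigma> \<in> extensional (arguments a \<sigma>)"
    and "\<And>\<sigma> xs. \<sigma> \<in> simplices C a n \<Longrightarrow> xs \<in> arguments a \<sigma> \<Longrightarrow> \<phi> \<sigma> xs \<in> carrier (target C M \<sigma>)"
    and "\<And>Us us As xs i. (Us, us, As) \<in> simplices C a n \<Longrightarrow> xs \<in> arguments a (Us, us, As) \<Longrightarrow> i < n \<Longrightarrow>
      (\<lambda>x. \<phi> (Us, us, As) (xs[i := x]))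
      \<in> linear_maps k (GHom a (us ! i) (As ! i) (As ! Suc i)) (target C M (Us, us, As))"
  shows "\<phi> \<in> carrier (cochains k C a M n)"
proof -
  have "\<phi> \<sigma> \<in> carrier (multilinear_module k (factors a \<sigma>) (target C M \<sigma>))"
    if "\<sigma> \<in> simplices C a n" for \<sigma>
  proof -
    obtain Us us As where \<sigma>: "\<sigma> = (Us, us, As)" by (cases \<sigma>)
    have "length us = n" using that simplicesD(2) \<sigma> by blast
    then have f: "length (factors a \<sigma>) = n"
      "\<And>i. i < n \<Longrightarrow> factors a \<sigma> ! i = GHom a (us ! i) (As ! i) (As ! Suc i)"
      by (simp_all add: \<sigma>)
    show ?thesis
      unfolding multilinear_carrier PiE_iff mem_Collect_eq f(1)
      using assms(2,3)[OF that] assms(4)[of Us us As] that f(2) by (auto simp only: \<sigma>)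
  qed
  then show ?thesis
    using assms(1) by (auto simp: cochains_def product_module_def PiE_iff)
qed

lemma cochain_eqI:
  assumes "\<phi> \<in> extensional (simplices C a n)" "\<psi> \<in> extensional (simplices C a n)"
    and "\<And>\<sigma>. \<sigma> \<in> simplices C a n \<Longrightarrow> \<phi> \<sigma> \<in> extensional (arguments a \<sigma>)"
    and "\<And>\<sigma>. \<sigma> \<in> simplices C a n \<Longrightarrow> \<psi> \<sigma> \<in> extensional (arguments a \<sigma>)"
    and "\<And>\<sigma> xs. \<sigma> \<in> simplices C a n \<Longrightarrow> xs \<in> arguments a \<sigma> \<Longrightarrow> \<phi> \<sigma> xs = \<psi> \<sigma> xs"
  shows "\<phi> = \<psi>"
proof (rule extensionalityI[OF assms(1,2)])
  fix \<sigma> assume s: "\<sigma> \<in> simplices C a n"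
  show "\<phi> \<sigma> = \<psi> \<sigma>"
    by (rule extensionalityI[OF assms(3,4)[OF s]]) (rule assms(5)[OF s])
qed

lemma cochain_extensional:
  assumes "\<phi> \<in> carrier (cochains k C a M n)"
  shows "\<phi> \<in> extensional (simplices C a n)"
    "\<sigma> \<in> simplices C a n \<Longrightarrow> \<phi> \<sigma> \<in> extensional (arguments a \<sigma>)"
  using assms by (auto simp: cochains_def product_module_def multilinear_carrier PiE_iff)

lemma cochains_record_simps:
  "add (cochains k C a M n) = (\<lambda>\<phi> \<psi>. \<lambda>\<sigma>\<in>simplices C a n. \<lambda>xs\<in>arguments a \<sigma>. \<phi> \<sigma> xs \<oplus>\<^bsub>target C M \<sigma>\<^esub> \<psi> \<sigma> xs)"
  "zero (cochains k C a M n) = (\<lambda>\<sigma>\<in>simplices C a n. \<lambda>xs\<in>arguments a \<sigma>. \<zero>\<^bsub>target C M \<sigma>\<^esub>)"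
  "smult (cochains k C a M n) = (\<lambda>c \<phi>. \<lambda>\<sigma>\<in>simplices C a n. \<lambda>xs\<in>arguments a \<sigma>. c \<odot>\<^bsub>target C M \<sigma>\<^esub> \<phi> \<sigma> xs)"
  by (simp_all add: cochains_def product_module_def multilinear_module_def)

lemma evaluation_linear:
  assumes "\<sigma> \<in> simplices C a n" "xs \<in> arguments a \<sigma>"
  shows "(\<lambda>\<phi>. \<phi> \<sigma> xs) \<in> linear_maps k (cochains k C a M n) (target C M \<sigma>)"
  using assms by (auto simp: linear_maps_def cochains_record_simps cochain_closed)

text \<open>
  Linearity of maps between cochain modules, like equality of cochains, is tested by evaluating at
  simplices and arguments.
\<close>

lemma linear_into_cochains:
  assumes cl: "\<And>x. x \<in> carrier N \<Longrightarrow> F x \<in> carrier (cochains k C a M n)"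
    and N: "module k N"
    and lin: "\<And>\<sigma> xs. \<sigma> \<in> simplices C a n \<Longrightarrow> xs \<in> arguments a \<sigma> \<Longrightarrow>
      (\<lambda>x. F x \<sigma> xs) \<in> linear_maps k N (target C M \<sigma>)"
  shows "F \<in> linear_maps k N (cochains k C a M n)"
proof -
  interpret N: module k N by fact
  note e = cochain_extensional[OF cl]
  have "F (x \<oplus>\<^bsub>N\<^esub> y) = F x \<oplus>\<^bsub>cochains k C a M n\<^esub> F y" if "x \<in> carrier N" "y \<in> carrier N" for x y
    by (rule cochain_eqI[where n = n and a = a and C = C])
      (use that e linear_maps_add[OF lin that] in \<open>auto simp: cochains_record_simps\<close>)
  moreover have "F (c \<odot>\<^bsub>N\<^esub> x) = c \<odot>\<^bsub>cochains k C a M n\<^esub> F x" if "c \<in> carrier k" "x \<in> carrier N" for c x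
    by (rule cochain_eqI[where n = n and a = a and C = C])
      (use that e linear_maps_smult[OF lin that] in \<open>auto simp: cochains_record_simps\<close>)
  ultimately show ?thesis
    using cl by (auto simp: linear_maps_def)
qed

context graded_category
begin

lemma factor_module:
  assumes "(Us, us, As) \<in> simplices U a n" "i < n"
  shows "module k (GHom a (us ! i) (As ! i) (As ! Suc i))"
  using simplicesD[OF assms(1)] assms(2) by (intro hom_module) auto

lemma drop_first_arguments:
  assumes "(Us, us, As) \<in> simplices U a (Suc n)" "xs \<in> arguments a (Us, us, As)"
  shows "tl xs \<in> arguments a (drop_first (Us, us, As))" "xs ! 0 \<in> carrier (GHom a (us ! 0) (As ! 0) (As ! 1))"
proof -
  have d: "(tl Us, tl us, tl As) \<in> simplices U a n"
    using drop_first_simplex(1)[OF assms(1)] by simp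
  show "tl xs \<in> arguments a (drop_first (Us, us, As))"
    using assms(2) simplicesD(1-3)[OF assms(1)]
    unfolding drop_first.simps in_arguments[OF d] in_arguments[OF assms(1)] by (auto simp: nth_tl)
  show "xs ! 0 \<in> carrier (GHom a (us ! 0) (As ! 0) (As ! 1))"
    using assms(2) unfolding in_arguments[OF assms(1)] by auto
qed

lemma drop_last_arguments:
  assumes "(Us, us, As) \<in> simplices U a (Suc n)" "xs \<in> arguments a (Us, us, As)"
  shows "butlast xs \<in> arguments a (drop_last (Us, us, As))"
    "xs ! n \<in> carrier (GHom a (us ! n) (As ! n) (As ! Suc n))"
proof -
  have d: "(butlast Us, butlast us, butlast As) \<in> simplices U a n"
    using drop_last_simplex(1)[OF assms(1)] by simp
  show "butlast xs \<in> arguments a (drop_last (Us, us, As))"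
    using assms(2) simplicesD(1-3)[OF assms(1)]
    unfolding drop_last.simps in_arguments[OF d] in_arguments[OF assms(1)] by (auto simp: nth_butlast)
  show "xs ! n \<in> carrier (GHom a (us ! n) (As ! n) (As ! Suc n))"
    using assms(2) unfolding in_arguments[OF assms(1)] by auto
qed

lemma gcomp_simplex:
  assumes "(Us, us, As) \<in> simplices U a (Suc n)" "i < n"
  shows "GComp a (us ! Suc i) (us ! i) (As ! i) (As ! Suc i) (As ! Suc (Suc i))
    \<in> bilinear_maps k (GHom a (us ! Suc i) (As ! Suc i) (As ! Suc (Suc i)))
        (GHom a (us ! i) (As ! i) (As ! Suc i))
        (GHom a (Comp U (us ! Suc i) (us ! i)) (As ! i) (As ! Suc (Suc i)))"
  using simplicesD[OF assms(1)] assms(2) by (intro comp_bilinear) auto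

lemma merged_factor:
  assumes "(Us, us, As) \<in> simplices U a (Suc n)" "i < n"
    and "merge_at U i (Us, us, As) = (Vs, vs, Bs)" "p < n"
  shows "GHom a (vs ! p) (Bs ! p) (Bs ! Suc p) =
    (if p < i then GHom a (us ! p) (As ! p) (As ! Suc p)
     else if p = i then GHom a (Comp U (us ! Suc i) (us ! i)) (As ! i) (As ! Suc (Suc i))
     else GHom a (us ! Suc p) (As ! Suc p) (As ! Suc (Suc p)))"
proof -
  have "Suc i < length us" "Suc i < length As" "p < length us - 1" "p < length As - 1" "Suc p < length As - 1"
    using simplicesD(1-3)[OF assms(1)] assms(2,4) by auto
  then show ?thesis
    using assms(3) unfolding merge_at_simp by (auto simp: nth_contract nth_delete)
qed

lemma merge_arguments:
  assumes "(Us, us, As) \<in> simplices U a (Suc n)" "i < n" "xs \<in> arguments a (Us, us, As)"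
  shows "merge_args a i (Us, us, As) xs \<in> arguments a (merge_at U i (Us, us, As))"
proof -
  obtain Vs vs Bs where m: "merge_at U i (Us, us, As) = (Vs, vs, Bs)"
    by (cases "merge_at U i (Us, us, As)")
  have v: "(Vs, vs, Bs) \<in> simplices U a n"
    using merge_at_simplex(1)[OF assms(1,2)] m by simp
  have x: "length xs = Suc n" "\<And>p. p < Suc n \<Longrightarrow> xs ! p \<in> carrier (GHom a (us ! p) (As ! p) (As ! Suc p))"
    using assms(3) unfolding in_arguments[OF assms(1)] by auto
  have i: "Suc i < length xs" using x(1) assms(2) by simp
  have "GComp a (us ! Suc i) (us ! i) (As ! i) (As ! Suc i) (As ! Suc (Suc i)) (xs ! Suc i) (xs ! i)
      \<in> carrier (GHom a (Comp U (us ! Suc i) (us ! i)) (As ! i) (As ! Suc (Suc i)))"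
    using assms(2)
    by (intro linear_maps_closed[OF bilinear_maps_right[OF gcomp_simplex[OF assms(1,2)]]] x) auto
  then show ?thesis
    unfolding m in_arguments[OF v] merge_args_simp length_contract[OF i]
    using x i by (auto simp: nth_contract merged_factor[OF assms(1,2) m])
qed

end


section \<open>The cosimplicial structure\<close>

text \<open>
  The summand of the Hochschild differential that belongs to the \<open>j\<close>-th face, without its sign:
  \<open>\<phi>(x\<^sub>n, \<dots>, x\<^sub>1) x\<^sub>0\<close> for \<open>j = 0\<close>, then the terms that merge \<open>x\<^sub>j\<close> with \<open>x\<^sub>j\<^sub>-\<^sub>1\<close>, and
  \<open>x\<^sub>n \<phi>(x\<^sub>n\<^sub>-\<^sub>1, \<dots>, x\<^sub>0)\<close> for \<open>j = n + 1\<close>. With this numbering the sign is \<open>(-1)\<^sup>n\<^sup>+\<^sup>1\<^sup>-\<^sup>j\<close>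
  throughout.
\<close>

fun coface_value ::
  "('o, 'f) cat \<Rightarrow> ('k, 'o, 'f, 'x, 'a) graded_cat \<Rightarrow> ('k, 'f, 'x, 'a, 'm) bimod \<Rightarrow> nat \<Rightarrow> nat \<Rightarrow>
   (('o, 'f, 'x) simplex \<Rightarrow> 'a list \<Rightarrow> 'm) \<Rightarrow> ('o, 'f, 'x) simplex \<Rightarrow> 'a list \<Rightarrow> 'm" where
  "coface_value C a M n j \<phi> (Us, us, As) xs =
     (if j = 0 then
        RAct M (composite C (drop_first (Us, us, As))) (us ! 0) (As ! 0) (As ! 1) (As ! Suc n)
          (\<phi> (drop_first (Us, us, As)) (tl xs)) (xs ! 0)
      else if j = Suc n then
        LAct M (us ! n) (composite C (drop_last (Us, us, As))) (As ! 0) (As ! n) (As ! Suc n)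
          (xs ! n) (\<phi> (drop_last (Us, us, As)) (butlast xs))
      else \<phi> (merge_at C (j - 1) (Us, us, As)) (merge_args a (j - 1) (Us, us, As) xs))"

text \<open>
  From here on faces, composites and targets of a simplex are treated as wholes.
\<close>

declare coface_value.simps [simp del] composite.simps [simp del] target.simps [simp del]
  drop_first.simps [simp del] drop_last.simps [simp del] merge_at.simps [simp del]
  merge_args.simps [simp del] factors.simps [simp del]

definition coface where
  "coface C a M n j \<phi> =
     (\<lambda>\<sigma>\<in>simplices C a (Suc n). \<lambda>xs\<in>arguments a \<sigma>. coface_value C a M n j \<phi> \<sigma> xs)"

context bimodule
begin

lemma target_module:
  assumes "\<sigma> \<in> simplices U a n"
  shows "module k (target U M \<sigma>)"
proof -
  obtain Us us As where \<sigma>: "\<sigma> = (Us, us, As)" by (cases \<sigma>)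
  note s = assms[unfolded \<sigma>]
  show ?thesis
    unfolding \<sigma> target_eq[OF s] using composite_mor[OF s] simplicesD[OF s] by (intro bhom_module) auto
qed

lemma cochains_module: "module k (cochains k U a M n)"
  unfolding cochains_def
proof (intro product_module_is_module multilinear_module_is_module base_ring target_module)
  fix \<sigma> i assume "\<sigma> \<in> simplices U a n" "i < length (factors a \<sigma>)"
  then show "module k (factors a \<sigma> ! i)"
    using factor_module[of _ _ _ n i] simplicesD(2)[of _ _ _ U a n]
    by (cases \<sigma>) (auto simp: factors.simps)
qed

lemma ract_simplex:
  assumes "(Us, us, As) \<in> simplices U a (Suc n)"
  shows "RAct M (composite U (drop_first (Us, us, As))) (us ! 0) (As ! 0) (As ! 1) (As ! Suc n)
    \<in> bilinear_maps k (target U M (drop_first (Us, us, As))) (GHom a (us ! 0) (As ! 0) (As ! 1))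
        (target U M (Us, us, As))"
proof -
  note s = simplicesD[OF assms]
  have d: "(tl Us, tl us, tl As) \<in> simplices U a n"
    using drop_first_simplex(1)[OF assms] by (simp add: drop_first.simps)
  have "tl As ! 0 = As ! 1" "tl As ! n = As ! Suc n" "tl Us ! 0 = Us ! 1" "tl Us ! n = Us ! Suc n"
    using s by (auto simp: nth_tl)
  then show ?thesis
    using s composite_mor[OF d] drop_first_simplex(2)[OF assms]
    unfolding drop_first.simps target_eq[OF d] target_eq[OF assms]
    by (auto intro!: ract_bilinear)
qed

lemma lact_simplex:
  assumes "(Us, us, As) \<in> simplices U a (Suc n)"
  shows "LAct M (us ! n) (composite U (drop_last (Us, us, As))) (As ! 0) (As ! n) (As ! Suc n)
    \<in> bilinear_maps k (GHom a (us ! n) (As ! n) (As ! Suc n)) (target U M (drop_last (Us, us, As)))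
        (target U M (Us, us, As))"
proof -
  note s = simplicesD[OF assms]
  have d: "(butlast Us, butlast us, butlast As) \<in> simplices U a n"
    using drop_last_simplex(1)[OF assms] by (simp add: drop_last.simps)
  have "butlast As ! 0 = As ! 0" "butlast As ! n = As ! n" "butlast Us ! 0 = Us ! 0" "butlast Us ! n = Us ! n"
    using s by (auto simp: nth_butlast)
  then show ?thesis
    using s composite_mor[OF d] drop_last_simplex(2)[OF assms]
    unfolding drop_last.simps target_eq[OF d] target_eq[OF assms]
    by (auto intro!: lact_bilinear)
qed

lemma merge_target:
  assumes "(Us, us, As) \<in> simplices U a (Suc n)" "i < n"
  shows "target U M (merge_at U i (Us, us, As)) = target U M (Us, us, As)"
proof -
  obtain Vs vs Bs where m: "merge_at U i (Us, us, As) = (Vs, vs, Bs)"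
    by (cases "merge_at U i (Us, us, As)")
  have v: "(Vs, vs, Bs) \<in> simplices U a n"
    using merge_at_simplex(1)[OF assms] m by simp
  have i: "Suc i < length As" using simplicesD(3)[OF assms(1)] assms(2) by simp
  have "Bs ! p = (if p \<le> i then As ! p else As ! Suc p)" if "p \<le> n" for p
    using m that i simplicesD(3)[OF assms(1)] nth_delete[OF i, of p] by (auto simp: merge_at.simps)
  then have "Bs ! 0 = As ! 0" "Bs ! n = As ! Suc n"
    using assms(2) by auto
  then show ?thesis
    using merge_at_simplex(2)[OF assms] unfolding m target_eq[OF v] target_eq[OF assms(1)] by simp
qed

lemma coface_value_linear:
  assumes s: "\<sigma> \<in> simplices U a (Suc n)" and xs: "xs \<in> arguments a \<sigma>" and j: "j \<le> Suc n"
  shows "(\<lambda>\<phi>. coface_value U a M n j \<phi> \<sigma> xs) \<in> linear_maps k (cochains k U a M n) (target U M \<sigma>)"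
proof -
  obtain Us us As where \<sigma>: "\<sigma> = (Us, us, As)" by (cases \<sigma>)
  note s = s[unfolded \<sigma>] and xs = xs[unfolded \<sigma>]
  consider "j = 0" | "j = Suc n" | i where "j = Suc i" "i < n"
    using j by (cases j) (auto simp: le_less)
  then show ?thesis
  proof cases
    case 1
    show ?thesis
      unfolding \<sigma> coface_value.simps 1
      using linear_maps_comp[OF evaluation_linear[OF drop_first_simplex(1)[OF s] drop_first_arguments(1)[OF s xs]]
          bilinear_maps_left[OF ract_simplex[OF s] drop_first_arguments(2)[OF s xs]]] by simp
  next
    case 2
    show ?thesis
      unfolding \<sigma> coface_value.simps 2
      using linear_maps_comp[OF evaluation_linear[OF drop_last_simplex(1)[OF s] drop_last_arguments(1)[OF s xs]]
          bilinear_maps_right[OF lact_simplex[OF s] drop_last_arguments(2)[OF s xs]]] by simp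
  next
    case 3
    show ?thesis
      unfolding \<sigma> coface_value.simps 3
      using evaluation_linear[OF merge_at_simplex(1)[OF s 3(2)] merge_arguments[OF s 3(2) xs], of k M] 3(2)
      by (simp add: merge_target[OF s 3(2)])
  qed
qed

text \<open>
  Each slot of the merged argument list is either untouched, possibly shifted by one place, or filled by a
  composite that is linear in each of its two factors; the outer terms are linear in the split-off
  slot because the actions are bilinear.
\<close>

lemma coface_value_multilinear:
  assumes \<phi>: "\<phi> \<in> carrier (cochains k U a M n)"
    and s: "(Us, us, As) \<in> simplices U a (Suc n)" and xs: "xs \<in> arguments a (Us, us, As)"
    and j: "j \<le> Suc n" and p: "p < Suc n"
  shows "(\<lambda>x. coface_value U a M n j \<phi> (Us, us, As) (xs[p := x]))
    \<in> linear_maps k (GHom a (us ! p) (As ! p) (As ! Suc p)) (target U M (Us, us, As))"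
proof -
  note l = simplicesD(1-3)[OF s]
  have lx: "length xs = Suc n" "\<And>p. p < Suc n \<Longrightarrow> xs ! p \<in> carrier (GHom a (us ! p) (As ! p) (As ! Suc p))"
    using xs unfolding in_arguments[OF s] by auto
  consider "j = 0" | "j = Suc n" | i where "j = Suc i" "i < n"
    using j by (cases j) (auto simp: le_less)
  then show ?thesis
  proof cases
    case 1
    note d = drop_first_simplex(1)[OF s]
    show ?thesis
    proof (cases p)
      case 0
      have "tl (xs[0 := x]) = tl xs" "xs[0 := x] ! 0 = x" for x
        using lx by (cases xs; auto)+
      then show ?thesis
        unfolding coface_value.simps 1 0
        using bilinear_maps_right[OF ract_simplex[OF s] cochain_closed[OF \<phi> d drop_first_arguments(1)[OF s xs]]]
        by simp
    next
      case (Suc q)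
      have t: "tl (xs[Suc q := x]) = (tl xs)[q := x]" "xs[Suc q := x] ! 0 = xs ! 0" for x
        using lx by (cases xs; auto)+
      have "(\<lambda>x. \<phi> (drop_first (Us, us, As)) ((tl xs)[q := x]))
        \<in> linear_maps k (GHom a (us ! p) (As ! p) (As ! Suc p)) (target U M (drop_first (Us, us, As)))"
        using cochain_multilinear[OF \<phi> d[unfolded drop_first.simps], of "tl xs" q]
          drop_first_arguments(1)[OF s xs] p Suc l
        by (simp add: drop_first.simps nth_tl)
      from linear_maps_comp[OF this bilinear_maps_left[OF ract_simplex[OF s] drop_first_arguments(2)[OF s xs]]]
      show ?thesis
        unfolding coface_value.simps 1 Suc t by simp
    qed
  next
    case 2
    note d = drop_last_simplex(1)[OF s]
    show ?thesis
    proof (cases "p = n")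
      case True
      have "butlast (xs[n := x]) = butlast xs" "xs[n := x] ! n = x" for x
        using lx by (auto simp: butlast_list_update)
      then show ?thesis
        unfolding coface_value.simps 2 True
        using bilinear_maps_left[OF lact_simplex[OF s] cochain_closed[OF \<phi> d drop_last_arguments(1)[OF s xs]]]
        by simp
    next
      case False
      then have t: "butlast (xs[p := x]) = (butlast xs)[p := x]" "xs[p := x] ! n = xs ! n" for x
        using lx by (auto simp: butlast_list_update)
      have "(\<lambda>x. \<phi> (drop_last (Us, us, As)) ((butlast xs)[p := x]))
        \<in> linear_maps k (GHom a (us ! p) (As ! p) (As ! Suc p)) (target U M (drop_last (Us, us, As)))"
        using cochain_multilinear[OF \<phi> d[unfolded drop_last.simps], of "butlast xs" p]
          drop_last_arguments(1)[OF s xs] p False l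
        by (simp add: drop_last.simps nth_butlast)
      from linear_maps_comp[OF this bilinear_maps_right[OF lact_simplex[OF s] drop_last_arguments(2)[OF s xs]]]
      show ?thesis
        unfolding coface_value.simps 2 t by simp
    qed
  next
    case 3
    obtain Vs vs Bs where m: "merge_at U i (Us, us, As) = (Vs, vs, Bs)"
      by (cases "merge_at U i (Us, us, As)")
    have v: "(Vs, vs, Bs) \<in> simplices U a n"
      using merge_at_simplex(1)[OF s 3(2)] m by simp
    define ys where "ys = merge_args a i (Us, us, As) xs"
    have ys: "ys \<in> arguments a (Vs, vs, Bs)"
      using merge_arguments[OF s 3(2) xs] by (simp add: ys_def m)
    have T: "target U M (Us, us, As) = target U M (Vs, vs, Bs)"
      using merge_target[OF s 3(2)] m by simp
    note ml = cochain_multilinear[OF \<phi> v ys]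
    note mf = merged_factor[OF s 3(2) m]
    have J: "coface_value U a M n j \<phi> (Us, us, As) zs = \<phi> (Vs, vs, Bs) (merge_args a i (Us, us, As) zs)" for zs
      using 3 by (simp add: coface_value.simps m)
    consider "p < i" | "p = i" | "p = Suc i" | "Suc i < p" by linarith
    then show ?thesis
    proof cases
      case a: 1
      have "merge_args a i (Us, us, As) (xs[p := x]) = ys[p := x]" for x
        using a lx 3(2) by (simp add: ys_def merge_args.simps list_update_append list_update_beyond take_update_swap)
      then show ?thesis
        unfolding J T using ml[of p] mf[of p] a 3(2) by simp
    next
      case a: 2
      have "merge_args a i (Us, us, As) (xs[p := x]) =
        ys[i := GComp a (us ! Suc i) (us ! i) (As ! i) (As ! Suc i) (As ! Suc (Suc i)) (xs ! Suc i) x]" for x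
        using a lx 3(2) by (simp add: ys_def merge_args.simps list_update_append list_update_beyond take_update_swap)
      then show ?thesis
        unfolding J T
        using linear_maps_comp[OF bilinear_maps_right[OF gcomp_simplex[OF s 3(2)] lx(2)[of "Suc i"]]] ml[of i] mf[of i] a 3(2)
        by simp
    next
      case a: 3
      have "merge_args a i (Us, us, As) (xs[p := x]) =
        ys[i := GComp a (us ! Suc i) (us ! i) (As ! i) (As ! Suc i) (As ! Suc (Suc i)) x (xs ! i)]" for x
        using a lx 3(2) by (simp add: ys_def merge_args.simps list_update_append list_update_beyond take_update_swap)
      then show ?thesis
        unfolding J T
        using linear_maps_comp[OF bilinear_maps_left[OF gcomp_simplex[OF s 3(2)] lx(2)[of i]]] ml[of i] mf[of i] a 3(2)
        by simp
    next
      case a: 4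
      then obtain q where q: "p = Suc q" "i < q" by (cases p) auto
      have "merge_args a i (Us, us, As) (xs[p := x]) = ys[q := x]" for x
      proof -
        have "q - i = Suc (q - Suc i)" using q by simp
        then show ?thesis
          using a lx 3(2) q by (simp add: ys_def merge_args.simps list_update_append list_update_beyond take_update_swap drop_update_swap)
      qed
      then show ?thesis
        unfolding J T using ml[of q] mf[of q] q p by simp
    qed
  qed
qed

lemma coface_closed:
  assumes \<phi>: "\<phi> \<in> carrier (cochains k U a M n)" and j: "j \<le> Suc n"
  shows "coface U a M n j \<phi> \<in> carrier (cochains k U a M (Suc n))"
proof (rule cochainI)
  show "coface U a M n j \<phi> \<sigma> xs \<in> carrier (target U M \<sigma>)"
    if "\<sigma> \<in> simplices U a (Suc n)" "xs \<in> arguments a \<sigma>" for \<sigma> xs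
    using linear_maps_closed[OF coface_value_linear[OF that j] \<phi>] that by (simp add: coface_def)
  fix Us us As xs i
  assume s: "(Us, us, As) \<in> simplices U a (Suc n)" and xs: "xs \<in> arguments a (Us, us, As)" and i: "i < Suc n"
  have "xs[i := x] \<in> arguments a (Us, us, As)" if "x \<in> carrier (GHom a (us ! i) (As ! i) (As ! Suc i))" for x
    using xs that i unfolding in_arguments[OF s] by (auto simp: nth_list_update)
  then show "(\<lambda>x. coface U a M n j \<phi> (Us, us, As) (xs[i := x]))
    \<in> linear_maps k (GHom a (us ! i) (As ! i) (As ! Suc i)) (target U M (Us, us, As))"
    using coface_value_multilinear[OF \<phi> s xs j i] s
    by (subst linear_maps_cong[OF factor_module[OF s i]]) (auto simp: coface_def)
qed (auto simp: coface_def)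

lemma coface_linear:
  assumes j: "j \<le> Suc n"
  shows "coface U a M n j \<in> linear_maps k (cochains k U a M n) (cochains k U a M (Suc n))"
proof (rule linear_into_cochains)
  show "(\<lambda>\<phi>. coface U a M n j \<phi> \<sigma> xs) \<in> linear_maps k (cochains k U a M n) (target U M \<sigma>)"
    if "\<sigma> \<in> simplices U a (Suc n)" "xs \<in> arguments a \<sigma>" for \<sigma> xs
    using coface_value_linear[OF that j] that by (simp add: coface_def)
qed (use coface_closed[OF _ j] cochains_module in auto)


lemma coface_eq:
  "\<sigma> \<in> simplices U a (Suc n) \<Longrightarrow> xs \<in> arguments a \<sigma> \<Longrightarrow>
   coface U a M n j \<phi> \<sigma> xs = coface_value U a M n j \<phi> \<sigma> xs"
  by (simp add: coface_def)

end

lemma merge_args_drop: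
  assumes "(Us, us, As) \<in> simplices C a (Suc (Suc n))" "length xs = Suc (Suc n)"
  shows "tl (merge_args a 0 (Us, us, As) xs) = tl (tl xs)"
    "tl (merge_args a (Suc i) (Us, us, As) xs) = merge_args a i (drop_first (Us, us, As)) (tl xs)"
    "butlast (merge_args a n (Us, us, As) xs) = butlast (butlast xs)"
    "i < n \<Longrightarrow> butlast (merge_args a i (Us, us, As) xs) = merge_args a i (drop_last (Us, us, As)) (butlast xs)"
proof -
  note s = simplicesD(1-3)[OF assms(1)]
  show "tl (merge_args a 0 (Us, us, As) xs) = tl (tl xs)"
    using s assms(2) by (cases xs) (auto simp: merge_args.simps drop_Suc)
  show "tl (merge_args a (Suc i) (Us, us, As) xs) = merge_args a i (drop_first (Us, us, As)) (tl xs)"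
    using s assms(2)
    by (cases xs; cases us; cases As) (auto simp: merge_args.simps drop_first.simps)
  show "butlast (merge_args a n (Us, us, As) xs) = butlast (butlast xs)"
    using s assms(2) by (simp add: merge_args.simps butlast_append butlast_conv_take)
  show "butlast (merge_args a i (Us, us, As) xs) = merge_args a i (drop_last (Us, us, As)) (butlast xs)"
    if "i < n"
    using s assms(2) that
    by (simp add: merge_args.simps drop_last.simps butlast_append nth_butlast take_butlast drop_butlast)
qed

context bimodule
begin

context
  fixes n Us us As \<phi> xs
  assumes \<phi>: "\<phi> \<in> carrier (cochains k U a M n)"
    and s: "(Us, us, As) \<in> simplices U a (Suc (Suc n))"
    and xs: "xs \<in> arguments a (Us, us, As)"
begin

lemma list_lengths: "length Us = Suc (Suc (Suc n))" "length us = Suc (Suc n)" "length As = Suc (Suc (Suc n))"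
  "length xs = Suc (Suc n)"
  using simplicesD(1-3)[OF s] xs[unfolded in_arguments[OF s]] by auto

lemma simplex_factor:
  assumes "i < Suc (Suc n)"
  shows "xs ! i \<in> carrier (GHom a (us ! i) (As ! i) (As ! Suc i))"
    "us ! i \<in> Mor U" "Dom U (us ! i) = Us ! i" "Cod U (us ! i) = Us ! Suc i"
    "As ! i \<in> GObj a (Us ! i)" "As ! Suc i \<in> GObj a (Us ! Suc i)"
  using assms xs simplicesD[OF s] unfolding in_arguments[OF s] by auto

text \<open>
  The next six lemmas are the cosimplicial identities, according to which of the two faces are
  outer. Two outer faces on different sides commute because left and right actions do, and two on
  the same side give the associativity of an action.
\<close>

lemma left_right_commute:
  "coface_value U a M (Suc n) (Suc (Suc n)) (coface U a M n 0 \<phi>) (Us, us, As) xs =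
   coface_value U a M (Suc n) 0 (coface U a M n (Suc n) \<phi>) (Us, us, As) xs"
proof -
  define \<tau> where "\<tau> = drop_first (drop_last (Us, us, As))"
  have dl: "(butlast Us, butlast us, butlast As) \<in> simplices U a (Suc n)"
    and df: "(tl Us, tl us, tl As) \<in> simplices U a (Suc n)"
    using drop_last_simplex(1)[OF s] drop_first_simplex(1)[OF s] by (auto simp: drop_last.simps drop_first.simps)
  have bx: "butlast xs \<in> arguments a (butlast Us, butlast us, butlast As)"
    and tx: "tl xs \<in> arguments a (tl Us, tl us, tl As)"
    using drop_last_arguments(1)[OF s xs] drop_first_arguments(1)[OF s xs]
    by (auto simp: drop_last.simps drop_first.simps)
  have \<tau>: "\<tau> = drop_first (butlast Us, butlast us, butlast As)" "\<tau> = drop_last (tl Us, tl us, tl As)"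
    by (auto simp: \<tau>_def drop_last.simps drop_first.simps butlast_tl)
  have \<tau>s: "\<tau> = (tl (butlast Us), tl (butlast us), tl (butlast As))"
    by (simp add: \<tau> drop_first.simps)
  have \<tau>m: "\<tau> \<in> simplices U a n" "tl (butlast xs) \<in> arguments a \<tau>"
    using drop_first_simplex(1)[OF dl] drop_first_arguments(1)[OF dl bx] by (auto simp: \<tau>)
  note cm = composite_mor[OF \<tau>m(1)[unfolded \<tau>s], folded \<tau>s]
  have c: "composite U (drop_last (Us, us, As)) = Comp U (composite U \<tau>) (us ! 0)"
    "composite U (drop_first (Us, us, As)) = Comp U (us ! Suc n) (composite U \<tau>)"
    using drop_first_simplex(2)[OF dl] drop_last_simplex(2)[OF df] list_lengths
    by (simp_all add: \<tau>[symmetric] nth_butlast nth_tl) (simp_all add: drop_last.simps drop_first.simps)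
  have e: "tl (butlast Us) ! 0 = Us ! 1" "tl (butlast Us) ! n = Us ! Suc n"
    "tl (butlast As) ! 0 = As ! 1" "tl (butlast As) ! n = As ! Suc n"
    using list_lengths by (auto simp: nth_tl nth_butlast)
  have m: "\<phi> \<tau> (tl (butlast xs)) \<in> carrier (BHom M (composite U \<tau>) (As ! 1) (As ! Suc n))"
    using cochain_closed[OF \<phi> \<tau>m] \<tau>m(1) unfolding \<tau>s by (subst (asm) target_eq) (auto simp: e)
  show ?thesis
    unfolding coface_value.simps(1)[of U a M "Suc n"]
    using list_lengths dl df bx tx lact_ract_assoc[of "us ! 0" "composite U \<tau>" "us ! Suc n" "As ! 0" "As ! 1" "As ! Suc n"
      "As ! Suc (Suc n)" "xs ! 0" "\<phi> \<tau> (tl (butlast xs))" "xs ! Suc n"]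
      simplex_factor[of 0] simplex_factor[of "Suc n"] cm m
    by (simp add: c[unfolded drop_first.simps drop_last.simps] e drop_last.simps[of Us] drop_first.simps[of Us] coface_eq coface_value.simps(1)[of U a M n]
        \<tau>[symmetric] nth_tl nth_butlast butlast_tl)
qed

lemma right_right:
  "coface_value U a M (Suc n) 1 (coface U a M n 0 \<phi>) (Us, us, As) xs =
   coface_value U a M (Suc n) 0 (coface U a M n 0 \<phi>) (Us, us, As) xs"
proof -
  define \<tau> where "\<tau> = drop_first (drop_first (Us, us, As))"
  obtain Vs vs Bs where mg: "merge_at U 0 (Us, us, As) = (Vs, vs, Bs)"
    by (cases "merge_at U 0 (Us, us, As)")
  have df: "(tl Us, tl us, tl As) \<in> simplices U a (Suc n)"
    and mgs: "(Vs, vs, Bs) \<in> simplices U a (Suc n)"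
    using drop_first_simplex(1)[OF s] merge_at_simplex(1)[OF s, of 0] by (auto simp: drop_first.simps mg)
  define ys where "ys = merge_args a 0 (Us, us, As) xs"
  have tx: "tl xs \<in> arguments a (tl Us, tl us, tl As)" and yx: "ys \<in> arguments a (Vs, vs, Bs)"
    using drop_first_arguments(1)[OF s xs] merge_arguments[OF s _ xs, of 0]
    by (auto simp: drop_first.simps mg ys_def)
  have \<tau>: "\<tau> = drop_first (tl Us, tl us, tl As)" "\<tau> = drop_first (Vs, vs, Bs)"
    using drop_first_merge_first[OF s] by (auto simp: \<tau>_def drop_first.simps mg)
  have \<tau>s: "\<tau> = (tl (tl Us), tl (tl us), tl (tl As))"
    by (simp add: \<tau> drop_first.simps)
  have \<tau>m: "\<tau> \<in> simplices U a n" "tl (tl xs) \<in> arguments a \<tau>"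
    using drop_first_simplex(1)[OF df] drop_first_arguments(1)[OF df tx] by (auto simp: \<tau>)
  note cm = composite_mor[OF \<tau>m(1)[unfolded \<tau>s], folded \<tau>s]
  have c: "composite U (drop_first (Us, us, As)) = Comp U (composite U \<tau>) (us ! 1)"
    using drop_first_simplex(2)[OF df] list_lengths
    by (simp_all add: \<tau>[symmetric] nth_tl) (simp_all add: drop_first.simps)
  have e: "tl (tl Us) ! 0 = Us ! Suc 1" "tl (tl Us) ! n = Us ! Suc (Suc n)"
    "tl (tl As) ! 0 = As ! Suc 1" "tl (tl As) ! n = As ! Suc (Suc n)"
    using list_lengths by (auto simp: nth_tl)
  have m: "\<phi> \<tau> (tl (tl xs)) \<in> carrier (BHom M (composite U \<tau>) (As ! Suc 1) (As ! Suc (Suc n)))"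
    using cochain_closed[OF \<phi> \<tau>m] \<tau>m(1) unfolding \<tau>s by (subst (asm) target_eq) (auto simp: e)
  have v: "vs ! 0 = Comp U (us ! 1) (us ! 0)" "Bs ! 0 = As ! 0" "Bs ! Suc 0 = As ! Suc 1" "Bs ! Suc n = As ! Suc (Suc n)"
    "ys ! 0 = GComp a (us ! 1) (us ! 0) (As ! 0) (As ! 1) (As ! Suc 1) (xs ! 1) (xs ! 0)"
    using mg list_lengths nth_contract[of 0 us 0] nth_delete[of 0 As]
    by (auto simp: merge_at_simp ys_def merge_args.simps)
  have ty: "tl ys = tl (tl xs)"
    unfolding ys_def by (rule merge_args_drop(1)[OF s list_lengths(4)])
  show ?thesis
    unfolding coface_value.simps(1)[of U a M "Suc n"]
    using list_lengths df tx mgs yx ract_assoc[of "us ! 0" "us ! 1" "composite U \<tau>" "As ! 0" "As ! 1" "As ! Suc 1"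
      "As ! Suc (Suc n)" "xs ! 0" "xs ! 1" "\<phi> \<tau> (tl (tl xs))"]
      simplex_factor[of 0] simplex_factor[of 1] cm m simplicesD(5)[OF s, of "Suc (Suc n)"]
    by (simp add: c[unfolded drop_first.simps drop_last.simps] e drop_first.simps[of Us] coface_eq coface_value.simps(1)[of U a M n]
        \<tau>[symmetric] nth_tl mg ys_def[symmetric] v ty)
qed

text \<open>
  An outer face and a merge at a place that it does not touch commute.
\<close>

lemma right_merge:
  assumes p: "p < n"
  shows "coface_value U a M (Suc n) (Suc (Suc p)) (coface U a M n 0 \<phi>) (Us, us, As) xs =
   coface_value U a M (Suc n) 0 (coface U a M n (Suc p) \<phi>) (Us, us, As) xs"
proof -
  define \<tau> where "\<tau> = merge_at U p (drop_first (Us, us, As))"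
  obtain Vs vs Bs where mg: "merge_at U (Suc p) (Us, us, As) = (Vs, vs, Bs)"
    by (cases "merge_at U (Suc p) (Us, us, As)")
  have df: "(tl Us, tl us, tl As) \<in> simplices U a (Suc n)"
    and mgs: "(Vs, vs, Bs) \<in> simplices U a (Suc n)"
    using drop_first_simplex(1)[OF s] merge_at_simplex(1)[OF s, of "Suc p"] p by (auto simp: drop_first.simps mg)
  define ys where "ys = merge_args a (Suc p) (Us, us, As) xs"
  have tx: "tl xs \<in> arguments a (tl Us, tl us, tl As)" and yx: "ys \<in> arguments a (Vs, vs, Bs)"
    using drop_first_arguments(1)[OF s xs] merge_arguments[OF s _ xs, of "Suc p"] p
    by (auto simp: drop_first.simps mg ys_def)
  have \<tau>: "\<tau> = merge_at U p (tl Us, tl us, tl As)" "\<tau> = drop_first (Vs, vs, Bs)"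
    using drop_first_merge[OF s, of p] by (auto simp: \<tau>_def drop_first.simps mg)
  have c: "composite U \<tau> = composite U (tl Us, tl us, tl As)"
    unfolding \<tau>(1) by (rule merge_at_simplex(2)[OF df p])
  have v: "vs ! 0 = us ! 0" "Bs ! 0 = As ! 0" "Bs ! Suc 0 = As ! Suc 0" "Bs ! Suc n = As ! Suc (Suc n)" "ys ! 0 = xs ! 0"
    using mg list_lengths p nth_contract[of "Suc p" us 0] nth_delete[of "Suc p" As] nth_contract[of "Suc p" xs 0]
    by (auto simp: merge_at_simp ys_def merge_args_simp)
  have ty: "tl ys = merge_args a p (tl Us, tl us, tl As) (tl xs)"
    unfolding ys_def merge_args_drop(2)[OF s list_lengths(4)] by (simp add: drop_first.simps)
  show ?thesis
    unfolding coface_value.simps(1)[of U a M "Suc n"]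
    using list_lengths df tx mgs yx p
    by (simp add: c drop_first.simps[of Us] coface_eq coface_value.simps(1)[of U a M n]
        \<tau>[symmetric] mg ys_def[symmetric] v ty)
qed

lemma left_merge:
  assumes p: "p < n"
  shows "coface_value U a M (Suc n) (Suc (Suc n)) (coface U a M n (Suc p) \<phi>) (Us, us, As) xs =
   coface_value U a M (Suc n) (Suc p) (coface U a M n (Suc n) \<phi>) (Us, us, As) xs"
proof -
  define \<tau> where "\<tau> = merge_at U p (drop_last (Us, us, As))"
  obtain Vs vs Bs where mg: "merge_at U p (Us, us, As) = (Vs, vs, Bs)"
    by (cases "merge_at U p (Us, us, As)")
  have dl: "(butlast Us, butlast us, butlast As) \<in> simplices U a (Suc n)"
    and mgs: "(Vs, vs, Bs) \<in> simplices U a (Suc n)"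
    using drop_last_simplex(1)[OF s] merge_at_simplex(1)[OF s, of p] p by (auto simp: drop_last.simps mg)
  define ys where "ys = merge_args a p (Us, us, As) xs"
  have bx: "butlast xs \<in> arguments a (butlast Us, butlast us, butlast As)" and yx: "ys \<in> arguments a (Vs, vs, Bs)"
    using drop_last_arguments(1)[OF s xs] merge_arguments[OF s _ xs, of p] p
    by (auto simp: drop_last.simps mg ys_def)
  have \<tau>: "\<tau> = merge_at U p (butlast Us, butlast us, butlast As)" "\<tau> = drop_last (Vs, vs, Bs)"
    using drop_last_merge[OF s p] by (auto simp: \<tau>_def drop_last.simps mg)
  have c: "composite U \<tau> = composite U (butlast Us, butlast us, butlast As)"
    unfolding \<tau>(1) by (rule merge_at_simplex(2)[OF dl p])
  have v: "vs ! n = us ! Suc n" "Bs ! 0 = As ! 0" "Bs ! n = As ! Suc n" "Bs ! Suc n = As ! Suc (Suc n)" "ys ! n = xs ! Suc n"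
    using mg list_lengths p nth_contract[of p us n] nth_delete[of p As] nth_contract[of p xs n]
    by (auto simp: merge_at_simp ys_def merge_args_simp)
  have ty: "butlast ys = merge_args a p (butlast Us, butlast us, butlast As) (butlast xs)"
    unfolding ys_def merge_args_drop(4)[OF s list_lengths(4) p] by (simp add: drop_last.simps)
  show ?thesis
    unfolding coface_value.simps(1)[of U a M "Suc n"]
    using list_lengths dl bx mgs yx p
    by (simp add: c drop_last.simps[of Us] coface_eq coface_value.simps(1)[of U a M n]
        \<tau>[symmetric] mg ys_def[symmetric] v ty)
qed

lemma left_left:
  "coface_value U a M (Suc n) (Suc (Suc n)) (coface U a M n (Suc n) \<phi>) (Us, us, As) xs =
   coface_value U a M (Suc n) (Suc n) (coface U a M n (Suc n) \<phi>) (Us, us, As) xs"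
proof -
  define \<tau> where "\<tau> = drop_last (drop_last (Us, us, As))"
  obtain Vs vs Bs where mg: "merge_at U n (Us, us, As) = (Vs, vs, Bs)"
    by (cases "merge_at U n (Us, us, As)")
  have dl: "(butlast Us, butlast us, butlast As) \<in> simplices U a (Suc n)"
    and mgs: "(Vs, vs, Bs) \<in> simplices U a (Suc n)"
    using drop_last_simplex(1)[OF s] merge_at_simplex(1)[OF s, of n] by (auto simp: drop_last.simps mg)
  define ys where "ys = merge_args a n (Us, us, As) xs"
  have bx: "butlast xs \<in> arguments a (butlast Us, butlast us, butlast As)" and yx: "ys \<in> arguments a (Vs, vs, Bs)"
    using drop_last_arguments(1)[OF s xs] merge_arguments[OF s _ xs, of n]
    by (auto simp: drop_last.simps mg ys_def)
  have \<tau>: "\<tau> = drop_last (butlast Us, butlast us, butlast As)" "\<tau> = drop_last (Vs, vs, Bs)"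
    using drop_last_merge_last[OF s] by (auto simp: \<tau>_def drop_last.simps mg)
  have \<tau>s: "\<tau> = (butlast (butlast Us), butlast (butlast us), butlast (butlast As))"
    by (simp add: \<tau> drop_last.simps)
  have \<tau>m: "\<tau> \<in> simplices U a n" "butlast (butlast xs) \<in> arguments a \<tau>"
    using drop_last_simplex(1)[OF dl] drop_last_arguments(1)[OF dl bx] by (auto simp: \<tau>)
  note cm = composite_mor[OF \<tau>m(1)[unfolded \<tau>s], folded \<tau>s]
  have c: "composite U (drop_last (Us, us, As)) = Comp U (us ! n) (composite U \<tau>)"
    using drop_last_simplex(2)[OF dl] list_lengths
    by (simp_all add: \<tau>[symmetric] nth_butlast) (simp_all add: drop_last.simps)
  have e: "butlast (butlast Us) ! 0 = Us ! 0" "butlast (butlast Us) ! n = Us ! n"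
    "butlast (butlast As) ! 0 = As ! 0" "butlast (butlast As) ! n = As ! n"
    using list_lengths by (auto simp: nth_butlast)
  have m: "\<phi> \<tau> (butlast (butlast xs)) \<in> carrier (BHom M (composite U \<tau>) (As ! 0) (As ! n))"
    using cochain_closed[OF \<phi> \<tau>m] \<tau>m(1) unfolding \<tau>s by (subst (asm) target_eq) (auto simp: e)
  have v: "vs ! n = Comp U (us ! Suc n) (us ! n)" "Bs ! 0 = As ! 0" "Bs ! n = As ! n" "Bs ! Suc n = As ! Suc (Suc n)"
    "ys ! n = GComp a (us ! Suc n) (us ! n) (As ! n) (As ! Suc n) (As ! Suc (Suc n)) (xs ! Suc n) (xs ! n)"
    using mg list_lengths nth_contract[of n us n] nth_delete[of n As] nth_contract[of n xs n]
    by (auto simp: merge_at_simp ys_def merge_args_simp)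
  have ty: "butlast ys = butlast (butlast xs)"
    unfolding ys_def by (rule merge_args_drop(3)[OF s list_lengths(4)])
  show ?thesis
    unfolding coface_value.simps(1)[of U a M "Suc n"]
    using list_lengths dl bx mgs yx lact_assoc[of "composite U \<tau>" "us ! n" "us ! Suc n" "As ! 0" "As ! n" "As ! Suc n"
      "As ! Suc (Suc n)" "\<phi> \<tau> (butlast (butlast xs))" "xs ! n" "xs ! Suc n"]
      simplex_factor[of n] simplex_factor[of "Suc n"] cm m simplicesD(5)[OF s, of 0]
    by (simp add: c[unfolded drop_first.simps drop_last.simps] e drop_last.simps[of Us] coface_eq coface_value.simps(1)[of U a M n]
        \<tau>[symmetric] nth_butlast mg ys_def[symmetric] v ty)
qed

lemma merge_merge:
  assumes pq: "p < q" "q < Suc n"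
  shows "coface_value U a M (Suc n) (Suc q) (coface U a M n (Suc p) \<phi>) (Us, us, As) xs =
   coface_value U a M (Suc n) (Suc p) (coface U a M n q \<phi>) (Us, us, As) xs"
proof -
  obtain Vs vs Bs where mg: "merge_at U p (Us, us, As) = (Vs, vs, Bs)"
    by (cases "merge_at U p (Us, us, As)")
  obtain Vs' vs' Bs' where mg': "merge_at U q (Us, us, As) = (Vs', vs', Bs')"
    by (cases "merge_at U q (Us, us, As)")
  define ys where "ys = merge_args a p (Us, us, As) xs"
  define ys' where "ys' = merge_args a q (Us, us, As) xs"
  have mgs: "(Vs, vs, Bs) \<in> simplices U a (Suc n)" "(Vs', vs', Bs') \<in> simplices U a (Suc n)"
    using merge_at_simplex(1)[OF s] pq by (metis less_trans mg, metis mg')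
  have yx: "ys \<in> arguments a (Vs, vs, Bs)" "ys' \<in> arguments a (Vs', vs', Bs')"
    using merge_arguments[OF s _ xs, of p] merge_arguments[OF s _ xs, of q] pq by (auto simp: mg mg' ys_def ys'_def)
  have P: "Suc p < length Us" "Suc q < length Us" "Suc p < length us" "Suc q < length us"
    "Suc p < length As" "Suc q < length As" "Suc p < length xs" "Suc q < length xs"
    using list_lengths pq by auto
  obtain r where r: "q = Suc r" "p \<le> r" using pq by (cases q) auto
  have V: "vs = take p us @ Comp U (us ! Suc p) (us ! p) # drop (Suc (Suc p)) us"
    "Vs = take (Suc p) Us @ drop (Suc (Suc p)) Us" "Bs = take (Suc p) As @ drop (Suc (Suc p)) As"
    "vs' = take q us @ Comp U (us ! Suc q) (us ! q) # drop (Suc (Suc q)) us"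
    "Vs' = take (Suc q) Us @ drop (Suc (Suc q)) Us" "Bs' = take (Suc q) As @ drop (Suc (Suc q)) As"
    "ys = take p xs @ GComp a (us ! Suc p) (us ! p) (As ! p) (As ! Suc p) (As ! Suc (Suc p)) (xs ! Suc p) (xs ! p) #
      drop (Suc (Suc p)) xs"
    "ys' = take q xs @ GComp a (us ! Suc q) (us ! q) (As ! q) (As ! Suc q) (As ! Suc (Suc q)) (xs ! Suc q) (xs ! q) #
      drop (Suc (Suc q)) xs"
    using mg mg' by (auto simp: merge_at_simp ys_def ys'_def merge_args_simp)
  have nth: "vs ! i = (if i < p then us ! i else if i = p then Comp U (us ! Suc p) (us ! p) else us ! Suc i)"
    "vs' ! i = (if i < q then us ! i else if i = q then Comp U (us ! Suc q) (us ! q) else us ! Suc i)"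
    "ys ! i = (if i < p then xs ! i else if i = p then
       GComp a (us ! Suc p) (us ! p) (As ! p) (As ! Suc p) (As ! Suc (Suc p)) (xs ! Suc p) (xs ! p) else xs ! Suc i)"
    "ys' ! i = (if i < q then xs ! i else if i = q then
       GComp a (us ! Suc q) (us ! q) (As ! q) (As ! Suc q) (As ! Suc (Suc q)) (xs ! Suc q) (xs ! q) else xs ! Suc i)"
    if "i < Suc n" for i
    using that P list_lengths unfolding V by (auto simp: nth_contract simp del: append_take_drop_id)
  have nthB: "Bs ! i = (if i \<le> p then As ! i else As ! Suc i)" "Bs' ! i = (if i \<le> q then As ! i else As ! Suc i)"
    if "i \<le> Suc n" for i
    using that P list_lengths unfolding V by (auto simp: nth_delete simp del: append_take_drop_id)
  note f = simplex_factor[of p] simplex_factor[of "Suc p"] simplex_factor[of "Suc (Suc p)"]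
  have "merge_at U p (Vs', vs', Bs') = merge_at U r (Vs, vs, Bs)"
  proof -
    have "take p vs' @ Comp U (vs' ! Suc p) (vs' ! p) # drop (Suc (Suc p)) vs' =
        take (q - 1) vs @ Comp U (vs ! q) (vs ! (q - 1)) # drop (Suc q) vs"
      unfolding V(1) V(4)
      by (rule contract_contract[OF pq(1) P(4)], unfold V(1)[symmetric] V(4)[symmetric])
        (use pq r f in \<open>auto simp: nth comp_assoc\<close>)
    moreover have "take (Suc p) Vs' @ drop (Suc (Suc p)) Vs' = take q Vs @ drop (Suc q) Vs"
      "take (Suc p) Bs' @ drop (Suc (Suc p)) Bs' = take q Bs @ drop (Suc q) Bs"
      using delete_delete[OF pq(1) P(2)] delete_delete[OF pq(1) P(6)] unfolding V by auto
    ultimately show ?thesis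
      unfolding merge_at_simp using r by simp
  qed
  moreover have "merge_args a p (Vs', vs', Bs') ys' = merge_args a r (Vs, vs, Bs) ys"
  proof -
    have "take p ys' @ GComp a (vs' ! Suc p) (vs' ! p) (Bs' ! p) (Bs' ! Suc p) (Bs' ! Suc (Suc p)) (ys' ! Suc p) (ys' ! p)
          # drop (Suc (Suc p)) ys' =
        take (q - 1) ys @ GComp a (vs ! q) (vs ! (q - 1)) (Bs ! (q - 1)) (Bs ! q) (Bs ! Suc q) (ys ! q) (ys ! (q - 1))
          # drop (Suc q) ys"
      unfolding V(7) V(8)
      by (rule contract_contract[OF pq(1) P(8)], unfold V(7)[symmetric] V(8)[symmetric])
        (use pq r f in \<open>auto simp: nth nthB gcomp_assoc\<close>)
    then show ?thesis
      unfolding merge_args_simp using r by simp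
  qed
  ultimately show ?thesis
    using pq r mgs yx
    by (simp add: coface_value.simps(1)[of U a M "Suc n"] mg mg'[unfolded r(1)] ys_def[symmetric] ys'_def[unfolded r(1), symmetric] coface_eq
        coface_value.simps(1)[of U a M n])
qed

lemma cosimplicial_identity:
  assumes ij: "i < j" "j \<le> Suc (Suc n)"
  shows "coface_value U a M (Suc n) j (coface U a M n i \<phi>) (Us, us, As) xs =
   coface_value U a M (Suc n) i (coface U a M n (j - 1) \<phi>) (Us, us, As) xs"
proof -
  consider "i = 0" "j = Suc (Suc n)" | "i = 0" "j = 1" | p where "i = 0" "j = Suc (Suc p)" "p < n"
    | p where "i = Suc p" "j = Suc (Suc n)" "p < n" | "i = Suc n" "j = Suc (Suc n)"
    | p q where "i = Suc p" "j = Suc q" "p < q" "q < Suc n"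
  proof (cases i)
    case 0
    then show ?thesis
      using that(1-3) ij by (cases j; cases "j - 1") (auto simp: le_less)
  next
    case (Suc p)
    then show ?thesis
      using that(4)[of p] that(5) that(6)[of p "j - 1"] ij by (cases j) (auto simp: le_less less_Suc_eq)
  qed
  then show ?thesis
    using left_right_commute right_right right_merge left_merge left_left merge_merge
    by cases simp_all
qed

end

end


section \<open>The Hochschild complex is a complex\<close>

text \<open>
  Only here does the shape of the Hochschild formula matter: its left term, its middle sum and its
  right term are the summands with \<open>j = n + 1\<close>, \<open>1 \<le> j \<le> n\<close> and \<open>j = 0\<close>.
\<close>

lemma hochschild_value_eq_alternating_sum:
  assumes N: "module k (target C M (Us, us, As))"
    and s: "(Us, us, As) \<in> simplices C a (Suc n)" and xs: "length xs = Suc n"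
    and cl: "\<And>j. j \<le> Suc n \<Longrightarrow> coface_value C a M n j \<phi> (Us, us, As) xs \<in> carrier (target C M (Us, us, As))"
  shows "hochschild_value C a M n \<phi> (Us, us, As) xs =
    (\<Oplus>\<^bsub>target C M (Us, us, As)\<^esub> j\<in>{..Suc n}. signed (target C M (Us, us, As)) (Suc n - j)
       (coface_value C a M n j \<phi> (Us, us, As) xs))"
proof -
  let ?N = "target C M (Us, us, As)"
  interpret N: module k ?N by fact
  define t where "t = (\<lambda>j. signed ?N (Suc n - j) (coface_value C a M n j \<phi> (Us, us, As) xs))"
  have tc: "t j \<in> carrier ?N" if "j \<le> Suc n" for j
    unfolding t_def by (intro signed_closed[OF N] cl that)
  have "us \<noteq> []" "xs \<noteq> []"
    using simplicesD(2)[OF s] xs by auto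
  then have h: "hd us = us ! 0" "last us = us ! n" "hd xs = xs ! 0" "last xs = xs ! n"
    using simplicesD(2)[OF s] xs by (simp_all add: hd_conv_nth last_conv_nth)
  have "finsum ?N t {..Suc n} = finsum ?N (\<lambda>i. t (Suc i)) {..n} \<oplus>\<^bsub>?N\<^esub> t 0"
    using tc by (intro N.finsum_Suc2) auto
  also have "finsum ?N (\<lambda>i. t (Suc i)) {..n} = t (Suc n) \<oplus>\<^bsub>?N\<^esub> finsum ?N (\<lambda>i. t (Suc i)) {..<n}"
    unfolding lessThan_Suc_atMost[symmetric] lessThan_Suc using tc by (intro N.finsum_insert) auto
  also have "finsum ?N (\<lambda>i. t (Suc i)) {..<n} = (\<Oplus>\<^bsub>?N\<^esub> i\<in>{..<n}. signed ?N (n - i)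
      (\<phi> (merge_at C i (Us, us, As)) (merge_args a i (Us, us, As) xs)))"
  proof (rule N.finsum_cong')
    have t: "t (Suc i) = signed ?N (n - i) (\<phi> (merge_at C i (Us, us, As)) (merge_args a i (Us, us, As) xs))"
      if "i < n" for i
      using that by (simp add: t_def coface_value.simps)
    then show "\<And>i. i \<in> {..<n} \<Longrightarrow> t (Suc i) =
        signed ?N (n - i) (\<phi> (merge_at C i (Us, us, As)) (merge_args a i (Us, us, As) xs))" by simp
    show "(\<lambda>i. signed ?N (n - i) (\<phi> (merge_at C i (Us, us, As)) (merge_args a i (Us, us, As) xs)))
        \<in> {..<n} \<rightarrow> carrier ?N"
      using tc by (auto simp: t[symmetric])
  qed simp
  finally have "finsum ?N t {..Suc n} = t (Suc n) \<oplus>\<^bsub>?N\<^esub> (\<Oplus>\<^bsub>?N\<^esub> i\<in>{..<n}. signed ?N (n - i)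
      (\<phi> (merge_at C i (Us, us, As)) (merge_args a i (Us, us, As) xs))) \<oplus>\<^bsub>?N\<^esub> t 0" .
  moreover have "t (Suc n) = LAct M (us ! n) (composite C (drop_last (Us, us, As))) (As ! 0) (As ! n) (As ! Suc n)
          (xs ! n) (\<phi> (drop_last (Us, us, As)) (butlast xs))"
    by (simp add: t_def coface_value.simps signed_def)
  moreover have "t 0 = signed ?N (Suc n) (RAct M (composite C (drop_first (Us, us, As))) (us ! 0) (As ! 0) (As ! 1)
      (As ! Suc n) (\<phi> (drop_first (Us, us, As)) (tl xs)) (xs ! 0))"
    by (simp add: t_def coface_value.simps)
  ultimately show ?thesis
    unfolding t_def by (simp only: hochschild_value.simps Let_def h)
qed

declare hochschild_value.simps [simp del]

context bimodule
begin

abbreviation "HC \<equiv> hochschild_complex k U a M"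

lemma differential_eq_alternating_sum:
  assumes \<phi>: "\<phi> \<in> carrier (cochains k U a M n)"
  shows "Diff HC n \<phi> = (\<Oplus>\<^bsub>cochains k U a M (Suc n)\<^esub> j\<in>{..Suc n}.
    signed (cochains k U a M (Suc n)) (Suc n - j) (coface U a M n j \<phi>))"
    (is "_ = ?R")
proof -
  let ?C = "cochains k U a M (Suc n)"
  interpret C: module k ?C by (rule cochains_module)
  have t: "signed ?C (Suc n - j) (coface U a M n j \<phi>) \<in> carrier ?C" if "j \<le> Suc n" for j
    by (intro signed_closed[OF cochains_module] coface_closed \<phi> that)
  then have R: "?R \<in> carrier ?C"
    by (intro C.finsum_closed) auto
  note e = cochain_extensional[OF R]
  show ?thesis
  proof (rule cochain_eqI[where C = U and a = a and n = "Suc n"])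
    fix \<sigma> xs assume s: "\<sigma> \<in> simplices U a (Suc n)" and xs: "xs \<in> arguments a \<sigma>"
    obtain Us us As where \<sigma>: "\<sigma> = (Us, us, As)" by (cases \<sigma>)
    note ev = evaluation_linear[OF s xs, of k M] and tm = target_module[OF s]
    have cv: "coface_value U a M n j \<phi> \<sigma> xs \<in> carrier (target U M \<sigma>)" if "j \<le> Suc n" for j
      using linear_maps_closed[OF coface_value_linear[OF s xs that] \<phi>] .
    have "?R \<sigma> xs = (\<Oplus>\<^bsub>target U M \<sigma>\<^esub> j\<in>{..Suc n}.
        signed ?C (Suc n - j) (coface U a M n j \<phi>) \<sigma> xs)"
      using t by (intro linear_maps_finsum[OF cochains_module tm ev]) auto
    also have "\<dots> = (\<Oplus>\<^bsub>target U M \<sigma>\<^esub> j\<in>{..Suc n}.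
        signed (target U M \<sigma>) (Suc n - j) (coface_value U a M n j \<phi> \<sigma> xs))"
    proof (rule abelian_monoid.finsum_cong')
      show "abelian_monoid (target U M \<sigma>)"
        using tm by (simp add: module_def abelian_group_def)
      show "(\<lambda>j. signed (target U M \<sigma>) (Suc n - j) (coface_value U a M n j \<phi> \<sigma> xs))
          \<in> {..Suc n} \<rightarrow> carrier (target U M \<sigma>)"
        using cv by (auto intro!: signed_closed[OF tm])
      fix j assume "j \<in> {..Suc n}"
      then show "signed ?C (Suc n - j) (coface U a M n j \<phi>) \<sigma> xs =
          signed (target U M \<sigma>) (Suc n - j) (coface_value U a M n j \<phi> \<sigma> xs)"
        using signed_of_linear[OF cochains_module tm ev coface_closed[OF \<phi>], of j "Suc n - j"]
        by (simp add: coface_eq[OF s xs])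
    qed simp
    also have "\<dots> = hochschild_value U a M n \<phi> \<sigma> xs"
      unfolding \<sigma>
      by (rule hochschild_value_eq_alternating_sum[symmetric, OF tm[unfolded \<sigma>] s[unfolded \<sigma>]])
        (use xs s cv in \<open>auto simp: \<sigma> in_arguments\<close>)
    finally show "Diff HC n \<phi> \<sigma> xs = ?R \<sigma> xs"
      using s xs \<phi> by (simp add: hochschild_complex_def)
  qed (use \<phi> in \<open>simp_all add: hochschild_complex_def e\<close>)
qed

lemma Deg_hochschild [simp]: "Deg HC = cochains k U a M"
  by (simp add: hochschild_complex_def)

lemma differential_linear:
  "Diff HC n \<in> linear_maps k (cochains k U a M n) (cochains k U a M (Suc n))"
proof -
  let ?f = "\<lambda>\<phi>. \<Oplus>\<^bsub>cochains k U a M (Suc n)\<^esub> j\<in>{..Suc n}.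
      signed (cochains k U a M (Suc n)) (Suc n - j) (coface U a M n j \<phi>)"
  have "?f \<in> linear_maps k (cochains k U a M n) (cochains k U a M (Suc n))"
  proof (rule linear_maps_finsum_map[OF cochains_module cochains_module])
    fix j assume "j \<in> {..Suc n}"
    then show "(\<lambda>\<phi>. signed (cochains k U a M (Suc n)) (Suc n - j) (coface U a M n j \<phi>))
        \<in> linear_maps k (cochains k U a M n) (cochains k U a M (Suc n))"
      by (intro signed_linear[OF cochains_module coface_linear]) simp
  qed simp
  moreover have "Diff HC n \<in> linear_maps k (cochains k U a M n) (cochains k U a M (Suc n)) \<longleftrightarrow>
      ?f \<in> linear_maps k (cochains k U a M n) (cochains k U a M (Suc n))"
    by (rule linear_maps_cong[OF cochains_module]) (rule differential_eq_alternating_sum)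
  ultimately show ?thesis by (simp only:)
qed

lemma differential_squared:
  assumes \<phi>: "\<phi> \<in> carrier (cochains k U a M n)"
  shows "Diff HC (Suc n) (Diff HC n \<phi>) = \<zero>\<^bsub>cochains k U a M (Suc (Suc n))\<^esub>"
proof -
  have cos: "coface U a M (Suc n) j (coface U a M n i \<phi>) = coface U a M (Suc n) i (coface U a M n (j - 1) \<phi>)"
    if "i < j" "j \<le> Suc (Suc n)" for i j
  proof (rule cochain_eqI[where C = U and a = a and n = "Suc (Suc n)"])
    fix \<sigma> xs assume s: "\<sigma> \<in> simplices U a (Suc (Suc n))" and xs: "xs \<in> arguments a \<sigma>"
    obtain Us us As where \<sigma>: "\<sigma> = (Us, us, As)" by (cases \<sigma>)
    show "coface U a M (Suc n) j (coface U a M n i \<phi>) \<sigma> xs = coface U a M (Suc n) i (coface U a M n (j - 1) \<phi>) \<sigma> xs"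
      unfolding coface_eq[OF s xs] using s xs unfolding \<sigma> by (rule cosimplicial_identity[OF \<phi> _ _ that])
  qed (auto simp: coface_def)
  have "Diff HC n \<phi> \<in> carrier (cochains k U a M (Suc n))"
    using linear_maps_closed[OF differential_linear \<phi>] .
  then have "Diff HC (Suc n) (Diff HC n \<phi>) = (\<Oplus>\<^bsub>cochains k U a M (Suc (Suc n))\<^esub> j\<in>{..Suc (Suc n)}.
      signed (cochains k U a M (Suc (Suc n))) (Suc (Suc n) - j) (coface U a M (Suc n) j (Diff HC n \<phi>)))"
    by (rule differential_eq_alternating_sum)
  also have "\<dots> = \<zero>\<^bsub>cochains k U a M (Suc (Suc n))\<^esub>"
    unfolding differential_eq_alternating_sum[OF \<phi>]
    by (rule alternating_sum_square_zero[where k = k and d = "coface U a M n" and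
          e = "coface U a M (Suc n)" and A = "cochains k U a M n", OF cochains_module cochains_module
          cochains_module coface_linear coface_linear cos \<phi>])
  finally show ?thesis .
qed

theorem hochschild_is_complex: "is_complex k HC"
  using cochains_module differential_linear differential_squared by (simp add: is_complex_def)

end


section \<open>Quotients of complexes\<close>

text \<open>
  All module axioms are equations or existence statements that pass to the image of a linear
  surjection. That zero goes to zero has to be assumed: the record \<open>N\<close> might name a wrong zero element.
\<close>

lemma module_image:
  assumes M: "module k M" and f: "f \<in> linear_maps k M N" and zero: "f \<zero>\<^bsub>M\<^esub> = \<zero>\<^bsub>N\<^esub>"
    and surj: "f ` carrier M = carrier N"
  shows "module k N"
proof -
  interpret M: module k M by fact
  note add = linear_maps_add[OF f, symmetric] and smult = linear_maps_smult[OF f, symmetric]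
  have ex: "\<exists>y\<in>carrier M. x = f y" if "x \<in> carrier N" for x
    using that surj by auto
  have cl: "f x \<in> carrier N" if "x \<in> carrier M" for x
    using that surj by auto
  show ?thesis
  proof (intro moduleI abelian_groupI)
    show "cring k" by (rule M.R.is_cring)
    show "\<zero>\<^bsub>N\<^esub> \<in> carrier N" using cl[of "\<zero>\<^bsub>M\<^esub>"] zero by simp
  next
    fix x assume "x \<in> carrier N"
    then obtain x' where x: "x' \<in> carrier M" "x = f x'" using ex by auto
    show "\<zero>\<^bsub>N\<^esub> \<oplus>\<^bsub>N\<^esub> x = x"
      using x by (simp add: add zero[symmetric])
    show "\<exists>y\<in>carrier N. y \<oplus>\<^bsub>N\<^esub> x = \<zero>\<^bsub>N\<^esub>"
      using x by (intro bexI[of _ "f (\<ominus>\<^bsub>M\<^esub> x')"]) (simp_all add: add M.l_neg zero cl)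
    show "\<one>\<^bsub>k\<^esub> \<odot>\<^bsub>N\<^esub> x = x"
      using x by (simp add: smult)
    fix y assume "y \<in> carrier N"
    then obtain y' where y: "y' \<in> carrier M" "y = f y'" using ex by auto
    show "x \<oplus>\<^bsub>N\<^esub> y \<in> carrier N" "x \<oplus>\<^bsub>N\<^esub> y = y \<oplus>\<^bsub>N\<^esub> x"
      using x y by (simp_all add: add cl M.M.a_comm)
    show "c \<odot>\<^bsub>N\<^esub> (x \<oplus>\<^bsub>N\<^esub> y) = c \<odot>\<^bsub>N\<^esub> x \<oplus>\<^bsub>N\<^esub> c \<odot>\<^bsub>N\<^esub> y" if "c \<in> carrier k" for c
      using x y that by (simp add: add smult M.smult_r_distr)
    fix z assume "z \<in> carrier N"
    then obtain z' where z: "z' \<in> carrier M" "z = f z'" using ex by auto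
    show "x \<oplus>\<^bsub>N\<^esub> y \<oplus>\<^bsub>N\<^esub> z = x \<oplus>\<^bsub>N\<^esub> (y \<oplus>\<^bsub>N\<^esub> z)"
      using x y z by (simp add: add M.M.a_assoc)
  next
    fix c x assume c: "c \<in> carrier k" and "x \<in> carrier N"
    then obtain x' where x: "x' \<in> carrier M" "x = f x'" using ex by auto
    show "c \<odot>\<^bsub>N\<^esub> x \<in> carrier N"
      using x c by (simp add: smult cl)
    fix b assume b: "b \<in> carrier k"
    show "(c \<oplus>\<^bsub>k\<^esub> b) \<odot>\<^bsub>N\<^esub> x = c \<odot>\<^bsub>N\<^esub> x \<oplus>\<^bsub>N\<^esub> b \<odot>\<^bsub>N\<^esub> x"
      using x c b by (simp add: add smult M.smult_l_distr)
    show "(c \<otimes>\<^bsub>k\<^esub> b) \<odot>\<^bsub>N\<^esub> x = c \<odot>\<^bsub>N\<^esub> (b \<odot>\<^bsub>N\<^esub> x)"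
      using x c b by (simp add: smult M.smult_assoc1)
  qed
qed

text \<open>
  A surjection onto \<open>D\<close> that is compatible with all operations transports the axioms of a complex
  from \<open>C\<close> to \<open>D\<close>. This is how the complexes over \<open>V\<close> and with coefficients in \<open>M\<^sub>V\<close> are obtained.
\<close>

locale quotient_of_complex =
  fixes k :: "('k, 'r) ring_scheme" and C :: "('k, 'c) cochain_complex"
    and D :: "('k, 'd) cochain_complex" and f :: "nat \<Rightarrow> 'c \<Rightarrow> 'd"
  assumes complex: "is_complex k C"
    and linear: "f n \<in> linear_maps k (Deg C n) (Deg D n)"
    and zero: "f n \<zero>\<^bsub>Deg C n\<^esub> = \<zero>\<^bsub>Deg D n\<^esub>"
    and ext: "f n \<in> extensional (carrier (Deg C n))"
    and surj: "f n ` carrier (Deg C n) = carrier (Deg D n)"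
    and commutes: "x \<in> carrier (Deg C n) \<Longrightarrow> f (Suc n) (Diff C n x) = Diff D n (f n x)"
begin

lemma source_complex: "module k (Deg C n)" "Diff C n \<in> linear_maps k (Deg C n) (Deg C (Suc n))"
  "x \<in> carrier (Deg C n) \<Longrightarrow> Diff C (Suc n) (Diff C n x) = \<zero>\<^bsub>Deg C (Suc (Suc n))\<^esub>"
  using complex by (auto simp: is_complex_def)

lemma quotient_module: "module k (Deg D n)"
  by (rule module_image[OF source_complex(1) linear zero surj])

lemma lift:
  assumes "y \<in> carrier (Deg D n)"
  obtains x where "x \<in> carrier (Deg C n)" "y = f n x"
  using assms surj[of n] by auto

lemma f_closed: "x \<in> carrier (Deg C n) \<Longrightarrow> f n x \<in> carrier (Deg D n)"
  using linear_maps_closed[OF linear] .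

lemma Diff_closed: "x \<in> carrier (Deg C n) \<Longrightarrow> Diff C n x \<in> carrier (Deg C (Suc n))"
  using linear_maps_closed[OF source_complex(2)] .

lemma quotient_complex: "is_complex k D"
  unfolding is_complex_def
proof (intro allI conjI ballI)
  fix n
  interpret C: module k "Deg C n" by (rule source_complex)
  show "module k (Deg D n)" by (rule quotient_module)
  show "Diff D (Suc n) (Diff D n y) = \<zero>\<^bsub>Deg D (Suc (Suc n))\<^esub>" if "y \<in> carrier (Deg D n)" for y
    using that
  proof (rule lift)
    fix x assume x: "x \<in> carrier (Deg C n)" "y = f n x"
    then show ?thesis
      using commutes[OF x(1)] commutes[OF Diff_closed[OF x(1)]] source_complex(3)[OF x(1)] zero by simp
  qed
  have cl: "Diff D n (f n x) \<in> carrier (Deg D (Suc n))" if "x \<in> carrier (Deg C n)" for x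
    using f_closed[OF Diff_closed[OF that]] commutes[OF that] by simp
  have add: "Diff D n (f n x \<oplus>\<^bsub>Deg D n\<^esub> f n y) = Diff D n (f n x) \<oplus>\<^bsub>Deg D (Suc n)\<^esub> Diff D n (f n y)"
    if "x \<in> carrier (Deg C n)" "y \<in> carrier (Deg C n)" for x y
  proof -
    have "Diff D n (f n x \<oplus>\<^bsub>Deg D n\<^esub> f n y) = f (Suc n) (Diff C n (x \<oplus>\<^bsub>Deg C n\<^esub> y))"
      using that commutes[of "x \<oplus>\<^bsub>Deg C n\<^esub> y" n] by (simp add: linear_maps_add[OF linear])
    then show ?thesis
      using that
      by (simp add: linear_maps_add[OF source_complex(2)] linear_maps_add[OF linear] Diff_closed commutes)
  qed
  have smult: "Diff D n (c \<odot>\<^bsub>Deg D n\<^esub> f n x) = c \<odot>\<^bsub>Deg D (Suc n)\<^esub> Diff D n (f n x)"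
    if "c \<in> carrier k" "x \<in> carrier (Deg C n)" for c x
  proof -
    have "Diff D n (c \<odot>\<^bsub>Deg D n\<^esub> f n x) = f (Suc n) (Diff C n (c \<odot>\<^bsub>Deg C n\<^esub> x))"
      using that commutes[of "c \<odot>\<^bsub>Deg C n\<^esub> x" n] by (simp add: linear_maps_smult[OF linear])
    then show ?thesis
      using that
      by (simp add: linear_maps_smult[OF source_complex(2)] linear_maps_smult[OF linear] Diff_closed commutes)
  qed
  show "Diff D n \<in> linear_maps k (Deg D n) (Deg D (Suc n))"
    using cl add smult unfolding linear_maps_def surj[of n, symmetric] by auto
qed

abbreviation K where "K n \<equiv> a_kernel (Deg C n) (Deg D n) (f n)"

lemma kernel_submodule: "submodule (K n) k (Deg C n)"
proof -
  interpret C: module k "Deg C n" by (rule source_complex)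
  interpret D: module k "Deg D n" by (rule quotient_module)
  show ?thesis
    by (rule C.submoduleI)
      (auto simp: a_kernel_def' zero linear_maps_add[OF linear] linear_maps_smult[OF linear]
        linear_maps_minus[OF source_complex(1) quotient_module linear])
qed

lemma kernel_closed: "x \<in> K n \<Longrightarrow> Diff C n x \<in> K (Suc n)"
  using commutes[of x n] zero linear_maps_zero[OF quotient_module quotient_module, of "Diff D n"] quotient_complex
  by (auto simp: a_kernel_def' Diff_closed is_complex_def)

lemma kernel_is_complex: "is_complex k (kernel_complex C D f)"
proof -
  have "module k ((Deg C n)\<lparr>carrier := K n\<rparr>)" for n
    using submodule.submodule_is_module[OF kernel_submodule source_complex(1)] .
  moreover have "restrict (Diff C n) (K n) \<in>
      linear_maps k ((Deg C n)\<lparr>carrier := K n\<rparr>) ((Deg C (Suc n))\<lparr>carrier := K (Suc n)\<rparr>)" for n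
  proof -
    have "x \<oplus>\<^bsub>Deg C n\<^esub> y \<in> K n" if "x \<in> K n" "y \<in> K n" for x y
      using module.submoduleE(5)[OF source_complex(1) kernel_submodule] that .
    moreover have "c \<odot>\<^bsub>Deg C n\<^esub> x \<in> K n" if "c \<in> carrier k" "x \<in> K n" for c x
      using module.submoduleE(4)[OF source_complex(1) kernel_submodule] that .
    moreover have "K n \<subseteq> carrier (Deg C n)"
      by (auto simp: a_kernel_def')
    ultimately show ?thesis
      using kernel_closed[of _ n] linear_maps_add[OF source_complex(2)[of n]] linear_maps_smult[OF source_complex(2)[of n]]
      by (auto simp: linear_maps_def subset_iff)
  qed
  moreover have "Diff C (Suc n) (Diff C n x) = \<zero>\<^bsub>Deg C (Suc (Suc n))\<^esub>" if "x \<in> K n" for x n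
    using that source_complex(3)[of x n] by (simp add: a_kernel_def')
  ultimately show ?thesis
    using kernel_closed by (simp add: is_complex_def kernel_complex_def)
qed

abbreviation kernel_sequence where
  "kernel_sequence \<equiv> \<lparr>Sub = kernel_complex C D f, Mid = C, Quo = D,
     Inc = identity_chain_map (kernel_complex C D f), Prj = f\<rparr>"

lemma Deg_kernel [simp]: "carrier (Deg (kernel_complex C D f) n) = K n"
  by (simp add: kernel_complex_def)

lemma short_exact_kernel_sequence: "short_exact k kernel_sequence"
proof -
  have sub: "K n \<subseteq> carrier (Deg C n)" for n
    by (auto simp: a_kernel_def')
  have "identity_chain_map (kernel_complex C D f) \<in> chain_maps k (kernel_complex C D f) C"
    using kernel_closed sub
      module.submoduleE(4,5)[OF source_complex(1) kernel_submodule]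
    by (auto simp: chain_maps_def identity_chain_map_def linear_maps_def kernel_complex_def subset_iff)
  moreover have "f \<in> chain_maps k C D"
    using linear ext commutes by (simp add: chain_maps_def)
  ultimately show ?thesis
    using complex quotient_complex kernel_is_complex surj
    by (auto simp: short_exact_def identity_chain_map_def inj_on_def image_def)
qed

lemma f_eq_iff:
  assumes x: "x \<in> carrier (Deg C n)" and y: "y \<in> carrier (Deg C n)"
  shows "f n x = f n y \<longleftrightarrow> x \<ominus>\<^bsub>Deg C n\<^esub> y \<in> K n"
proof -
  interpret C: module k "Deg C n" by (rule source_complex)
  interpret D: module k "Deg D n" by (rule quotient_module)
  have "f n (x \<ominus>\<^bsub>Deg C n\<^esub> y) = f n x \<ominus>\<^bsub>Deg D n\<^esub> f n y"
    using x y by (simp add: a_minus_def linear_maps_add[OF linear] linear_maps_minus[OF source_complex(1) quotient_module linear])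
  moreover have "u \<ominus>\<^bsub>Deg D n\<^esub> v = \<zero>\<^bsub>Deg D n\<^esub> \<longleftrightarrow> u = v" if "u \<in> carrier (Deg D n)" "v \<in> carrier (Deg D n)" for u v
    using that D.minus_equality[of u "\<ominus>\<^bsub>Deg D n\<^esub> v"] by (auto simp: a_minus_def D.r_neg)
  ultimately show ?thesis
    using x y f_closed by (simp add: a_kernel_def')
qed

end

lemma chain_maps_extensional:
  "\<alpha> \<in> chain_maps k C D \<Longrightarrow> \<alpha> n \<in> extensional (carrier (Deg C n))"
  by (simp add: chain_maps_def)

lemma identity_chain_iso:
  assumes "is_complex k C"
  shows "identity_chain_map C \<in> chain_isos k C C"
proof -
  have mod: "module k (Deg C n)" and d: "Diff C n \<in> linear_maps k (Deg C n) (Deg C (Suc n))" for n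
    using assms by (simp_all add: is_complex_def)
  have "(\<lambda>x. x) \<in> linear_maps k (Deg C n) (Deg C n)" for n
    by (simp add: linear_maps_def)
  moreover have "identity_chain_map C n \<in> linear_maps k (Deg C n) (Deg C n) \<longleftrightarrow>
      (\<lambda>x. x) \<in> linear_maps k (Deg C n) (Deg C n)" for n
    by (rule linear_maps_cong[OF mod]) (simp add: identity_chain_map_def)
  moreover have "bij_betw (identity_chain_map C n) (carrier (Deg C n)) (carrier (Deg C n))" for n
    by (rule bij_betw_cong[THEN iffD1, OF _ bij_betw_id]) (simp add: identity_chain_map_def)
  ultimately show ?thesis
    using linear_maps_closed[OF d]
    by (simp add: chain_isos_def chain_maps_def) (simp add: identity_chain_map_def)
qed

text \<open>
  Lifting along \<open>f\<close> and applying \<open>g\<close> is well defined and injective because \<open>f\<close> and \<open>g\<close> identify the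
  same elements. Uniqueness holds since \<open>f\<close> is surjective and the inclusion of the kernel is
  injective; chain maps being extensional, they are then equal as functions.
\<close>

lemma quotients_with_same_kernel:
  assumes f: "quotient_of_complex k C D f" and g: "quotient_of_complex k C E g"
    and ker: "\<And>n. a_kernel (Deg C n) (Deg D n) (f n) = a_kernel (Deg C n) (Deg E n) (g n)"
  shows "\<exists>!(\<alpha>, \<gamma>). (\<alpha>, identity_chain_map C, \<gamma>) \<in> sequence_isos k
    (quotient_of_complex.kernel_sequence C D f) (quotient_of_complex.kernel_sequence C E g)"
proof -
  interpret f: quotient_of_complex k C D f by fact
  interpret g: quotient_of_complex k C E g by fact
  have Keq: "kernel_complex C D f = kernel_complex C E g"
    by (simp add: kernel_complex_def ker)
  let ?K = "kernel_complex C E g"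
  have eq: "f n x = f n y \<longleftrightarrow> g n x = g n y" if "x \<in> carrier (Deg C n)" "y \<in> carrier (Deg C n)" for n x y
    using f.f_eq_iff[OF that] g.f_eq_iff[OF that] ker by simp
  define \<gamma> where "\<gamma> = (\<lambda>n. \<lambda>y\<in>carrier (Deg D n). g n (inv_into (carrier (Deg C n)) (f n) y))"
  have \<gamma>: "\<gamma> n (f n x) = g n x" if x: "x \<in> carrier (Deg C n)" for n x
  proof -
    have "f n x \<in> f n ` carrier (Deg C n)" using x by blast
    then have "f n (inv_into (carrier (Deg C n)) (f n) (f n x)) = f n x"
      "inv_into (carrier (Deg C n)) (f n) (f n x) \<in> carrier (Deg C n)"
      by (auto intro: f_inv_into_f inv_into_into)
    then show ?thesis
      using eq x f.f_closed[OF x] by (simp add: \<gamma>_def)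
  qed
  have "\<gamma> n \<in> linear_maps k (Deg D n) (Deg E n)" for n
  proof -
    interpret C: module k "Deg C n" by (rule f.source_complex)
    have "\<gamma> n (f n x \<oplus>\<^bsub>Deg D n\<^esub> f n y) = \<gamma> n (f n x) \<oplus>\<^bsub>Deg E n\<^esub> \<gamma> n (f n y)"
      if "x \<in> carrier (Deg C n)" "y \<in> carrier (Deg C n)" for x y
      using that \<gamma>[of "x \<oplus>\<^bsub>Deg C n\<^esub> y" n]
      by (simp add: \<gamma> linear_maps_add[OF f.linear] linear_maps_add[OF g.linear])
    moreover have "\<gamma> n (c \<odot>\<^bsub>Deg D n\<^esub> f n x) = c \<odot>\<^bsub>Deg E n\<^esub> \<gamma> n (f n x)"
      if "c \<in> carrier k" "x \<in> carrier (Deg C n)" for c x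
      using that \<gamma>[of "c \<odot>\<^bsub>Deg C n\<^esub> x" n]
      by (simp add: \<gamma> linear_maps_smult[OF f.linear] linear_maps_smult[OF g.linear])
    ultimately show ?thesis
      unfolding linear_maps_def f.surj[of n, symmetric] by (auto simp: \<gamma> g.f_closed)
  qed
  moreover have "\<gamma> (Suc n) (Diff D n y) = Diff E n (\<gamma> n y)" if "y \<in> carrier (Deg D n)" for n y
    using that
  proof (rule f.lift)
    fix x assume x: "x \<in> carrier (Deg C n)" "y = f n x"
    then show ?thesis
      using \<gamma>[OF f.Diff_closed[OF x(1)]] by (simp add: f.commutes g.commutes \<gamma>)
  qed
  moreover have "bij_betw (\<gamma> n) (carrier (Deg D n)) (carrier (Deg E n))" for n
  proof (rule bij_betw_imageI)
    show "inj_on (\<gamma> n) (carrier (Deg D n))"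
      unfolding f.surj[of n, symmetric] by (auto simp: inj_on_def \<gamma> eq)
    have "\<gamma> n ` carrier (Deg D n) = g n ` carrier (Deg C n)"
      unfolding f.surj[of n, symmetric] image_image by (rule image_cong[OF refl \<gamma>])
    then show "\<gamma> n ` carrier (Deg D n) = carrier (Deg E n)"
      by (simp add: g.surj)
  qed
  ultimately have "\<gamma> \<in> chain_isos k D E"
    by (simp add: chain_isos_def chain_maps_def \<gamma>_def)
  moreover have "identity_chain_map C n (identity_chain_map ?K n x) = identity_chain_map ?K n (identity_chain_map ?K n x)"
    if "x \<in> carrier (Deg ?K n)" for n x
    using that by (simp add: identity_chain_map_def a_kernel_def')
  moreover have "\<gamma> n (f n x) = g n (identity_chain_map C n x)" if "x \<in> carrier (Deg C n)" for n x
    using that \<gamma> by (simp add: identity_chain_map_def)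
  ultimately have ex: "(identity_chain_map ?K, identity_chain_map C, \<gamma>)
      \<in> sequence_isos k f.kernel_sequence g.kernel_sequence"
    unfolding sequence_isos_def mem_Collect_eq prod.case complex_sequence.simps Keq
    using identity_chain_iso[OF g.kernel_is_complex] identity_chain_iso[OF f.complex] by blast
  have uniq: "\<alpha> = identity_chain_map ?K \<and> \<delta> = \<gamma>"
    if "(\<alpha>, identity_chain_map C, \<delta>) \<in> sequence_isos k f.kernel_sequence g.kernel_sequence" for \<alpha> \<delta>
  proof (intro conjI ext)
    have \<alpha>: "\<alpha> \<in> chain_isos k ?K ?K" and \<delta>: "\<delta> \<in> chain_isos k D E"
      and \<alpha>c: "\<And>n x. x \<in> carrier (Deg ?K n) \<Longrightarrow> identity_chain_map C n (identity_chain_map ?K n x) = identity_chain_map ?K n (\<alpha> n x)"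
      and \<delta>c: "\<And>n x. x \<in> carrier (Deg C n) \<Longrightarrow> \<delta> n (f n x) = g n (identity_chain_map C n x)"
      using that unfolding sequence_isos_def mem_Collect_eq prod.case complex_sequence.simps Keq by blast+
    fix n
    show "\<alpha> n x = identity_chain_map ?K n x" for x
    proof (cases "x \<in> carrier (Deg ?K n)")
      case True
      then have "\<alpha> n x \<in> carrier (Deg ?K n)"
        using \<alpha> by (auto simp: chain_isos_def bij_betw_def)
      then show ?thesis
        using \<alpha>c[OF True] True by (simp add: identity_chain_map_def a_kernel_def')
    next
      case False
      then show ?thesis
        using \<alpha> chain_maps_extensional[of \<alpha> k ?K ?K n]
        by (simp add: chain_isos_def identity_chain_map_def extensional_def)
    qed
    show "\<delta> n y = \<gamma> n y" for y
    proof (cases "y \<in> carrier (Deg D n)")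
      case True
      then show ?thesis
      proof (rule f.lift)
        fix x assume "x \<in> carrier (Deg C n)" "y = f n x"
        then show ?thesis
          using \<delta>c[of x n] \<gamma>[of x n] by (simp add: identity_chain_map_def)
      qed
    next
      case False
      then show ?thesis
        using \<delta> chain_maps_extensional[of \<delta> k D E n]
        by (simp add: chain_isos_def \<gamma>_def extensional_def)
    qed
  qed
  show ?thesis
  proof (rule ex1I[of _ "(identity_chain_map ?K, \<gamma>)"])
    show "case (identity_chain_map ?K, \<gamma>) of (\<alpha>, \<gamma>) \<Rightarrow> (\<alpha>, identity_chain_map C, \<gamma>)
        \<in> sequence_isos k f.kernel_sequence g.kernel_sequence"
      using ex by (simp only: prod.case)
    fix p assume "case p of (\<alpha>, \<gamma>) \<Rightarrow> (\<alpha>, identity_chain_map C, \<gamma>)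
        \<in> sequence_isos k f.kernel_sequence g.kernel_sequence"
    then show "p = (identity_chain_map ?K, \<gamma>)"
      using uniq[of "fst p" "snd p"] by (cases p) (simp only: prod.case fst_conv snd_conv)
  qed
qed


section \<open>Comparing Hochschild differentials\<close>

lemma product_module_cong:
  assumes "\<And>i. i \<in> I \<Longrightarrow> N i = N' i"
  shows "product_module I N = product_module I N'"
  using assms by (auto simp: product_module_def fun_eq_iff restrict_def intro!: PiE_cong)

text \<open>
  Hochschild differentials over different categories or with different coefficients are compared
  face by face.
\<close>

lemma hochschild_value_cong:
  assumes N: "module k (target C M (Us, us, As))"
    and T: "target C' M' (Us, us, As) = target C M (Us, us, As)"
    and s: "(Us, us, As) \<in> simplices C a (Suc n)" "(Us, us, As) \<in> simplices C' a' (Suc n)" and xs: "length xs = Suc n"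
    and cl: "\<And>j. j \<le> Suc n \<Longrightarrow> coface_value C a M n j \<phi> (Us, us, As) xs \<in> carrier (target C M (Us, us, As))"
    and eq: "\<And>j. j \<le> Suc n \<Longrightarrow> coface_value C' a' M' n j \<phi>' (Us, us, As) xs = coface_value C a M n j \<phi> (Us, us, As) xs"
  shows "hochschild_value C' a' M' n \<phi>' (Us, us, As) xs = hochschild_value C a M n \<phi> (Us, us, As) xs"
proof -
  interpret N: module k "target C M (Us, us, As)" by fact
  have "hochschild_value C' a' M' n \<phi>' (Us, us, As) xs =
    (\<Oplus>\<^bsub>target C M (Us, us, As)\<^esub> j\<in>{..Suc n}. signed (target C M (Us, us, As)) (Suc n - j)
       (coface_value C' a' M' n j \<phi>' (Us, us, As) xs))"
    using hochschild_value_eq_alternating_sum[of k C' M' Us us As a' n xs \<phi>', unfolded T, OF N s(2) xs]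
      eq cl by simp
  also have "\<dots> = (\<Oplus>\<^bsub>target C M (Us, us, As)\<^esub> j\<in>{..Suc n}. signed (target C M (Us, us, As)) (Suc n - j)
       (coface_value C a M n j \<phi> (Us, us, As) xs))"
    by (rule N.finsum_cong') (auto simp: eq intro!: signed_closed[OF N] cl)
  also have "\<dots> = hochschild_value C a M n \<phi> (Us, us, As) xs"
    by (rule hochschild_value_eq_alternating_sum[symmetric, OF N s(1) xs cl])
  finally show ?thesis .
qed

lemma hochschild_value_zero:
  assumes N: "module k (target C M (Us, us, As))"
    and s: "(Us, us, As) \<in> simplices C a (Suc n)" and xs: "length xs = Suc n"
    and eq: "\<And>j. j \<le> Suc n \<Longrightarrow> coface_value C a M n j \<phi> (Us, us, As) xs = \<zero>\<^bsub>target C M (Us, us, As)\<^esub>"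
  shows "hochschild_value C a M n \<phi> (Us, us, As) xs = \<zero>\<^bsub>target C M (Us, us, As)\<^esub>"
proof -
  interpret N: module k "target C M (Us, us, As)" by fact
  have "hochschild_value C a M n \<phi> (Us, us, As) xs =
    (\<Oplus>\<^bsub>target C M (Us, us, As)\<^esub> j\<in>{..Suc n}. signed (target C M (Us, us, As)) (Suc n - j)
       (coface_value C a M n j \<phi> (Us, us, As) xs))"
    by (rule hochschild_value_eq_alternating_sum[OF N s xs]) (simp add: eq)
  also have "\<dots> = (\<Oplus>\<^bsub>target C M (Us, us, As)\<^esub> j\<in>{..Suc n}. \<zero>\<^bsub>target C M (Us, us, As)\<^esub>)"
    by (rule N.finsum_cong') (auto simp: eq signed_def)
  finally show ?thesis by simp
qed

lemma zero_submodule_simps [simp]: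
  "carrier (zero_submodule N) = {\<zero>\<^bsub>N\<^esub>}" "add (zero_submodule N) = add N"
  "zero (zero_submodule N) = zero N" "smult (zero_submodule N) = smult N"
  by (simp_all add: zero_submodule_def)

lemma zero_submodule_is_module:
  assumes "module k N"
  shows "module k (zero_submodule N)"
proof -
  interpret N: module k N by fact
  have "submodule {\<zero>\<^bsub>N\<^esub>} k N"
    by (rule N.submoduleI) auto
  then show ?thesis
    unfolding zero_submodule_def using submodule.submodule_is_module assms by blast
qed

lemma zero_map_to_zero_submodule:
  "module k N \<Longrightarrow> (\<lambda>x. \<zero>\<^bsub>N\<^esub>) \<in> linear_maps k M (zero_submodule N)"
  using linear_maps_zero_map[OF zero_submodule_is_module] by simp

lemma linear_maps_from_zero_submodule:
  assumes "module k N" "f \<in> linear_maps k M (zero_submodule N)"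
  shows "f \<in> linear_maps k M N"
proof -
  interpret N: module k N by fact
  show ?thesis using assms(2) by (auto simp: linear_maps_def Pi_iff)
qed

section \<open>Degrees in the subcategory\<close>

locale decomposed_bimodule = bimodule k U a M
  for k :: "('k, 'r) ring_scheme"
    and U :: "('o, 'f) cat"
    and a :: "('k, 'o, 'f, 'x, 'a) graded_cat"
    and M :: "('k, 'f, 'x, 'a, 'm) bimod" +
  fixes Z :: "'f set" and V :: "('o, 'f) cat"
  assumes decomposition: "ideal_subcategory_decomposition U Z V"
begin

lemma V_category: "small_category V" and V_Obj: "Obj V \<subseteq> Obj U" and V_Mor: "Mor V \<subseteq> Mor U"
  and V_Dom: "\<And>f. f \<in> Mor V \<Longrightarrow> Dom V f = Dom U f" and V_Cod: "\<And>f. f \<in> Mor V \<Longrightarrow> Cod V f = Cod U f"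
  and V_Ident: "\<And>X. X \<in> Obj V \<Longrightarrow> Ident V X = Ident U X"
  and V_Comp: "\<And>f g. f \<in> Mor V \<Longrightarrow> g \<in> Mor V \<Longrightarrow> Dom V g = Cod V f \<Longrightarrow> Comp V g f = Comp U g f"
  using decomposition by (auto simp: ideal_subcategory_decomposition_def subcategory_def)

sublocale V: small_category V by (rule V_category)

lemma Z_iff: "f \<in> Mor U \<Longrightarrow> f \<in> Z \<longleftrightarrow> f \<notin> Mor V"
  using decomposition by (auto simp: ideal_subcategory_decomposition_def)

lemma Z_comp: "z \<in> Z \<Longrightarrow> u \<in> Mor U \<Longrightarrow> v \<in> Mor U \<Longrightarrow> Dom U u = Cod U z \<Longrightarrow> Dom U z = Cod U v \<Longrightarrow>
    Comp U u (Comp U z v) \<in> Z"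
  using decomposition by (auto simp: ideal_subcategory_decomposition_def cat_ideal_def)

text \<open>
  One direction is closure of \<open>V\<close> under composition. For the other one, a composite with a factor in
  \<open>Z\<close> lies in \<open>Z\<close>; the ideal property speaks of two-sided products, whence the identities.
\<close>

lemma Comp_in_V_iff:
  assumes f: "f \<in> Mor U" and g: "g \<in> Mor U" and fg: "Dom U g = Cod U f"
  shows "Comp U g f \<in> Mor V \<longleftrightarrow> f \<in> Mor V \<and> g \<in> Mor V"
proof
  assume "f \<in> Mor V \<and> g \<in> Mor V"
  then show "Comp U g f \<in> Mor V"
    using V.comp_closed[of f g] V_Comp[of f g] V_Dom V_Cod fg by simp
next
  assume c: "Comp U g f \<in> Mor V"
  have cU: "Comp U g f \<in> Mor U" using comp_closed[OF f g fg] .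
  have "Comp U g f \<in> Z" if "f \<in> Z"
    using Z_comp[OF that g ident_closed[OF dom_closed[OF f]] fg] comp_ident_right[OF f]
    by (simp add: cod_ident dom_closed f)
  moreover have "Comp U g f \<in> Z" if "g \<in> Z"
    using Z_comp[OF that ident_closed[OF cod_closed[OF g]] f _ fg] comp_ident_left[OF cU]
    by (simp add: dom_ident cod_closed g cod_comp f fg)
  ultimately show "f \<in> Mor V \<and> g \<in> Mor V"
    using c Z_iff[OF cU] Z_iff[OF f] Z_iff[OF g] by blast
qed

lemma Ident_in_V_iff:
  assumes "X \<in> Obj U"
  shows "Ident U X \<in> Mor V \<longleftrightarrow> X \<in> Obj V"
proof
  assume "Ident U X \<in> Mor V"
  then show "X \<in> Obj V"
    using V.dom_closed[of "Ident U X"] V_Dom[of "Ident U X"] dom_ident[OF assms] by simp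
next
  assume "X \<in> Obj V"
  then show "Ident U X \<in> Mor V"
    using V.ident_closed[of X] V_Ident[of X] by simp
qed

definition aV where "aV = restrict_graded_cat V a"
definition MV where "MV = restrict_bimod V M"

lemma composite_in_V_iff:
  assumes s: "(Us, us, As) \<in> simplices U a n"
  shows "composite U (Us, us, As) \<in> Mor V \<longleftrightarrow> Us ! 0 \<in> Obj V \<and> (\<forall>i<n. us ! i \<in> Mor V)"
proof -
  define w where "w = (\<lambda>i. foldl (\<lambda>w u. Comp U u w) (Ident U (hd Us)) (take i us))"
  have h: "hd Us = Us ! 0"
    using simplicesD(1)[OF s] by (cases Us) auto
  have "w i \<in> Mor V \<longleftrightarrow> Us ! 0 \<in> Obj V \<and> (\<forall>j<i. us ! j \<in> Mor V)" if "i \<le> n" for i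
    using that
  proof (induction i)
    case 0
    then show ?case
      using simplicesD(4)[OF s, of 0] by (simp add: w_def Ident_in_V_iff h)
  next
    case (Suc i)
    have "w (Suc i) = Comp U (us ! i) (w i)"
      using Suc.prems simplicesD(2)[OF s] by (simp add: w_def take_Suc_conv_app_nth)
    then show ?case
      using Suc composite_take[OF s, of i, folded w_def] simplicesD(6-8)[OF s, of i]
      by (simp add: Comp_in_V_iff w_def less_Suc_eq) blast
  qed
  from this[of n] show ?thesis
    using simplicesD(2)[OF s] by (simp add: w_def composite.simps)
qed

lemma V_simplices_iff:
  "\<sigma> \<in> simplices V aV n \<longleftrightarrow> \<sigma> \<in> simplices U a n \<and> composite U \<sigma> \<in> Mor V"
proof -
  obtain Us us As where \<sigma>: "\<sigma> = (Us, us, As)" by (cases \<sigma>)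
  have "(Us, us, As) \<in> simplices V aV n \<longleftrightarrow>
    (Us, us, As) \<in> simplices U a n \<and> Us ! 0 \<in> Obj V \<and> (\<forall>i<n. us ! i \<in> Mor V)"
  proof
    assume "(Us, us, As) \<in> simplices V aV n"
    then show "(Us, us, As) \<in> simplices U a n \<and> Us ! 0 \<in> Obj V \<and> (\<forall>i<n. us ! i \<in> Mor V)"
      using V_Obj V_Mor by (auto simp: simplices_def aV_def restrict_graded_cat_def V_Dom V_Cod)
  next
    assume r: "(Us, us, As) \<in> simplices U a n \<and> Us ! 0 \<in> Obj V \<and> (\<forall>i<n. us ! i \<in> Mor V)"
    note s = simplicesD[OF conjunct1[OF r]]
    have "Us ! i \<in> Obj V" if "i \<le> n" for i
    proof (cases i)
      case (Suc j)
      then show ?thesis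
        using r that V.cod_closed[of "us ! j"] s(8)[of j] by (simp add: V_Cod)
    qed (use r in simp)
    then show "(Us, us, As) \<in> simplices V aV n"
      using r s by (auto simp: simplices_def aV_def restrict_graded_cat_def V_Dom V_Cod)
  qed
  then show ?thesis
    using composite_in_V_iff \<sigma> by blast
qed

lemma V_simplex_parts:
  assumes "(Us, us, As) \<in> simplices V aV n" "i < n"
  shows "us ! i \<in> Mor V" "Dom V (us ! i) = Us ! i" "Cod V (us ! i) = Us ! Suc i"
  using simplicesD[OF assms(1)] assms(2) by auto

lemma composite_V:
  assumes s: "\<sigma> \<in> simplices V aV n"
  shows "composite V \<sigma> = composite U \<sigma>"
proof -
  obtain Us us As where \<sigma>: "\<sigma> = (Us, us, As)" by (cases \<sigma>)
  note s = s[unfolded \<sigma>]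
  have h: "hd Us = Us ! 0"
    using simplicesD(1)[OF s] by (cases Us) auto
  have "foldl (\<lambda>w u. Comp V u w) (Ident V (hd Us)) (take i us) =
      foldl (\<lambda>w u. Comp U u w) (Ident U (hd Us)) (take i us)" if "i \<le> n" for i
    using that
  proof (induction i)
    case 0
    then show ?case
      using simplicesD(4)[OF s, of 0] by (simp add: h V_Ident)
  next
    case (Suc i)
    then show ?case
      using simplicesD(2)[OF s] V.composite_take[OF s, of i] V_simplex_parts[OF s, of i]
      by (simp add: take_Suc_conv_app_nth V_Comp)
  qed
  from this[of n] show ?thesis
    using simplicesD(2)[OF s] by (simp add: \<sigma> composite.simps)
qed

lemma factors_V:
  assumes s: "\<sigma> \<in> simplices V aV n"
  shows "factors aV \<sigma> = factors a \<sigma>"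
proof -
  obtain Us us As where \<sigma>: "\<sigma> = (Us, us, As)" by (cases \<sigma>)
  note s = s[unfolded \<sigma>]
  show ?thesis
    using V_simplex_parts(1)[OF s] simplicesD(2)[OF s]
    by (simp add: \<sigma> factors.simps aV_def restrict_graded_cat_def)
qed

lemma target_V:
  assumes s: "\<sigma> \<in> simplices V aV n"
  shows "target V MV \<sigma> = target U M \<sigma>"
  using V_simplices_iff[of \<sigma> n] composite_V[OF s] s
  by (cases \<sigma>) (simp add: target.simps MV_def restrict_bimod_def)

lemma cochains_V:
  "cochains k V aV MV n = product_module (simplices V aV n) (\<lambda>\<sigma>. multilinear_module k (factors a \<sigma>) (target U M \<sigma>))"
  unfolding cochains_def by (rule product_module_cong) (simp add: factors_V target_V)

lemma drop_first_in_V: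
  assumes "(Us, us, As) \<in> simplices U a (Suc n)" "composite U (Us, us, As) \<in> Mor V"
  shows "composite U (drop_first (Us, us, As)) \<in> Mor V"
  using V.drop_first_simplex(1)[of Us us As aV n] assms V_simplices_iff by blast

lemma drop_last_in_V:
  assumes "(Us, us, As) \<in> simplices U a (Suc n)" "composite U (Us, us, As) \<in> Mor V"
  shows "composite U (drop_last (Us, us, As)) \<in> Mor V"
  using V.drop_last_simplex(1)[of Us us As aV n] assms V_simplices_iff by blast

lemma coface_value_closed:
  assumes "(Us, us, As) \<in> simplices U a (Suc n)" "xs \<in> arguments a (Us, us, As)" "j \<le> Suc n"
    "\<phi> \<in> carrier (cochains k U a M n)"
  shows "coface_value U a M n j \<phi> (Us, us, As) xs \<in> carrier (target U M (Us, us, As))"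
  using linear_maps_closed[OF coface_value_linear[OF assms(1-3)] assms(4)] .

lemma coface_value_V:
  assumes s: "(Us, us, As) \<in> simplices V aV (Suc n)" and j: "j \<le> Suc n"
  shows "coface_value V aV MV n j (restrict \<phi> (simplices V aV n)) (Us, us, As) xs = coface_value U a M n j \<phi> (Us, us, As) xs"
proof -
  have u: "us ! i \<in> Mor V" if "i \<le> n" for i
    using V_simplex_parts(1)[OF s] that by simp
  note df = V.drop_first_simplex(1)[OF s] and dl = V.drop_last_simplex(1)[OF s]
  consider "j = 0" | "j = Suc n" | i where "j = Suc i" "i < n"
    using j by (cases j) (auto simp: le_less)
  then show ?thesis
  proof cases
    case 1
    then show ?thesis
      using df u[of 0] V_simplices_iff[THEN iffD1, OF df]
      by (simp add: coface_value.simps composite_V[OF df] MV_def restrict_bimod_def)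
  next
    case 2
    then show ?thesis
      using dl u[of n] V_simplices_iff[THEN iffD1, OF dl]
      by (simp add: coface_value.simps composite_V[OF dl] MV_def restrict_bimod_def)
  next
    case 3
    have uu: "us ! i \<in> Mor V" "us ! Suc i \<in> Mor V" using u 3 by auto
    have "merge_at V i (Us, us, As) = merge_at U i (Us, us, As)"
      using V_Comp[OF uu] V_simplex_parts[OF s, of i] V_simplex_parts[OF s, of "Suc i"] 3
      by (simp add: merge_at.simps)
    moreover have "merge_args aV i (Us, us, As) xs = merge_args a i (Us, us, As) xs"
      using uu by (simp add: merge_args.simps aV_def restrict_graded_cat_def)
    ultimately show ?thesis
      using V.merge_at_simplex(1)[OF s 3(2)] 3 by (simp add: coface_value.simps)
  qed
qed

section \<open>Restriction to the subcategory\<close>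

abbreviation "R \<equiv> restriction_chain_map k U V a M"
abbreviation "HV \<equiv> hochschild_complex k V aV MV"

lemma V_simplices_subset: "simplices V aV n \<subseteq> simplices U a n"
  by (rule subsetI) (simp only: V_simplices_iff)

lemma R_eq: "\<phi> \<in> carrier (cochains k U a M n) \<Longrightarrow> R n \<phi> = restrict \<phi> (simplices V aV n)"
  by (simp add: restriction_chain_map_def aV_def)

lemma cochains_carrier:
  "carrier (cochains k U a M n) = (\<Pi>\<^sub>E \<sigma>\<in>simplices U a n. carrier (multilinear_module k (factors a \<sigma>) (target U M \<sigma>)))"
  by (simp add: cochains_def product_module_def)

lemma cochains_V_carrier:
  "carrier (cochains k V aV MV n) =
    (\<Pi>\<^sub>E \<sigma>\<in>simplices V aV n. carrier (multilinear_module k (factors a \<sigma>) (target U M \<sigma>)))"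
  unfolding cochains_V by (simp add: product_module_def)

lemma R_closed:
  assumes "\<phi> \<in> carrier (cochains k U a M n)"
  shows "R n \<phi> \<in> carrier (cochains k V aV MV n)"
  unfolding R_eq[OF assms] cochains_V_carrier restrict_PiE_iff
proof
  fix \<sigma> assume "\<sigma> \<in> simplices V aV n"
  then show "\<phi> \<sigma> \<in> carrier (multilinear_module k (factors a \<sigma>) (target U M \<sigma>))"
    using PiE_mem[OF assms[unfolded cochains_carrier], of \<sigma>] V_simplices_iff[of \<sigma> n] by simp
qed

text \<open>
  Surjectivity of the restriction: the factors of a product can be prescribed independently.
\<close>

lemma extend_by_zero:
  assumes \<psi>: "\<psi> \<in> carrier (cochains k V aV MV n)"
  defines "\<phi> \<equiv> (\<lambda>\<sigma>\<in>simplices U a n. if \<sigma> \<in> simplices V aV n then \<psi> \<sigma> else \<zero>\<^bsub>cochains k U a M n\<^esub> \<sigma>)"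
  shows "\<phi> \<in> carrier (cochains k U a M n)" "restrict \<phi> (simplices V aV n) = \<psi>"
proof -
  interpret C: module k "cochains k U a M n" by (rule cochains_module)
  show "\<phi> \<in> carrier (cochains k U a M n)"
    unfolding \<phi>_def cochains_carrier restrict_PiE_iff
  proof
    fix \<sigma> assume \<sigma>: "\<sigma> \<in> simplices U a n"
    show "(if \<sigma> \<in> simplices V aV n then \<psi> \<sigma> else \<zero>\<^bsub>cochains k U a M n\<^esub> \<sigma>)
        \<in> carrier (multilinear_module k (factors a \<sigma>) (target U M \<sigma>))"
    proof (cases "\<sigma> \<in> simplices V aV n")
      case True
      then show ?thesis
        using PiE_mem[OF \<psi>[unfolded cochains_V_carrier], of \<sigma>] by simp
    next
      case False
      then show ?thesis
        using PiE_mem[OF C.zero_closed[unfolded cochains_carrier], of \<sigma>] \<sigma> by simp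
    qed
  qed
  show "restrict \<phi> (simplices V aV n) = \<psi>"
  proof (rule extensionalityI[where A = "simplices V aV n"])
    fix \<sigma> assume \<sigma>: "\<sigma> \<in> simplices V aV n"
    then have "\<sigma> \<in> simplices U a n" by (simp only: V_simplices_iff)
    with \<sigma> show "restrict \<phi> (simplices V aV n) \<sigma> = \<psi> \<sigma>" by (simp add: \<phi>_def)
  qed (simp, rule cochain_extensional(1)[OF \<psi>])
qed

lemma restriction_is_quotient: "quotient_of_complex k HC HV R"
proof
  show "is_complex k HC" by (rule hochschild_is_complex)
  fix n
  have "R n \<in> linear_maps k (cochains k U a M n) (cochains k V aV MV n)"
  proof (rule linear_into_cochains[OF R_closed cochains_module])
    fix \<sigma> xs assume s: "\<sigma> \<in> simplices V aV n" and xs: "xs \<in> arguments aV \<sigma>"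
    have "\<sigma> \<in> simplices U a n" "xs \<in> arguments a \<sigma>"
      using s xs V_simplices_subset by (auto simp only: factors_V)
    then have "(\<lambda>\<phi>. \<phi> \<sigma> xs) \<in> linear_maps k (cochains k U a M n) (target V MV \<sigma>)"
      unfolding target_V[OF s] by (rule evaluation_linear)
    then show "(\<lambda>\<phi>. R n \<phi> \<sigma> xs) \<in> linear_maps k (cochains k U a M n) (target V MV \<sigma>)"
      using s by (subst linear_maps_cong[OF cochains_module, where g = "\<lambda>\<phi>. \<phi> \<sigma> xs"]) (simp_all add: R_eq)
  qed
  then show "R n \<in> linear_maps k (Deg HC n) (Deg HV n)"
    by (simp add: hochschild_complex_def)
  interpret C: module k "cochains k U a M n" by (rule cochains_module)
  have "restrict \<zero>\<^bsub>cochains k U a M n\<^esub> (simplices V aV n) \<sigma> = \<zero>\<^bsub>cochains k V aV MV n\<^esub> \<sigma>" for \<sigma>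
    using subsetD[OF V_simplices_subset[of n], of \<sigma>]
    by (cases "\<sigma> \<in> simplices V aV n") (simp_all add: cochains_record_simps target_V factors_V)
  then show "R n \<zero>\<^bsub>Deg HC n\<^esub> = \<zero>\<^bsub>Deg HV n\<^esub>"
    using R_eq[OF C.zero_closed] by (simp add: hochschild_complex_def fun_eq_iff)
  show "R n \<in> extensional (carrier (Deg HC n))"
    by (simp add: restriction_chain_map_def hochschild_complex_def)
  have "\<psi> \<in> R n ` carrier (cochains k U a M n)" if "\<psi> \<in> carrier (cochains k V aV MV n)" for \<psi>
    using R_eq[OF extend_by_zero(1)[OF that]] extend_by_zero(2)[OF that]
    by (intro image_eqI[OF _ extend_by_zero(1)[OF that]]) simp
  then have "R n ` carrier (cochains k U a M n) = carrier (cochains k V aV MV n)"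
    using R_closed by (intro equalityI subsetI) (auto simp only:)
  then show "R n ` carrier (Deg HC n) = carrier (Deg HV n)"
    by (simp add: hochschild_complex_def)
  fix \<phi> assume "\<phi> \<in> carrier (Deg HC n)"
  then have \<phi>: "\<phi> \<in> carrier (cochains k U a M n)" by (simp add: hochschild_complex_def)
  have d: "Diff HC n \<phi> \<in> carrier (cochains k U a M (Suc n))"
    using linear_maps_closed[OF differential_linear \<phi>] .
  have "restrict (Diff HC n \<phi>) (simplices V aV (Suc n)) = Diff HV n (R n \<phi>)"
  proof (rule cochain_eqI[where C = V and a = aV and n = "Suc n"])
    fix \<sigma> assume \<sigma>V: "\<sigma> \<in> simplices V aV (Suc n)"
    obtain Us us As where \<sigma>: "\<sigma> = (Us, us, As)" by (cases \<sigma>)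
    have sU: "\<sigma> \<in> simplices U a (Suc n)" using \<sigma>V V_simplices_subset by blast
    show "restrict (Diff HC n \<phi>) (simplices V aV (Suc n)) \<sigma> \<in> extensional (arguments aV \<sigma>)"
      using cochain_extensional(2)[OF d sU] \<sigma>V by (simp add: factors_V)
    fix xs assume xs: "xs \<in> arguments aV \<sigma>"
    have xs': "xs \<in> arguments a \<sigma>" using xs by (simp add: factors_V[OF \<sigma>V])
    have "hochschild_value V aV MV n (R n \<phi>) \<sigma> xs = hochschild_value U a M n \<phi> \<sigma> xs"
      unfolding \<sigma> R_eq[OF \<phi>]
    proof (rule hochschild_value_cong[OF target_module[OF sU[unfolded \<sigma>]] target_V[OF \<sigma>V[unfolded \<sigma>]]
          sU[unfolded \<sigma>] \<sigma>V[unfolded \<sigma>]])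
      show "length xs = Suc n"
        using xs'[unfolded \<sigma>] unfolding in_arguments[OF sU[unfolded \<sigma>]] by simp
    qed (rule coface_value_closed[OF sU[unfolded \<sigma>] xs'[unfolded \<sigma>] _ \<phi>], assumption,
        rule coface_value_V[OF \<sigma>V[unfolded \<sigma>]])
    then show "restrict (Diff HC n \<phi>) (simplices V aV (Suc n)) \<sigma> xs = Diff HV n (R n \<phi>) \<sigma> xs"
      using \<sigma>V sU xs xs' \<phi> R_closed[OF \<phi>] by (simp add: hochschild_complex_def)
  qed (use R_closed[OF \<phi>] in \<open>simp_all add: hochschild_complex_def\<close>)
  then show "R (Suc n) (Diff HC n \<phi>) = Diff HV n (R n \<phi>)"
    by (simp add: R_eq[OF d])
qed

text \<open>
  The kernel of the restriction, and also that of the projection to the quotient bimodule.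
\<close>

definition vanishing where
  "vanishing n = {\<phi> \<in> carrier (cochains k U a M n).
     \<forall>\<sigma>\<in>simplices U a n. composite U \<sigma> \<in> Mor V \<longrightarrow> (\<forall>xs\<in>arguments a \<sigma>. \<phi> \<sigma> xs = \<zero>\<^bsub>target U M \<sigma>\<^esub>)}"

lemma kernel_restriction: "a_kernel (cochains k U a M n) (cochains k V aV MV n) (R n) = vanishing n"
proof -
  have "restrict \<phi> (simplices V aV n) = \<zero>\<^bsub>cochains k V aV MV n\<^esub> \<longleftrightarrow>
     (\<forall>\<sigma>\<in>simplices U a n. composite U \<sigma> \<in> Mor V \<longrightarrow> (\<forall>xs\<in>arguments a \<sigma>. \<phi> \<sigma> xs = \<zero>\<^bsub>target U M \<sigma>\<^esub>))"
    (is "?L \<longleftrightarrow> ?R") if \<phi>: "\<phi> \<in> carrier (cochains k U a M n)" for \<phi>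
  proof
    assume L: ?L
    show ?R
    proof (intro ballI impI)
      fix \<sigma> xs assume "\<sigma> \<in> simplices U a n" "composite U \<sigma> \<in> Mor V" and xs: "xs \<in> arguments a \<sigma>"
      then have s: "\<sigma> \<in> simplices V aV n" using V_simplices_iff by blast
      show "\<phi> \<sigma> xs = \<zero>\<^bsub>target U M \<sigma>\<^esub>"
        using fun_cong[OF fun_cong[OF L, of \<sigma>], of xs] s xs
        by (simp add: cochains_record_simps factors_V target_V)
    qed
  next
    assume R: ?R
    show ?L
    proof (rule cochain_eqI[where C = V and a = aV and n = n])
      fix \<sigma> assume \<sigma>V: "\<sigma> \<in> simplices V aV n"
      then have sU: "\<sigma> \<in> simplices U a n" "composite U \<sigma> \<in> Mor V" using V_simplices_iff by blast+
      show "restrict \<phi> (simplices V aV n) \<sigma> \<in> extensional (arguments aV \<sigma>)"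
        using cochain_extensional(2)[OF \<phi> sU(1)] \<sigma>V by (simp add: factors_V)
      fix xs assume xs: "xs \<in> arguments aV \<sigma>"
      have xs': "xs \<in> arguments a \<sigma>" using xs by (simp add: factors_V[OF \<sigma>V])
      show "restrict \<phi> (simplices V aV n) \<sigma> xs = \<zero>\<^bsub>cochains k V aV MV n\<^esub> \<sigma> xs"
        using R sU \<sigma>V xs xs' by (simp add: cochains_record_simps target_V)
    qed (simp_all add: cochains_record_simps)
  qed
  then show ?thesis
    by (auto simp: a_kernel_def' vanishing_def R_eq)
qed

section \<open>Projection to the quotient bimodule\<close>

abbreviation "MQ \<equiv> quotient_bimod U V M"
abbreviation "HQ \<equiv> hochschild_complex k U a MQ"
abbreviation "P \<equiv> induced_chain_map k U a M (quotient_projection V M)"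

lemma target_quotient:
  "target U MQ \<sigma> = (if composite U \<sigma> \<in> Mor V then target U M \<sigma> else zero_submodule (target U M \<sigma>))"
  by (cases \<sigma>) (simp add: target.simps quotient_bimod_def)

lemma P_eq:
  assumes "\<phi> \<in> carrier (cochains k U a M n)"
  shows "P n \<phi> = (\<lambda>\<sigma>\<in>simplices U a n. \<lambda>xs\<in>arguments a \<sigma>.
    if composite U \<sigma> \<in> Mor V then \<phi> \<sigma> xs else \<zero>\<^bsub>target U M \<sigma>\<^esub>)"
  using assms
  by (auto simp: induced_chain_map_def quotient_projection_def target.simps fun_eq_iff restrict_def)

lemma quotient_target_module: "\<sigma> \<in> simplices U a n \<Longrightarrow> module k (target U MQ \<sigma>)"
  using target_module[of \<sigma> n] by (simp add: target_quotient zero_submodule_is_module)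

lemma update_arguments:
  assumes "(Us, us, As) \<in> simplices U a n" "xs \<in> arguments a (Us, us, As)" "i < n"
    "x \<in> carrier (GHom a (us ! i) (As ! i) (As ! Suc i))"
  shows "xs[i := x] \<in> arguments a (Us, us, As)"
  using assms(2-4) unfolding in_arguments[OF assms(1)] by (auto simp: nth_list_update)

lemma P_closed:
  assumes \<phi>: "\<phi> \<in> carrier (cochains k U a M n)"
  shows "P n \<phi> \<in> carrier (cochains k U a MQ n)"
  unfolding P_eq[OF \<phi>]
proof (rule cochainI)
  fix Us us As xs i
  assume s: "(Us, us, As) \<in> simplices U a n" and xs: "xs \<in> arguments a (Us, us, As)" and i: "i < n"
  have "(\<lambda>x. if composite U (Us, us, As) \<in> Mor V then \<phi> (Us, us, As) (xs[i := x]) else \<zero>\<^bsub>target U M (Us, us, As)\<^esub>)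
    \<in> linear_maps k (GHom a (us ! i) (As ! i) (As ! Suc i)) (target U MQ (Us, us, As))"
    using cochain_multilinear[OF \<phi> s xs i]
    by (simp add: target_quotient zero_map_to_zero_submodule target_module[OF s])
  then show "(\<lambda>x. (\<lambda>\<sigma>\<in>simplices U a n. \<lambda>xs\<in>arguments a \<sigma>.
      if composite U \<sigma> \<in> Mor V then \<phi> \<sigma> xs else \<zero>\<^bsub>target U M \<sigma>\<^esub>) (Us, us, As) (xs[i := x]))
    \<in> linear_maps k (GHom a (us ! i) (As ! i) (As ! Suc i)) (target U MQ (Us, us, As))"
    using s by (subst linear_maps_cong[OF factor_module[OF s i]]) (auto simp: update_arguments[OF s xs i])
qed (use cochain_closed[OF \<phi>] in \<open>auto simp: target_quotient\<close>)

text \<open>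
  The values of the quotient bimodule are contained in those of \<open>M\<close>, so a cochain with values in the
  quotient is its own lift.
\<close>

lemma quotient_cochain_lift:
  assumes \<psi>: "\<psi> \<in> carrier (cochains k U a MQ n)"
  shows "\<psi> \<in> carrier (cochains k U a M n)" "P n \<psi> = \<psi>"
proof -
  note cl = cochain_closed[OF \<psi>] and e = cochain_extensional[OF \<psi>]
  show *: "\<psi> \<in> carrier (cochains k U a M n)"
  proof (rule cochainI)
    show "\<psi> \<sigma> xs \<in> carrier (target U M \<sigma>)" if s: "\<sigma> \<in> simplices U a n" "xs \<in> arguments a \<sigma>" for \<sigma> xs
    proof -
      interpret T: module k "target U M \<sigma>" by (rule target_module[OF s(1)])
      show ?thesis using cl[OF s] by (auto simp: target_quotient split: if_splits)
    qed
    show "(\<lambda>x. \<psi> (Us, us, As) (xs[i := x])) \<in> linear_maps k (GHom a (us ! i) (As ! i) (As ! Suc i)) (target U M (Us, us, As))"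
      if s: "(Us, us, As) \<in> simplices U a n" "xs \<in> arguments a (Us, us, As)" "i < n" for Us us As xs i
      using cochain_multilinear[OF \<psi> s] linear_maps_from_zero_submodule[OF target_module[OF s(1)]]
      by (auto simp: target_quotient split: if_splits)
  qed (use e in auto)
  show "P n \<psi> = \<psi>"
    unfolding P_eq[OF *]
  proof (rule cochain_eqI[where C = U and a = a and n = n])
    fix \<sigma> xs assume s: "\<sigma> \<in> simplices U a n" "xs \<in> arguments a \<sigma>"
    show "(\<lambda>\<sigma>\<in>simplices U a n. \<lambda>xs\<in>arguments a \<sigma>.
        if composite U \<sigma> \<in> Mor V then \<psi> \<sigma> xs else \<zero>\<^bsub>target U M \<sigma>\<^esub>) \<sigma> xs = \<psi> \<sigma> xs"
      using cl[OF s] s by (simp add: target_quotient split: if_splits)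
  qed (use e in simp_all)
qed

text \<open>
  If \<open>|u| \<in> V\<close>, all faces of the simplex have composite in \<open>V\<close> too, so nothing has been discarded.
  Otherwise the actions of the quotient bimodule give zero in the outer faces, and the merged faces
  have the same composite \<open>|u|\<close>, where the projected cochain is zero.
\<close>

lemma coface_value_quotient:
  assumes s: "(Us, us, As) \<in> simplices U a (Suc n)" and xs: "xs \<in> arguments a (Us, us, As)"
    and j: "j \<le> Suc n" and \<phi>: "\<phi> \<in> carrier (cochains k U a M n)"
  shows "coface_value U a MQ n j (P n \<phi>) (Us, us, As) xs =
    (if composite U (Us, us, As) \<in> Mor V then coface_value U a M n j \<phi> (Us, us, As) xs
     else \<zero>\<^bsub>target U M (Us, us, As)\<^esub>)"
proof -
  consider "j = 0" | "j = Suc n" | i where "j = Suc i" "i < n"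
    using j by (cases j) (auto simp: le_less)
  then show ?thesis
  proof cases
    case 1
    then show ?thesis
      using drop_first_simplex[OF s] drop_first_arguments(1)[OF s xs] drop_first_in_V[OF s]
      by (simp add: coface_value.simps quotient_bimod_def P_eq[OF \<phi>] target_eq[OF s])
  next
    case 2
    then show ?thesis
      using drop_last_simplex[OF s] drop_last_arguments(1)[OF s xs] drop_last_in_V[OF s]
      by (simp add: coface_value.simps quotient_bimod_def P_eq[OF \<phi>] target_eq[OF s])
  next
    case 3
    then show ?thesis
      using merge_at_simplex[OF s 3(2)] merge_arguments[OF s 3(2) xs] merge_target[OF s 3(2)]
      by (simp add: coface_value.simps P_eq[OF \<phi>])
  qed
qed

lemma projection_is_quotient: "quotient_of_complex k HC HQ P"
proof
  show "is_complex k HC" by (rule hochschild_is_complex)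
  fix n
  have "P n \<in> linear_maps k (cochains k U a M n) (cochains k U a MQ n)"
  proof (rule linear_into_cochains[OF P_closed cochains_module])
    fix \<sigma> xs assume s: "\<sigma> \<in> simplices U a n" and xs: "xs \<in> arguments a \<sigma>"
    have "(\<lambda>\<phi>. if composite U \<sigma> \<in> Mor V then \<phi> \<sigma> xs else \<zero>\<^bsub>target U M \<sigma>\<^esub>)
        \<in> linear_maps k (cochains k U a M n) (target U MQ \<sigma>)"
      using evaluation_linear[OF s xs, of k M]
      by (simp add: target_quotient zero_map_to_zero_submodule target_module[OF s])
    then show "(\<lambda>\<phi>. P n \<phi> \<sigma> xs) \<in> linear_maps k (cochains k U a M n) (target U MQ \<sigma>)"
      using s xs by (subst linear_maps_cong[OF cochains_module]) (auto simp: P_eq)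
  qed
  then show "P n \<in> linear_maps k (Deg HC n) (Deg HQ n)"
    by (simp add: hochschild_complex_def)
  show "P n \<zero>\<^bsub>Deg HC n\<^esub> = \<zero>\<^bsub>Deg HQ n\<^esub>"
  proof -
    interpret C: module k "cochains k U a M n" by (rule cochains_module)
    show ?thesis
      using P_eq[OF C.zero_closed]
      by (auto simp: hochschild_complex_def cochains_record_simps target_quotient fun_eq_iff restrict_def)
  qed
  show "P n \<in> extensional (carrier (Deg HC n))"
    by (simp add: induced_chain_map_def hochschild_complex_def)
  have "\<psi> \<in> P n ` carrier (cochains k U a M n)" if "\<psi> \<in> carrier (cochains k U a MQ n)" for \<psi>
    using quotient_cochain_lift(2)[OF that] by (intro image_eqI[OF _ quotient_cochain_lift(1)[OF that]]) simp
  then have "P n ` carrier (cochains k U a M n) = carrier (cochains k U a MQ n)"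
    using P_closed by (intro equalityI subsetI) (auto simp only:)
  then show "P n ` carrier (Deg HC n) = carrier (Deg HQ n)"
    by (simp add: hochschild_complex_def)
  fix \<phi> assume "\<phi> \<in> carrier (Deg HC n)"
  then have \<phi>: "\<phi> \<in> carrier (cochains k U a M n)" by (simp add: hochschild_complex_def)
  have d: "Diff HC n \<phi> \<in> carrier (cochains k U a M (Suc n))"
    using linear_maps_closed[OF differential_linear \<phi>] .
  show "P (Suc n) (Diff HC n \<phi>) = Diff HQ n (P n \<phi>)"
    unfolding P_eq[OF d]
  proof (rule cochain_eqI[where C = U and a = a and n = "Suc n"])
    fix \<sigma> xs assume s: "\<sigma> \<in> simplices U a (Suc n)" and xs: "xs \<in> arguments a \<sigma>"
    obtain Us us As where \<sigma>: "\<sigma> = (Us, us, As)" by (cases \<sigma>)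
    note s' = s[unfolded \<sigma>] and xs' = xs[unfolded \<sigma>]
    have l: "length xs = Suc n" using xs' unfolding in_arguments[OF s'] by simp
    note cv = coface_value_quotient[OF s' xs' _ \<phi>]
    have "hochschild_value U a MQ n (P n \<phi>) \<sigma> xs =
        (if composite U \<sigma> \<in> Mor V then hochschild_value U a M n \<phi> \<sigma> xs else \<zero>\<^bsub>target U M \<sigma>\<^esub>)"
    proof (cases "composite U \<sigma> \<in> Mor V")
      case True
      have "hochschild_value U a MQ n (P n \<phi>) (Us, us, As) xs = hochschild_value U a M n \<phi> (Us, us, As) xs"
        by (rule hochschild_value_cong[OF target_module[OF s'] _ s' s' l])
          (use True cv coface_value_closed[OF s' xs' _ \<phi>] in \<open>auto simp: target_quotient \<sigma>\<close>)
      then show ?thesis using True by (simp add: \<sigma>)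
    next
      case False
      have "hochschild_value U a MQ n (P n \<phi>) (Us, us, As) xs = \<zero>\<^bsub>target U MQ (Us, us, As)\<^esub>"
        by (rule hochschild_value_zero[OF quotient_target_module[OF s'] s' l])
          (use False cv in \<open>auto simp: target_quotient \<sigma>\<close>)
      then show ?thesis using False by (simp add: \<sigma> target_quotient)
    qed
    then show "(\<lambda>\<sigma>\<in>simplices U a (Suc n). \<lambda>xs\<in>arguments a \<sigma>.
        if composite U \<sigma> \<in> Mor V then Diff HC n \<phi> \<sigma> xs else \<zero>\<^bsub>target U M \<sigma>\<^esub>) \<sigma> xs = Diff HQ n (P n \<phi>) \<sigma> xs"
      using s xs \<phi> P_closed[OF \<phi>] by (simp add: hochschild_complex_def)
  qed (use P_closed[OF \<phi>] in \<open>simp_all add: hochschild_complex_def\<close>)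
qed

lemma kernel_projection: "a_kernel (cochains k U a M n) (cochains k U a MQ n) (P n) = vanishing n"
proof -
  have "P n \<phi> = \<zero>\<^bsub>cochains k U a MQ n\<^esub> \<longleftrightarrow>
     (\<forall>\<sigma>\<in>simplices U a n. composite U \<sigma> \<in> Mor V \<longrightarrow> (\<forall>xs\<in>arguments a \<sigma>. \<phi> \<sigma> xs = \<zero>\<^bsub>target U M \<sigma>\<^esub>))"
    (is "?L \<longleftrightarrow> ?R") if \<phi>: "\<phi> \<in> carrier (cochains k U a M n)" for \<phi>
  proof
    assume L: ?L
    show ?R
    proof (intro ballI impI)
      fix \<sigma> xs assume s: "\<sigma> \<in> simplices U a n" "composite U \<sigma> \<in> Mor V" and xs: "xs \<in> arguments a \<sigma>"
      show "\<phi> \<sigma> xs = \<zero>\<^bsub>target U M \<sigma>\<^esub>"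
        using fun_cong[OF fun_cong[OF L, of \<sigma>], of xs] s xs
        by (simp add: cochains_record_simps P_eq[OF \<phi>] target_quotient)
    qed
  next
    assume R: ?R
    show ?L
      unfolding P_eq[OF \<phi>]
      by (rule cochain_eqI[where C = U and a = a and n = n])
        (use R in \<open>simp_all add: cochains_record_simps target_quotient\<close>)
  qed
  then show ?thesis
    by (auto simp: a_kernel_def' vanishing_def)
qed

section \<open>Coefficients in the sub-bimodule\<close>

abbreviation "MZ \<equiv> ideal_bimod Z M"
abbreviation "HZ \<equiv> hochschild_complex k U a MZ"

lemma target_ideal:
  assumes "\<sigma> \<in> simplices U a n"
  shows "target U MZ \<sigma> = (if composite U \<sigma> \<in> Mor V then zero_submodule (target U M \<sigma>) else target U M \<sigma>)"
proof -
  obtain Us us As where \<sigma>: "\<sigma> = (Us, us, As)" by (cases \<sigma>)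
  show ?thesis
    using Z_iff[OF composite_mor(1)[OF assms[unfolded \<sigma>]]] by (simp add: \<sigma> target.simps ideal_bimod_def)
qed

lemma cochains_ideal_carrier: "carrier (cochains k U a MZ n) = vanishing n"
proof (intro equalityI subsetI)
  fix \<phi> assume \<phi>: "\<phi> \<in> carrier (cochains k U a MZ n)"
  note cl = cochain_closed[OF \<phi>] and e = cochain_extensional[OF \<phi>]
  have "\<phi> \<in> carrier (cochains k U a M n)"
  proof (rule cochainI)
    show "\<phi> \<sigma> xs \<in> carrier (target U M \<sigma>)" if s: "\<sigma> \<in> simplices U a n" "xs \<in> arguments a \<sigma>" for \<sigma> xs
    proof -
      interpret T: module k "target U M \<sigma>" by (rule target_module[OF s(1)])
      show ?thesis using cl[OF s] by (auto simp: target_ideal[OF s(1)] split: if_splits)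
    qed
    show "(\<lambda>x. \<phi> (Us, us, As) (xs[i := x])) \<in> linear_maps k (GHom a (us ! i) (As ! i) (As ! Suc i)) (target U M (Us, us, As))"
      if s: "(Us, us, As) \<in> simplices U a n" "xs \<in> arguments a (Us, us, As)" "i < n" for Us us As xs i
      using cochain_multilinear[OF \<phi> s] linear_maps_from_zero_submodule[OF target_module[OF s(1)]]
      by (auto simp: target_ideal[OF s(1)] split: if_splits)
  qed (use e in auto)
  moreover have "\<phi> \<sigma> xs = \<zero>\<^bsub>target U M \<sigma>\<^esub>"
    if s: "\<sigma> \<in> simplices U a n" "composite U \<sigma> \<in> Mor V" "xs \<in> arguments a \<sigma>" for \<sigma> xs
    using cl[OF s(1,3)] s(2) by (simp add: target_ideal[OF s(1)])
  ultimately show "\<phi> \<in> vanishing n" by (simp add: vanishing_def)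
next
  fix \<phi> assume v: "\<phi> \<in> vanishing n"
  then have \<phi>: "\<phi> \<in> carrier (cochains k U a M n)" by (simp add: vanishing_def)
  have z: "\<phi> \<sigma> xs = \<zero>\<^bsub>target U M \<sigma>\<^esub>"
    if "\<sigma> \<in> simplices U a n" "composite U \<sigma> \<in> Mor V" "xs \<in> arguments a \<sigma>" for \<sigma> xs
    using v that by (simp add: vanishing_def)
  show "\<phi> \<in> carrier (cochains k U a MZ n)"
  proof (rule cochainI)
    show "\<phi> \<sigma> xs \<in> carrier (target U MZ \<sigma>)" if s: "\<sigma> \<in> simplices U a n" "xs \<in> arguments a \<sigma>" for \<sigma> xs
      using cochain_closed[OF \<phi> s] z[OF s(1) _ s(2)] by (simp add: target_ideal[OF s(1)])
    show "(\<lambda>x. \<phi> (Us, us, As) (xs[i := x])) \<in> linear_maps k (GHom a (us ! i) (As ! i) (As ! Suc i)) (target U MZ (Us, us, As))"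
      if s: "(Us, us, As) \<in> simplices U a n" "xs \<in> arguments a (Us, us, As)" "i < n" for Us us As xs i
    proof (cases "composite U (Us, us, As) \<in> Mor V")
      case True
      have "(\<lambda>x. \<zero>\<^bsub>target U M (Us, us, As)\<^esub>) \<in> linear_maps k (GHom a (us ! i) (As ! i) (As ! Suc i)) (target U MZ (Us, us, As))"
        using True
        by (simp add: target_ideal[OF s(1)] zero_map_to_zero_submodule target_module[OF s(1)])
      then show ?thesis
        by (subst linear_maps_cong[OF factor_module[OF s(1,3)]])
          (simp_all add: z[OF s(1) True] update_arguments[OF s])
    next
      case False
      then show ?thesis
        using cochain_multilinear[OF \<phi> s] by (simp add: target_ideal[OF s(1)])
    qed
  qed (use cochain_extensional[OF \<phi>] in auto)
qed

text \<open>
  The two records agree in all fields, since a zero submodule keeps the operations of the ambient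
  module.
\<close>

lemma cochains_ideal: "cochains k U a MZ n = (cochains k U a M n)\<lparr>carrier := vanishing n\<rparr>"
proof (rule module.equality)
  have z: "\<zero>\<^bsub>target U MZ \<sigma>\<^esub> = \<zero>\<^bsub>target U M \<sigma>\<^esub>" "add (target U MZ \<sigma>) = add (target U M \<sigma>)"
    "smult (target U MZ \<sigma>) = smult (target U M \<sigma>)" if "\<sigma> \<in> simplices U a n" for \<sigma>
    using target_ideal[OF that] by simp_all
  show "carrier (cochains k U a MZ n) = carrier ((cochains k U a M n)\<lparr>carrier := vanishing n\<rparr>)"
    by (simp add: cochains_ideal_carrier)
  show "mult (cochains k U a MZ n) = mult ((cochains k U a M n)\<lparr>carrier := vanishing n\<rparr>)"
    "one (cochains k U a MZ n) = one ((cochains k U a M n)\<lparr>carrier := vanishing n\<rparr>)"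
    by (simp_all add: cochains_def product_module_def)
  show "zero (cochains k U a MZ n) = zero ((cochains k U a M n)\<lparr>carrier := vanishing n\<rparr>)"
    "add (cochains k U a MZ n) = add ((cochains k U a M n)\<lparr>carrier := vanishing n\<rparr>)"
    "smult (cochains k U a MZ n) = smult ((cochains k U a M n)\<lparr>carrier := vanishing n\<rparr>)"
    by (auto simp: cochains_record_simps z fun_eq_iff restrict_def)
qed simp

lemma coface_value_ideal: "coface_value U a MZ n j \<phi> \<sigma> xs = coface_value U a M n j \<phi> \<sigma> xs"
  by (cases \<sigma>) (simp add: coface_value.simps ideal_bimod_def)

text \<open>
  The faces of a simplex with \<open>|u| \<in> V\<close> have composite in \<open>V\<close>, where the cochain vanishes.
\<close>

lemma coface_value_vanishing:
  assumes s: "(Us, us, As) \<in> simplices U a (Suc n)" and xs: "xs \<in> arguments a (Us, us, As)"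
    and j: "j \<le> Suc n" and v: "\<phi> \<in> vanishing n" and V: "composite U (Us, us, As) \<in> Mor V"
  shows "coface_value U a M n j \<phi> (Us, us, As) xs = \<zero>\<^bsub>target U M (Us, us, As)\<^esub>"
proof -
  have \<phi>: "\<phi> \<in> carrier (cochains k U a M n)" using v by (simp add: vanishing_def)
  have z: "\<phi> \<sigma> xs = \<zero>\<^bsub>target U M \<sigma>\<^esub>"
    if "\<sigma> \<in> simplices U a n" "composite U \<sigma> \<in> Mor V" "xs \<in> arguments a \<sigma>" for \<sigma> xs
    using v that by (simp add: vanishing_def)
  consider "j = 0" | "j = Suc n" | i where "j = Suc i" "i < n"
    using j by (cases j) (auto simp: le_less)
  then show ?thesis
  proof cases
    case 1
    note d = drop_first_simplex(1)[OF s] and x = drop_first_arguments[OF s xs]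
    show ?thesis
      using linear_maps_zero[OF target_module[OF d] target_module[OF s] bilinear_maps_left[OF ract_simplex[OF s] x(2)]] 1
      by (simp add: coface_value.simps z[OF d drop_first_in_V[OF s V] x(1)])
  next
    case 2
    note d = drop_last_simplex(1)[OF s] and x = drop_last_arguments[OF s xs]
    show ?thesis
      using linear_maps_zero[OF target_module[OF d] target_module[OF s] bilinear_maps_right[OF lact_simplex[OF s] x(2)]] 2
      by (simp add: coface_value.simps z[OF d drop_last_in_V[OF s V] x(1)])
  next
    case 3
    note d = merge_at_simplex[OF s 3(2)] and x = merge_arguments[OF s 3(2) xs]
    show ?thesis
      using z[OF d(1) _ x] d(2) V 3 by (simp add: coface_value.simps merge_target[OF s 3(2)])
  qed
qed

text \<open>
  For \<open>|u| \<notin> V\<close> both sides are computed in the same module. For \<open>|u| \<in> V\<close> the targets have different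
  carriers, hence the sums are a priori different, but both are sums of zeros.
\<close>

lemma hochschild_value_ideal:
  assumes s: "\<sigma> \<in> simplices U a (Suc n)" and xs: "xs \<in> arguments a \<sigma>" and v: "\<phi> \<in> vanishing n"
  shows "hochschild_value U a MZ n \<phi> \<sigma> xs = hochschild_value U a M n \<phi> \<sigma> xs"
proof -
  obtain Us us As where \<sigma>: "\<sigma> = (Us, us, As)" by (cases \<sigma>)
  note s = s[unfolded \<sigma>] and xs = xs[unfolded \<sigma>]
  have l: "length xs = Suc n" using xs unfolding in_arguments[OF s] by simp
  have \<phi>: "\<phi> \<in> carrier (cochains k U a M n)" using v by (simp add: vanishing_def)
  note tm = target_module[OF s]
  show ?thesis
  proof (cases "composite U \<sigma> \<in> Mor V")
    case True
    note cv = coface_value_vanishing[OF s xs _ v True[unfolded \<sigma>]]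
    have "hochschild_value U a M n \<phi> (Us, us, As) xs = \<zero>\<^bsub>target U M (Us, us, As)\<^esub>"
      by (rule hochschild_value_zero[OF tm s l cv])
    moreover have "hochschild_value U a MZ n \<phi> (Us, us, As) xs = \<zero>\<^bsub>target U MZ (Us, us, As)\<^esub>"
      by (rule hochschild_value_zero[OF _ s l])
        (use True zero_submodule_is_module[OF tm] cv in \<open>auto simp: \<sigma> target_ideal[OF s] coface_value_ideal\<close>)
    ultimately show ?thesis
      using True by (simp add: \<sigma> target_ideal[OF s])
  next
    case False
    then show ?thesis
      unfolding \<sigma>
      by (intro hochschild_value_cong[OF tm _ s s l])
        (auto simp: \<sigma> target_ideal[OF s] coface_value_ideal intro!: coface_value_closed[OF s xs _ \<phi>])
  qed
qed

lemma ideal_complex_is_kernel: "HZ = kernel_complex HC HQ P"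
proof -
  have "restrict (Diff HC n) (vanishing n) \<phi> = Diff HZ n \<phi>" for n \<phi>
  proof (cases "\<phi> \<in> vanishing n")
    case True
    have "\<phi> \<in> carrier (cochains k U a M n)"
      using True by (simp add: vanishing_def)
    moreover have "(\<lambda>\<sigma>\<in>simplices U a (Suc n). \<lambda>xs\<in>arguments a \<sigma>. hochschild_value U a M n \<phi> \<sigma> xs)
        = (\<lambda>\<sigma>\<in>simplices U a (Suc n). \<lambda>xs\<in>arguments a \<sigma>. hochschild_value U a MZ n \<phi> \<sigma> xs)"
      by (intro restrict_ext hochschild_value_ideal[OF _ _ True, symmetric])
    ultimately show ?thesis
      using True by (simp add: hochschild_complex_def cochains_ideal_carrier)
  next
    case False
    then show ?thesis by (simp add: hochschild_complex_def cochains_ideal_carrier)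
  qed
  then have "(\<lambda>n. restrict (Diff HC n) (vanishing n)) = Diff HZ"
    by - (rule HOL.ext, rule HOL.ext, simp only:)
  moreover have "(\<lambda>n. (cochains k U a M n)\<lparr>carrier := vanishing n\<rparr>) = Deg HZ"
    by (simp add: hochschild_complex_def cochains_ideal fun_eq_iff)
  moreover have "Deg HQ = cochains k U a MQ"
    by (simp add: hochschild_complex_def)
  ultimately show ?thesis
    by (simp add: kernel_complex_def kernel_projection)
qed

lemma ideal_inclusion_is_identity:
  "induced_chain_map k U a MZ ideal_inclusion = identity_chain_map HZ"
proof (rule HOL.ext, rule HOL.ext)
  fix n \<phi>
  show "induced_chain_map k U a MZ ideal_inclusion n \<phi> = identity_chain_map HZ n \<phi>"
  proof (cases "\<phi> \<in> carrier (cochains k U a MZ n)")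
    case True
    note e = cochain_extensional[OF True]
    have "(\<lambda>(Us, us, As)\<in>simplices U a n. \<lambda>xs\<in>arguments a (Us, us, As). \<phi> (Us, us, As) xs) \<sigma> = \<phi> \<sigma>" for \<sigma>
    proof (cases "\<sigma> \<in> simplices U a n")
      case True
      obtain Us us As where \<sigma>: "\<sigma> = (Us, us, As)" by (cases \<sigma>)
      show ?thesis
        using extensional_restrict[OF e(2)[OF True]] True by (simp add: \<sigma>)
    next
      case False
      then show ?thesis using extensional_arb[OF e(1) False] by simp
    qed
    then have "(\<lambda>(Us, us, As)\<in>simplices U a n. \<lambda>xs\<in>arguments a (Us, us, As). \<phi> (Us, us, As) xs) = \<phi>"
      by (rule HOL.ext)
    then show ?thesis
      using True by (simp add: induced_chain_map_def identity_chain_map_def hochschild_complex_def ideal_inclusion_def)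
  qed (simp add: induced_chain_map_def identity_chain_map_def hochschild_complex_def)
qed

lemma support_sequence_eq: "support_sequence k U V a M = quotient_of_complex.kernel_sequence HC HV R"
  by (simp add: support_sequence_def support_complex_def aV_def MV_def)

lemma coefficient_sequence_eq: "coefficient_sequence k U Z V a M = quotient_of_complex.kernel_sequence HC HQ P"
  by (simp add: coefficient_sequence_def ideal_inclusion_is_identity ideal_complex_is_kernel)

end

theorem proposition5p2:
  fixes k :: "('k, 'r) ring_scheme"
    and U V :: "('o, 'f) cat"
    and Z :: "'f set"
    and a :: "('k, 'o, 'f, 'x, 'a) graded_cat"
    and M :: "('k, 'f, 'x, 'a, 'm) bimod"
  assumes "cring k"
    and "small_category U"
    and "graded_category k U a"
    and "ideal_subcategory_decomposition U Z V"
    and "bimodule k U a M"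
  shows "short_exact k (support_sequence k U V a M) \<and>
         short_exact k (coefficient_sequence k U Z V a M) \<and>
         (\<exists>!(\<alpha>, \<gamma>).
            (\<alpha>, identity_chain_map (hochschild_complex k U a M), \<gamma>)
              \<in> sequence_isos k (support_sequence k U V a M) (coefficient_sequence k U Z V a M))"
proof -
  interpret decomposed_bimodule k U a M Z V
    using assms(4,5) by (intro decomposed_bimodule.intro decomposed_bimodule_axioms.intro)
  note r = restriction_is_quotient and p = projection_is_quotient
  have "a_kernel (Deg HC n) (Deg HV n) (R n) = a_kernel (Deg HC n) (Deg HQ n) (P n)" for n
    using kernel_restriction kernel_projection by (simp add: hochschild_complex_def)
  then show ?thesis
    using quotient_of_complex.short_exact_kernel_sequence[OF r]
      quotient_of_complex.short_exact_kernel_sequence[OF p] quotients_with_same_kernel[OF r p]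
    unfolding support_sequence_eq coefficient_sequence_eq by simp
qed

end
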